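(* Let $n,d\ge 1$ and let $v_1,\ldots,v_n\in\mathbb{R}^d$ satisfy $\|v_j\|_2\le 1$ for all $j$. Then there are signs $\varepsilon_1,\ldots,\varepsilon_n\in\{-1,1\}$ such that $$\Bigl\|\sum_{j=1}^n\varepsilon_jv_j\Bigr\|_\infty<3\pi .$$
   Context: $\|\cdot\|_2$ is the Euclidean norm and $\|\cdot\|_\infty$ the maximum absolute value of the coordinates on $\mathbb{R}^d$. *)

theory Defs
  imports "HOL-Analysis.Analysis"
begin

end

theory Submission
  imports Defs "HOL-Probability.Probability"
begin

text \<open>
  For a list \<open>L\<close> of weighted directions \<open>(v, c)\<close> let \<open>prin_eig L K\<close> be the norm of Gaussian smoothing
  with covariance \<open>\<Sum> 2 c v v\<^sup>T\<close>, compressed to \<open>L\<^sup>2(K)\<close>.  Call \<open>K\<close> good for \<open>V\<close> if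
  \<open>prin_eig L K \<ge> exp (- (\<Sum> c) / 36)\<close> whenever the directions of \<open>L\<close> lie in \<open>V\<close>.  The cube of
  half-side \<open>3\<pi>\<close> is good for every set of vectors of norm at most 1, because the product of the functions
  \<open>cos (y\<^sub>b / 6)\<close> (the square roots of the densities of least Fisher information on the interval)
  has shift correlation at least \<open>1 - \<bar>z\<bar>\<^sup>2 / 72\<close>, whatever the dimension.

  Vectors are eliminated one at a time.  For convex \<open>K\<close> let \<open>K\<^sub>p\<close> be the set of points \<open>y\<close> such that
  the part of \<open>K\<close> on \<open>y + [-3, 3] v\<close> has length at least \<open>2p\<close>.  Then \<open>y \<in> K\<^sub>1\<close> implies
  \<open>y + v \<in> K\<close> or \<open>y - v \<in> K\<close>, and if \<open>K\<close> is good for \<open>V \<union> {v}\<close>, then \<open>K\<^sub>1\<close> is good for \<open>V\<close>.  After all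
  vectors have been eliminated a nonempty symmetric convex set is left; it contains 0, and going back yields
  the signs.

  For the elimination step, \<open>K\<^sub>p\<close> is jointly convex in \<open>(y, p)\<close>, so \<open>p \<mapsto> prin_eig L K\<^sub>p\<close> is log-concave by
  the Prekopa--Leindler inequality for the survival probabilities of a Gaussian walk.  Let \<open>- x\<close> be a
  slope of its logarithm at \<open>p = 1\<close>.  Sorting the values of a near-extremal state \<open>f\<close> on \<open>K\<close> at equally
  spaced points of the window cannot decrease the quadratic form (rearrangement inequality), and an order statistic
  lives on a \<open>K\<^sub>p\<close> with \<open>p\<close> proportional to its rank.  If \<open>D\<close> is the Dirichlet energy of \<open>f\<close> in
  direction \<open>v\<close>, the mean of \<open>p\<close> is at least \<open>3/2 - 3 sqrt D\<close>.  Giving \<open>v\<close> a weight proportional to \<open>x\<close>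
  charges \<open>f\<close> for \<open>D\<close>, and \<open>(3 sqrt D - 1/2)\<^sup>2 \<ge> 0\<close> shows that the charge pays for the rise from
  \<open>prin_eig L K\<^sub>1\<close> to \<open>prin_eig L K\<^sub>p\<close> for \<open>p < 1\<close>.  The errors are of second order in \<open>L\<close>, and they
  disappear because \<open>(prin_eig (L/2) K)\<^sup>2 \<le> prin_eig L K\<close> allows \<open>L\<close> to be scaled down.
\<close>


section \<open>Log-concave functions\<close>

lemma emeasure_convex_real_le:
  fixes A :: "real set"
  assumes "A \<noteq> {}"
  shows "emeasure lborel A \<le> (SUP p\<in>A\<times>A. ennreal (snd p - fst p))"
proof (cases "(SUP p\<in>A\<times>A. ennreal (snd p - fst p)) = top")
  case True
  show ?thesis unfolding True by simp
next
  case False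
  then obtain r where r: "r \<ge> 0" "(SUP p\<in>A\<times>A. ennreal (snd p - fst p)) = ennreal r"
    by (cases "(SUP p\<in>A\<times>A. ennreal (snd p - fst p))") auto
  \<comment> \<open>With finite diameter \<open>r\<close> the set lies in the interval from
    \<open>Inf A\<close> to \<open>Inf A + r\<close>. Negative differences count as 0 in
    \<open>ennreal\<close>.\<close>
  have d: "y - x \<le> r" if "x \<in> A" "y \<in> A" for x y
  proof -
    have "ennreal (snd (x,y) - fst (x,y)) \<le> ennreal r"
      unfolding r(2)[symmetric] by (rule SUP_upper) (use that in auto)
    then show ?thesis using r(1) by (simp add: ennreal_le_iff2) linarith
  qed
  obtain x0 where x0: "x0 \<in> A" using assms by auto
  have bb: "bdd_below A" by (rule bdd_belowI[of _ "x0 - r"]) (use d[OF _ x0] in force)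
  have s: "y - r \<le> Inf A" if "y \<in> A" for y
    by (rule cInf_greatest) (use assms d that in force)+
  have "A \<subseteq> {Inf A .. Inf A + r}"
    using cInf_lower[OF _ bb] s by force
  then have "emeasure lborel A \<le> emeasure lborel {Inf A .. Inf A + r}"
    by (rule emeasure_mono) auto
  also have "\<dots> = r" using r(1) by simp
  finally show ?thesis using r by simp
qed

text \<open>Two segments in \<open>A\<close> and \<open>B\<close> combine to a segment in
  \<open>C\<close> whose length is the weighted sum of their lengths. Taking suprema over the end
  points gives the claim, so \<open>C\<close> may be any Borel set that contains the
  combinations.\<close>

lemma brunn_minkowski_convex_real:
  fixes A B C :: "real set"
  assumes A: "convex A" "A \<noteq> {}" and B: "convex B" "B \<noteq> {}" and C: "C \<in> sets borel"
    and m: "0 < m" "m < 1"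
    and sub: "\<And>x y. x \<in> A \<Longrightarrow> y \<in> B \<Longrightarrow> (1 - m) * x + m * y \<in> C"
  shows "ennreal (1 - m) * emeasure lborel A + ennreal m * emeasure lborel B \<le> emeasure lborel C"
proof -
  have main: "ennreal (1 - m) * ennreal (a1 - a0) + ennreal m * ennreal (b1 - b0) \<le> emeasure lborel C"
    if ab: "a0 \<in> A" "a1 \<in> A" "b0 \<in> B" "b1 \<in> B" for a0 a1 b0 b1
  proof -
    \<comment> \<open>If \<open>a1 < a0\<close>, the \<open>ennreal\<close> of the difference is 0.
      Replacing the right end point by the maximum keeps this value and orders the segment.\<close>
    define a1' b1' where "a1' = max a0 a1" and "b1' = max b0 b1"
    have ab': "a1' \<in> A" "b1' \<in> B" "a0 \<le> a1'" "b0 \<le> b1'"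
      using ab by (auto simp: a1'_def b1'_def max_def)
    have e: "ennreal (a1 - a0) = ennreal (a1' - a0)" "ennreal (b1 - b0) = ennreal (b1' - b0)"
      by (auto simp: a1'_def b1'_def max_def ennreal_neg)
    define l u where "l = (1 - m) * a0 + m * b0" and "u = (1 - m) * a1' + m * b1'"
    have lu: "l \<le> u" using ab' m by (auto simp: l_def u_def intro!: add_mono mult_left_mono)
    have "{l..u} \<subseteq> C"
    proof
      fix c assume c: "c \<in> {l..u}"
      define \<theta> where "\<theta> = (if l = u then 0 else (c - l) / (u - l))"
      have \<theta>: "0 \<le> \<theta>" "\<theta> \<le> 1" "c = l + \<theta> * (u - l)"
        using c lu by (auto simp: \<theta>_def divide_simps)
      have "(1 - \<theta>) *\<^sub>R a0 + \<theta> *\<^sub>R a1' \<in> A" "(1 - \<theta>) *\<^sub>R b0 + \<theta> *\<^sub>R b1' \<in> B"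
        using A(1) B(1) ab ab' \<theta> by (blast intro: convexD_alt)+
      from sub[OF this] show "c \<in> C"
        unfolding \<theta>(3) l_def u_def by (simp add: algebra_simps)
    qed
    then have "emeasure lborel {l..u} \<le> emeasure lborel C" using C by (intro emeasure_mono) auto
    also have "emeasure lborel {l..u} = ennreal ((1 - m) * (a1' - a0) + m * (b1' - b0))"
      using lu by (simp add: l_def u_def algebra_simps)
    finally show ?thesis using m ab' unfolding e
      by (simp add: ennreal_plus[symmetric] ennreal_mult[symmetric] del: ennreal_plus)
  qed
  have "ennreal (1 - m) * emeasure lborel A + ennreal m * emeasure lborel B
    \<le> ennreal (1 - m) * (SUP p\<in>A\<times>A. ennreal (snd p - fst p)) + ennreal m * (SUP p\<in>B\<times>B. ennreal (snd p - fst p))"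
    using A B by (intro add_mono mult_left_mono emeasure_convex_real_le) auto
  also have "\<dots> = (SUP p\<in>A\<times>A. SUP q\<in>B\<times>B. ennreal (1 - m) * ennreal (snd p - fst p) + ennreal m * ennreal (snd q - fst q))"
    using A B by (simp add: SUP_mult_left_ennreal ennreal_SUP_add_left ennreal_SUP_add_right SUP_commute[of _ "B \<times> B"])
  also have "\<dots> \<le> emeasure lborel C"
    by (intro SUP_least) (auto intro!: main)
  finally show ?thesis .
qed


text \<open>The levels are rescaled to the unit interval, so that two functions cut at different
  heights can be compared at the same relative level \<open>w\<close>.\<close>

lemma nn_integral_min_layer_cake:
  fixes f :: "real \<Rightarrow> ennreal" and \<alpha> :: real
  assumes [measurable]: "f \<in> borel_measurable borel" and a: "\<alpha> > 0"
  shows "(\<integral>\<^sup>+x. min (f x) (ennreal \<alpha>) \<partial>lborel)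
    = ennreal \<alpha> * (\<integral>\<^sup>+w. indicator {0<..<1} w * emeasure lborel {x. ennreal (\<alpha> * w) \<le> f x} \<partial>lborel)"
proof -
  have pt: "min y (ennreal \<alpha>) = ennreal \<alpha> * (\<integral>\<^sup>+w. indicator {0<..<1} w * indicator {w. ennreal (\<alpha> * w) \<le> y} w \<partial>lborel)" for y
  proof -
    have "(\<integral>\<^sup>+w. indicator {0<..<1} w * indicator {w. ennreal (\<alpha> * w) \<le> y} w \<partial>lborel)
      = (\<integral>\<^sup>+w. indicator ({0<..<1::real} \<inter> {w. ennreal (\<alpha> * w) \<le> y}) w \<partial>lborel)"
      by (intro nn_integral_cong) (auto simp: indicator_def)
    also have "\<dots> = emeasure lborel ({0<..<1::real} \<inter> {w. ennreal (\<alpha> * w) \<le> y})"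
      by (rule nn_integral_indicator) measurable
    finally have *: "(\<integral>\<^sup>+w. indicator {0<..<1} w * indicator {w. ennreal (\<alpha> * w) \<le> y} w \<partial>lborel) = \<dots>" .
    show ?thesis
    proof (cases y)
      case top
      then show ?thesis unfolding * using a by (simp add: min_def top_unique)
    next
      case (real r)
      have eq: "{0<..<1::real} \<inter> {w. ennreal (\<alpha> * w) \<le> y} = (if r < \<alpha> then {0<..r/\<alpha>} else {0<..<1})"
      proof (intro set_eqI)
        fix w
        have "ennreal (\<alpha> * w) \<le> y \<longleftrightarrow> \<alpha> * w \<le> r" using real by simp
        also have "\<dots> \<longleftrightarrow> w \<le> r / \<alpha>" using a by (simp add: field_simps)
        finally have 1: "ennreal (\<alpha> * w) \<le> y \<longleftrightarrow> w \<le> r / \<alpha>" .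
        have "r < \<alpha> \<longleftrightarrow> r / \<alpha> < 1" using a by simp
        then show "w \<in> {0<..<1} \<inter> {w. ennreal (\<alpha> * w) \<le> y} \<longleftrightarrow> w \<in> (if r < \<alpha> then {0<..r/\<alpha>} else {0<..<1})"
          using 1 by auto
      qed
      show ?thesis unfolding * eq using real a
        by (auto simp: min_def ennreal_mult[symmetric] ennreal_le_iff)
    qed
  qed
  have "(\<integral>\<^sup>+x. min (f x) (ennreal \<alpha>) \<partial>lborel)
    = (\<integral>\<^sup>+x. ennreal \<alpha> * (\<integral>\<^sup>+w. indicator {0<..<1} w * indicator {w. ennreal (\<alpha> * w) \<le> f x} w \<partial>lborel) \<partial>lborel)"
    by (subst pt) simp
  also have "\<dots> = (\<integral>\<^sup>+x. ennreal \<alpha> * (\<integral>\<^sup>+w. indicator {0<..<1} w * indicator {(x, w). ennreal (\<alpha> * w) \<le> f x} (x, w) \<partial>lborel) \<partial>lborel)"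
    by (simp add: indicator_def)
  also have "\<dots> = ennreal \<alpha> * (\<integral>\<^sup>+x. (\<integral>\<^sup>+w. indicator {0<..<1} w * indicator {(x, w). ennreal (\<alpha> * w) \<le> f x} (x, w) \<partial>lborel) \<partial>lborel)"
    by (rule nn_integral_cmult) measurable
  also have "(\<integral>\<^sup>+x. (\<integral>\<^sup>+w. indicator {0<..<1} w * indicator {(x, w). ennreal (\<alpha> * w) \<le> f x} (x, w) \<partial>lborel) \<partial>lborel)
    = (\<integral>\<^sup>+w. (\<integral>\<^sup>+x. indicator {0<..<1} w * indicator {(x, w). ennreal (\<alpha> * w) \<le> f x} (x, w) \<partial>lborel) \<partial>lborel)"
    by (rule lborel_pair.Fubini'[symmetric]) measurable
  also have "\<dots> = (\<integral>\<^sup>+w. indicator {0<..<1} w * emeasure lborel {x. ennreal (\<alpha> * w) \<le> f x} \<partial>lborel)"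
  proof (rule nn_integral_cong)
    fix w :: real
    have "(\<integral>\<^sup>+x. indicator {0<..<1} w * indicator {(x, w). ennreal (\<alpha> * w) \<le> f x} (x, w) \<partial>lborel)
      = (\<integral>\<^sup>+x. indicator {0<..<1} w * indicator {x. ennreal (\<alpha> * w) \<le> f x} x \<partial>lborel)"
      by (intro nn_integral_cong) (auto simp: indicator_def)
    then show "(\<integral>\<^sup>+x. indicator {0<..<1} w * indicator {(x, w). ennreal (\<alpha> * w) \<le> f x} (x, w) \<partial>lborel)
      = indicator {0<..<1} w * emeasure lborel {x. ennreal (\<alpha> * w) \<le> f x}"
      by (simp add: nn_integral_cmult)
  qed
  finally show ?thesis .
qed

text \<open>With both functions cut at heights that do not exceed their suprema, the superlevel sets
  at every relative level \<open>w < 1\<close> are nonempty, and Brunn-Minkowski bounds the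
  corresponding level set of \<open>h\<close>. Integrating over \<open>w\<close> gives an arithmetic
  mean of \<open>a / \<alpha>\<close> and \<open>b / \<beta>\<close>, which dominates the geometric
  mean in the claim.\<close>

lemma prekopa_leindler_truncated:
  fixes f g h :: "real \<Rightarrow> ennreal"
  assumes [measurable]: "f \<in> borel_measurable borel" "g \<in> borel_measurable borel" "h \<in> borel_measurable borel"
    and m: "0 < m" "m < 1"
    and cf: "\<And>u. u > 0 \<Longrightarrow> convex {x. ennreal u \<le> f x}"
    and cg: "\<And>u. u > 0 \<Longrightarrow> convex {x. ennreal u \<le> g x}"
    and sub: "\<And>x y a b. a > 0 \<Longrightarrow> b > 0 \<Longrightarrow> ennreal a \<le> f x \<Longrightarrow> ennreal b \<le> g y \<Longrightarrow>
       ennreal (a powr (1 - m) * b powr m) \<le> h ((1 - m) * x + m * y)"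
    and \<alpha>: "\<alpha> > 0" "ennreal \<alpha> \<le> (SUP x. f x)" and \<beta>: "\<beta> > 0" "ennreal \<beta> \<le> (SUP x. g x)"
    and a: "a > 0" "ennreal a \<le> (\<integral>\<^sup>+x. min (f x) (ennreal \<alpha>) \<partial>lborel)"
    and b: "b > 0" "ennreal b \<le> (\<integral>\<^sup>+x. min (g x) (ennreal \<beta>) \<partial>lborel)"
  shows "ennreal (a powr (1 - m) * b powr m) \<le> (\<integral>\<^sup>+x. h x \<partial>lborel)"
proof -
  define c where "c = \<alpha> powr (1 - m) * \<beta> powr m"
  have c: "c > 0" using \<alpha> \<beta> by (simp add: c_def)
  let ?I = "\<lambda>\<alpha> f. \<integral>\<^sup>+w. indicator {0<..<1} w * emeasure lborel {x. ennreal (\<alpha> * w) \<le> f x} \<partial>lborel"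
  have I: "ennreal (d / \<gamma>) \<le> ?I \<gamma> k" if "0 < \<gamma>" "0 < d" "k \<in> borel_measurable borel"
    "ennreal d \<le> (\<integral>\<^sup>+x. min (k x) (ennreal \<gamma>) \<partial>lborel)" for \<gamma> d :: real and k :: "real \<Rightarrow> ennreal"
  proof -
    have "ennreal (1/\<gamma>) * ennreal d \<le> ennreal (1/\<gamma>) * (ennreal \<gamma> * ?I \<gamma> k)"
      using that by (intro mult_left_mono) (simp_all add: nn_integral_min_layer_cake[symmetric])
    also have "\<dots> = ?I \<gamma> k" using that(1) by (simp add: mult.assoc[symmetric] ennreal_mult[symmetric])
    finally show ?thesis using that by (simp add: ennreal_mult[symmetric])
  qed
  have ne: "{x. ennreal (\<gamma> * w) \<le> k x} \<noteq> {}" if "0 < w" "w < 1" "\<gamma> > 0" "ennreal \<gamma> \<le> (SUP x. k x)"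
    for w \<gamma> and k :: "real \<Rightarrow> ennreal"
  proof -
    have "ennreal (\<gamma> * w) < ennreal \<gamma>" using that by (simp add: ennreal_less_iff)
    also note that(4)
    finally show ?thesis unfolding less_SUP_iff using less_imp_le by blast
  qed
  have lev: "ennreal (1 - m) * emeasure lborel {x. ennreal (\<alpha> * w) \<le> f x} + ennreal m * emeasure lborel {x. ennreal (\<beta> * w) \<le> g x}
    \<le> emeasure lborel {x. ennreal (c * w) \<le> h x}" if w: "0 < w" "w < 1" for w
  proof (rule brunn_minkowski_convex_real[OF cf _ cg _ _ m])
    fix x y assume "x \<in> {x. ennreal (\<alpha> * w) \<le> f x}" "y \<in> {x. ennreal (\<beta> * w) \<le> g x}"
    then have "ennreal ((\<alpha> * w) powr (1 - m) * (\<beta> * w) powr m) \<le> h ((1 - m) * x + m * y)"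
      using w \<alpha> \<beta> by (intro sub) auto
    also have "(\<alpha> * w) powr (1 - m) * (\<beta> * w) powr m = c * w"
      using w \<alpha> \<beta> by (simp add: c_def powr_mult powr_add[symmetric] algebra_simps powr_diff)
    finally show "(1 - m) * x + m * y \<in> {x. ennreal (c * w) \<le> h x}" by simp
  qed (use w \<alpha> \<beta> ne in auto)
  have "ennreal (a powr (1 - m) * b powr m) = ennreal (c * ((a/\<alpha>) powr (1 - m) * (b/\<beta>) powr m))"
    using \<alpha> \<beta> a b by (simp add: c_def powr_divide)
  also have "\<dots> \<le> ennreal (c * ((1 - m) * (a/\<alpha>) + m * (b/\<beta>)))"
    using m a b \<alpha> \<beta> c by (intro ennreal_leI mult_left_mono Youngs_inequality_0) auto
  also have "\<dots> = ennreal c * (ennreal (1 - m) * ennreal (a/\<alpha>) + ennreal m * ennreal (b/\<beta>))"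
    using m a b \<alpha> \<beta> c by (simp add: ennreal_mult[symmetric] ennreal_plus[symmetric] del: ennreal_plus)
  also have "\<dots> \<le> ennreal c * (ennreal (1 - m) * ?I \<alpha> f + ennreal m * ?I \<beta> g)"
    by (intro mult_left_mono add_mono I) (use \<alpha> \<beta> a b in auto)
  also have "ennreal (1 - m) * ?I \<alpha> f + ennreal m * ?I \<beta> g
    = (\<integral>\<^sup>+w. indicator {0<..<1} w * (ennreal (1 - m) * emeasure lborel {x. ennreal (\<alpha> * w) \<le> f x}
       + ennreal m * emeasure lborel {x. ennreal (\<beta> * w) \<le> g x}) \<partial>lborel)"
  proof -
    have [measurable]: "(\<lambda>w. emeasure lborel {x. ennreal (\<gamma> * w) \<le> k x}) \<in> borel_measurable lborel"
      if [measurable]: "k \<in> borel_measurable borel" for \<gamma> and k :: "real \<Rightarrow> ennreal"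
    proof -
      have "{p \<in> space (lborel \<Otimes>\<^sub>M lborel). ennreal (\<gamma> * fst p) \<le> k (snd p)} \<in> sets (lborel \<Otimes>\<^sub>M lborel)" by measurable
      from lborel.measurable_emeasure_Pair[OF this] show ?thesis by (simp add: vimage_def space_pair_measure)
    qed
    have "(\<integral>\<^sup>+w. indicator {0<..<1} w * (ennreal (1 - m) * emeasure lborel {x. ennreal (\<alpha> * w) \<le> f x}
       + ennreal m * emeasure lborel {x. ennreal (\<beta> * w) \<le> g x}) \<partial>lborel)
      = (\<integral>\<^sup>+w. ennreal (1 - m) * (indicator {0<..<1} w * emeasure lborel {x. ennreal (\<alpha> * w) \<le> f x})
       + ennreal m * (indicator {0<..<1} w * emeasure lborel {x. ennreal (\<beta> * w) \<le> g x}) \<partial>lborel)"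
      by (intro nn_integral_cong) (auto simp: indicator_def)
    then show ?thesis
      by (simp add: nn_integral_add nn_integral_cmult)
  qed
  also have "\<dots> \<le> ?I c h"
    by (intro nn_integral_mono) (auto simp: indicator_def lev)
  also have "ennreal c * ?I c h = (\<integral>\<^sup>+x. min (h x) (ennreal c) \<partial>lborel)"
    using c by (subst nn_integral_min_layer_cake[symmetric]) auto
  also have "\<dots> \<le> (\<integral>\<^sup>+x. h x \<partial>lborel)" by (intro nn_integral_mono) auto
  finally show ?thesis by (simp add: mult_left_mono)
qed


text \<open>Supplies the cutting heights for the truncated inequality. Capping the supremum at
  \<open>n\<close> keeps \<open>\<alpha>\<close> finite when the function is unbounded.\<close>

lemma nn_integral_min_approx:
  fixes f :: "real \<Rightarrow> ennreal"
  assumes [measurable]: "f \<in> borel_measurable borel" and a: "a > 0" "ennreal a < (\<integral>\<^sup>+x. f x \<partial>lborel)"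
  obtains \<alpha> :: real where "\<alpha> > 0" "ennreal \<alpha> \<le> (SUP x. f x)" "ennreal a \<le> (\<integral>\<^sup>+x. min (f x) (ennreal \<alpha>) \<partial>lborel)"
proof -
  have "(\<integral>\<^sup>+x. f x \<partial>lborel) = (\<integral>\<^sup>+x. (SUP n. min (f x) (of_nat n)) \<partial>lborel)"
  proof (rule nn_integral_cong)
    fix x
    have "(SUP n. min (f x) (of_nat n)) = min (f x) (SUP n. of_nat n :: ennreal)"
      by (simp add: inf_min[symmetric] inf_SUP)
    then show "f x = (SUP n. min (f x) (of_nat n))" by (simp add: ennreal_SUP_of_nat_eq_top)
  qed
  also have "\<dots> = (SUP n. \<integral>\<^sup>+x. min (f x) (of_nat n) \<partial>lborel)"
    by (intro nn_integral_monotone_convergence_SUP) (auto simp: incseq_def le_fun_def min_le_iff_disj intro!: min.mono)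
  finally obtain n :: nat where n: "ennreal a < (\<integral>\<^sup>+x. min (f x) (of_nat n) \<partial>lborel)"
    using a(2) by (auto simp: less_SUP_iff)
  define A where "A = min (SUP x. f x) (of_nat n)"
  have "A \<le> of_nat n" by (simp add: A_def)
  then have "A < top" using of_nat_less_top[of n] by (rule le_less_trans)
  then obtain \<alpha> where \<alpha>: "\<alpha> \<ge> 0" "A = ennreal \<alpha>" by (cases A) auto
  have "min (f x) (of_nat n) = min (f x) (ennreal \<alpha>)" for x
  proof -
    have "f x \<le> (SUP x. f x)" by (rule SUP_upper) auto
    then show ?thesis unfolding \<alpha>(2)[symmetric] A_def by (auto simp: min_def)
  qed
  then have le: "ennreal a < (\<integral>\<^sup>+x. min (f x) (ennreal \<alpha>) \<partial>lborel)" using n by simp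
  have "\<alpha> > 0"
  proof (rule ccontr)
    assume "\<not> \<alpha> > 0" then have "\<alpha> = 0" using \<alpha>(1) by simp
    then show False using le by (simp add: min.absorb2)
  qed
  moreover have "ennreal \<alpha> \<le> (SUP x. f x)" unfolding \<alpha>(2)[symmetric] A_def by simp
  ultimately show ?thesis using that le by auto
qed

text \<open>A factor \<open>s < 1\<close> makes the lower bounds strict, which leaves room for
  truncation; then \<open>s\<close> tends to 1. Convex superlevel sets are assumed because
  Brunn-Minkowski is used only for intervals.\<close>

lemma prekopa_leindler_real:
  fixes f g h :: "real \<Rightarrow> ennreal"
  assumes [measurable]: "f \<in> borel_measurable borel" "g \<in> borel_measurable borel" "h \<in> borel_measurable borel"
    and m: "0 < m" "m < 1"
    and cf: "\<And>u. u > 0 \<Longrightarrow> convex {x. ennreal u \<le> f x}"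
    and cg: "\<And>u. u > 0 \<Longrightarrow> convex {x. ennreal u \<le> g x}"
    and sub: "\<And>x y a b. a > 0 \<Longrightarrow> b > 0 \<Longrightarrow> ennreal a \<le> f x \<Longrightarrow> ennreal b \<le> g y \<Longrightarrow>
       ennreal (a powr (1 - m) * b powr m) \<le> h ((1 - m) * x + m * y)"
    and a: "a > 0" "ennreal a \<le> (\<integral>\<^sup>+x. f x \<partial>lborel)"
    and b: "b > 0" "ennreal b \<le> (\<integral>\<^sup>+x. g x \<partial>lborel)"
  shows "ennreal (a powr (1 - m) * b powr m) \<le> (\<integral>\<^sup>+x. h x \<partial>lborel)"
proof (cases "(\<integral>\<^sup>+x. h x \<partial>lborel)")
  case (real r)
  have "s * (a powr (1 - m) * b powr m) \<le> r" if s: "0 < s" "s < 1" for s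
  proof -
    have "ennreal (s * a) < ennreal a" "ennreal (s * b) < ennreal b" using s a(1) b(1) by (auto simp: ennreal_less_iff)
    then have sa: "ennreal (s * a) < (\<integral>\<^sup>+x. f x \<partial>lborel)" and sb: "ennreal (s * b) < (\<integral>\<^sup>+x. g x \<partial>lborel)"
      using a(2) b(2) by auto
    have pos: "s * a > 0" "s * b > 0" using s a(1) b(1) by auto
    obtain \<alpha> where \<alpha>: "\<alpha> > 0" "ennreal \<alpha> \<le> (SUP x. f x)" "ennreal (s * a) \<le> (\<integral>\<^sup>+x. min (f x) (ennreal \<alpha>) \<partial>lborel)"
      using nn_integral_min_approx[OF assms(1) pos(1) sa] by blast
    obtain \<beta> where \<beta>: "\<beta> > 0" "ennreal \<beta> \<le> (SUP x. g x)" "ennreal (s * b) \<le> (\<integral>\<^sup>+x. min (g x) (ennreal \<beta>) \<partial>lborel)"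
      using nn_integral_min_approx[OF assms(2) pos(2) sb] by blast
    have "ennreal ((s * a) powr (1 - m) * (s * b) powr m) \<le> (\<integral>\<^sup>+x. h x \<partial>lborel)"
      by (rule prekopa_leindler_truncated[OF assms(1-3) m cf cg sub \<alpha>(1,2) \<beta>(1,2) pos(1) \<alpha>(3) pos(2) \<beta>(3)])
    also have "(s * a) powr (1 - m) * (s * b) powr m = s powr (1 - m + m) * (a powr (1 - m) * b powr m)"
      unfolding powr_add using s a(1) b(1) by (simp add: powr_mult)
    finally show ?thesis using real s by simp
  qed
  then have "a powr (1 - m) * b powr m \<le> r" by (rule field_le_mult_one_interval)
  then show ?thesis using real by simp
qed simp

section \<open>Log-concave functions and their marginals\<close>

text \<open>Stated through real lower bounds because \<open>ennreal\<close> has no \<open>powr\<close>; infinite values are allowed.\<close>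

definition log_concave :: "('b::real_vector \<Rightarrow> ennreal) \<Rightarrow> bool" where
  "log_concave F \<longleftrightarrow> (\<forall>x y m a b. 0 < m \<longrightarrow> m < 1 \<longrightarrow> 0 < a \<longrightarrow> 0 < b \<longrightarrow> ennreal a \<le> F x \<longrightarrow> ennreal b \<le> F y
     \<longrightarrow> ennreal (a powr (1 - m) * b powr m) \<le> F ((1 - m) *\<^sub>R x + m *\<^sub>R y))"

lemma log_concaveI:
  assumes "\<And>x y m a b. 0 < m \<Longrightarrow> m < 1 \<Longrightarrow> 0 < a \<Longrightarrow> 0 < b \<Longrightarrow> ennreal a \<le> F x \<Longrightarrow> ennreal b \<le> F y
     \<Longrightarrow> ennreal (a powr (1 - m) * b powr m) \<le> F ((1 - m) *\<^sub>R x + m *\<^sub>R y)"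
  shows "log_concave F"
  using assms unfolding log_concave_def by blast

lemma log_concaveD:
  assumes "log_concave F" "0 < m" "m < 1" "0 < a" "0 < b" "ennreal a \<le> F x" "ennreal b \<le> F y"
  shows "ennreal (a powr (1 - m) * b powr m) \<le> F ((1 - m) *\<^sub>R x + m *\<^sub>R y)"
  using assms unfolding log_concave_def by blast

lemma convex_log_concave_superlevel:
  assumes "log_concave F" "u > 0"
  shows "convex {x. ennreal u \<le> F x}"
proof -
  have "ennreal u \<le> F ((1 - m) *\<^sub>R x + m *\<^sub>R y)" if "0 < m" "m < 1" "ennreal u \<le> F x" "ennreal u \<le> F y" for x y m
  proof -
    have "ennreal (u powr (1 - m) * u powr m) \<le> F ((1 - m) *\<^sub>R x + m *\<^sub>R y)"
      by (rule log_concaveD[OF assms(1)]) (use that assms in auto)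
    then show ?thesis using assms(2) by (simp add: powr_add[symmetric])
  qed
  note main = this
  show ?thesis
  proof (rule convexI)
    fix x y and p q :: real
    assume *: "x \<in> {x. ennreal u \<le> F x}" "y \<in> {x. ennreal u \<le> F x}" "0 \<le> p" "0 \<le> q" "p + q = 1"
    consider "q = 0" "p = 1" | "q = 1" "p = 0" | "0 < q" "q < 1" "p = 1 - q" using * by linarith
    then show "p *\<^sub>R x + q *\<^sub>R y \<in> {x. ennreal u \<le> F x}"
      using * main[of q x y] by cases auto
  qed
qed

lemma log_concave_linear:
  assumes "linear T" "log_concave F"
  shows "log_concave (\<lambda>x. F (T x))"
  by (rule log_concaveI) (use log_concaveD[OF assms(2)] in \<open>simp add: linear_add[OF assms(1)] linear_scale[OF assms(1)]\<close>)

lemma log_concave_mult: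
  assumes "log_concave F" "log_concave G"
  shows "log_concave (\<lambda>x. F x * G x)"
proof (rule log_concaveI)
  fix x y and m a b :: real
  assume m: "0 < m" "m < 1" and ab: "0 < a" "0 < b" and a: "ennreal a \<le> F x * G x" and b: "ennreal b \<le> F y * G y"
  \<comment> \<open>A lower bound for a product is split into lower bounds for the factors. The
    cases deal with zero and infinite factors.\<close>
  have split: "\<exists>f g. 0 < f \<and> 0 < g \<and> ennreal f \<le> F x \<and> ennreal g \<le> G x \<and> a = f * g"
    if a: "ennreal a \<le> F x * G x" "0 < a" for a x
  proof (cases "F x")
    case (real f)
    show ?thesis
    proof (cases "f = 0")
      case False
      then have f: "f > 0" using real by auto
      have "ennreal (a / f) \<le> G x"
      proof -
        have "ennreal (1/f) * ennreal a \<le> ennreal (1/f) * (ennreal f * G x)" using a real by (intro mult_left_mono) auto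
        also have "\<dots> = G x" using f by (simp add: mult.assoc[symmetric] ennreal_mult[symmetric])
        finally show ?thesis using f a by (simp add: ennreal_mult[symmetric])
      qed
      then show ?thesis using f real a by (intro exI[of _ f] exI[of _ "a / f"]) auto
    qed (use a real in auto)
  next
    case top
    show ?thesis
    proof (cases "G x")
      case (real g)
      then have "g > 0" using a by (cases "g = 0") auto
      then show ?thesis using top real a by (intro exI[of _ "a / g"] exI[of _ g]) auto
    next
      case top' : top
      then show ?thesis using top a by (intro exI[of _ a] exI[of _ 1]) auto
    qed
  qed
  obtain f g f' g' where fg: "0 < f" "0 < g" "ennreal f \<le> F x" "ennreal g \<le> G x" "a = f * g"
    "0 < f'" "0 < g'" "ennreal f' \<le> F y" "ennreal g' \<le> G y" "b = f' * g'"
    using split[OF a] split[OF b] ab by blast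
  have "ennreal (a powr (1 - m) * b powr m) = ennreal (f powr (1 - m) * f' powr m) * ennreal (g powr (1 - m) * g' powr m)"
    using fg by (simp add: powr_mult ennreal_mult[symmetric] mult_ac)
  also have "\<dots> \<le> F ((1 - m) *\<^sub>R x + m *\<^sub>R y) * G ((1 - m) *\<^sub>R x + m *\<^sub>R y)"
    by (intro mult_mono log_concaveD[OF assms(1)] log_concaveD[OF assms(2)]) (use m fg in auto)
  finally show "ennreal (a powr (1 - m) * b powr m) \<le> F ((1 - m) *\<^sub>R x + m *\<^sub>R y) * G ((1 - m) *\<^sub>R x + m *\<^sub>R y)" .
qed

lemma log_concave_indicator:
  assumes "convex S"
  shows "log_concave (indicator S)"
proof (rule log_concaveI)
  fix x y and m a b :: real
  assume m: "0 < m" "m < 1" and ab: "0 < a" "0 < b" and a: "ennreal a \<le> indicator S x" and b: "ennreal b \<le> indicator S y"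
  have x: "x \<in> S" "a \<le> 1" using ab a by (cases "x \<in> S"; simp)+
  have y: "y \<in> S" "b \<le> 1" using ab b by (cases "y \<in> S"; simp)+
  have "(1 - m) *\<^sub>R x + m *\<^sub>R y \<in> S" using m by (intro convexD[OF assms x(1) y(1)]) auto
  note x y this
  then show "ennreal (a powr (1 - m) * b powr m) \<le> indicator S ((1 - m) *\<^sub>R x + m *\<^sub>R y)"
    using m ab by (simp add: mult_le_one powr_le1)
qed

text \<open>Prekopa's theorem for one integrated variable: the Prekopa-Leindler inequality is
  applied to the fibres over \<open>x\<close>, over \<open>y\<close> and over their convex
  combination.\<close>

lemma log_concave_marginal:
  fixes F :: "real \<times> 'b::real_vector \<Rightarrow> ennreal"
  assumes F: "log_concave F" and meas: "\<And>x. (\<lambda>t. F (t, x)) \<in> borel_measurable borel"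
  shows "log_concave (\<lambda>x. \<integral>\<^sup>+t. F (t, x) \<partial>lborel)"
proof (rule log_concaveI)
  fix x y and m a b :: real
  assume m: "0 < m" "m < 1" and ab: "0 < a" "0 < b" and a: "ennreal a \<le> (\<integral>\<^sup>+t. F (t, x) \<partial>lborel)" and b: "ennreal b \<le> (\<integral>\<^sup>+t. F (t, y) \<partial>lborel)"
  have conv: "convex {t. ennreal u \<le> F (t, x)}" if "u > 0" for u x
  proof (rule convexI)
    fix s t and p q :: real
    assume *: "s \<in> {t. ennreal u \<le> F (t, x)}" "t \<in> {t. ennreal u \<le> F (t, x)}" "0 \<le> p" "0 \<le> q" "p + q = 1"
    have "p *\<^sub>R (s, x) + q *\<^sub>R (t, x) \<in> {z. ennreal u \<le> F z}"
      by (rule convexD[OF convex_log_concave_superlevel[OF F that]]) (use * in auto)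
    moreover have "p *\<^sub>R x + q *\<^sub>R x = x" using * by (simp add: scaleR_add_left[symmetric])
    ultimately show "p *\<^sub>R s + q *\<^sub>R t \<in> {t. ennreal u \<le> F (t, x)}" by simp
  qed
  show "ennreal (a powr (1 - m) * b powr m) \<le> (\<integral>\<^sup>+t. F (t, (1 - m) *\<^sub>R x + m *\<^sub>R y) \<partial>lborel)"
  proof (rule prekopa_leindler_real[OF meas meas meas m conv conv _ ab(1) a ab(2) b])
    fix s t c d :: real
    assume "c > 0" "d > 0" "ennreal c \<le> F (s, x)" "ennreal d \<le> F (t, y)"
    from log_concaveD[OF F m this]
    show "ennreal (c powr (1 - m) * d powr m) \<le> F ((1 - m) * s + m * t, (1 - m) *\<^sub>R x + m *\<^sub>R y)" by simp
  qed auto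
qed

lemma log_concave_std_normal: "log_concave (\<lambda>t. ennreal (std_normal_density t))"
proof (rule log_concaveI)
  fix x y m a b :: real
  assume m: "0 < m" "m < 1" and ab: "0 < a" "0 < b" and a: "ennreal a \<le> ennreal (std_normal_density x)" and b: "ennreal b \<le> ennreal (std_normal_density y)"
  let ?c = "1 / sqrt (2 * pi)"
  have a': "a \<le> ?c * exp (- x\<^sup>2 / 2)" and b': "b \<le> ?c * exp (- y\<^sup>2 / 2)"
    using a b by (simp_all add: std_normal_density_def)
  have "a powr (1 - m) * b powr m \<le> (?c * exp (- x\<^sup>2 / 2)) powr (1 - m) * (?c * exp (- y\<^sup>2 / 2)) powr m"
    using a' b' ab m by (intro mult_mono powr_mono2) auto
  also have "\<dots> = ?c powr (1 - m + m) * (exp (- x\<^sup>2 / 2) powr (1 - m) * exp (- y\<^sup>2 / 2) powr m)"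
    unfolding powr_add by (simp add: powr_mult powr_divide)
  also have "\<dots> = ?c * exp (- ((1 - m) * x\<^sup>2 + m * y\<^sup>2) / 2)"
    by (simp add: exp_powr_real exp_add[symmetric] field_simps)
  also have "\<dots> \<le> ?c * exp (- ((1 - m) * x + m * y)\<^sup>2 / 2)"
  proof -
    \<comment> \<open>This difference is the convexity gap of the square, so the exponent of the
      density is concave.\<close>
    have "(1 - m) * x\<^sup>2 + m * y\<^sup>2 - ((1 - m) * x + m * y)\<^sup>2 = m * (1 - m) * (x - y)\<^sup>2"
      by (simp add: power2_eq_square algebra_simps)
    moreover have "m * (1 - m) * (x - y)\<^sup>2 \<ge> 0" using m by simp
    ultimately have "((1 - m) * x + m * y)\<^sup>2 \<le> (1 - m) * x\<^sup>2 + m * y\<^sup>2" by linarith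
    then show ?thesis by (intro mult_left_mono) auto
  qed
  finally show "ennreal (a powr (1 - m) * b powr m) \<le> ennreal (std_normal_density ((1 - m) *\<^sub>R x + m *\<^sub>R y))"
    by (simp add: std_normal_density_def ennreal_leI)
qed

section \<open>Gaussian laws\<close>

definition gauss :: "real measure" where
  "gauss = density lborel (\<lambda>t. ennreal (std_normal_density t))"

lemma sets_gauss[measurable_cong, simp]: "sets gauss = sets borel"
  by (simp add: gauss_def)

lemma space_gauss[simp]: "space gauss = UNIV"
  by (simp add: gauss_def)

interpretation gauss: prob_space gauss
  unfolding gauss_def by (rule prob_space_normal_density) simp

lemma nn_integral_gauss:
  assumes "f \<in> borel_measurable borel"
  shows "(\<integral>\<^sup>+t. f t \<partial>gauss) = (\<integral>\<^sup>+t. ennreal (std_normal_density t) * f t \<partial>lborel)"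
  using assms unfolding gauss_def by (subst nn_integral_density) auto

lemma nn_integral_gauss_uminus:
  assumes [measurable]: "f \<in> borel_measurable borel"
  shows "(\<integral>\<^sup>+t. f (- t) \<partial>gauss) = (\<integral>\<^sup>+t. f t \<partial>gauss)"
proof -
  have "(\<integral>\<^sup>+t. f t \<partial>gauss) = (\<integral>\<^sup>+t. ennreal (std_normal_density (- t)) * f (- t) \<partial>lborel)"
    by (subst nn_integral_gauss, simp, subst nn_integral_real_affine[where c="-1" and t=0]) auto
  also have "\<dots> = (\<integral>\<^sup>+t. f (- t) \<partial>gauss)"
    by (subst nn_integral_gauss) (auto simp: std_normal_density_def)
  finally show ?thesis by simp
qed

lemma nn_integral_gauss_square: "(\<integral>\<^sup>+t. ennreal (t\<^sup>2) \<partial>gauss) = 1"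
proof -
  have "(\<integral>\<^sup>+t. ennreal (t\<^sup>2) \<partial>gauss) = (\<integral>\<^sup>+t. ennreal (std_normal_density t * t\<^sup>2) \<partial>lborel)"
    by (subst nn_integral_gauss) (auto simp: ennreal_mult)
  also have "\<dots> = ennreal 1"
    by (rule nn_integral_eq_integral[THEN trans]) (use std_normal_moment_even[of 1] in \<open>auto simp: has_bochner_integral_iff\<close>)
  finally show ?thesis by simp
qed

lemma nn_integral_gauss_fourth: "(\<integral>\<^sup>+t. ennreal (t^4) \<partial>gauss) = 3"
proof -
  have "(\<integral>\<^sup>+t. ennreal (t^4) \<partial>gauss) = (\<integral>\<^sup>+t. ennreal (std_normal_density t * t^4) \<partial>lborel)"
    by (subst nn_integral_gauss) (auto simp: ennreal_mult)
  also have "\<dots> = ennreal 3"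
    by (rule nn_integral_eq_integral[THEN trans]) (use std_normal_moment_even[of 2] in \<open>auto simp: has_bochner_integral_iff fact_numeral\<close>)
  finally show ?thesis by simp
qed

text \<open>The sum of two independent standard normals is distributed as \<open>sqrt 2\<close>
  times one. This is what makes halved weights add up.\<close>

lemma nn_integral_gauss_convolution:
  assumes [measurable]: "f \<in> borel_measurable borel"
  shows "(\<integral>\<^sup>+s. \<integral>\<^sup>+t. f (s + t) \<partial>gauss \<partial>gauss) = (\<integral>\<^sup>+t. f (sqrt 2 * t) \<partial>gauss)"
proof -
  let ?n = "\<lambda>t. ennreal (std_normal_density t)"
  have "(\<integral>\<^sup>+s. \<integral>\<^sup>+t. f (s + t) \<partial>gauss \<partial>gauss)
    = (\<integral>\<^sup>+s. \<integral>\<^sup>+t. ?n s * (?n t * f (s + t)) \<partial>lborel \<partial>lborel)"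
    by (simp add: nn_integral_gauss nn_integral_cmult)
  also have "\<dots> = (\<integral>\<^sup>+s. \<integral>\<^sup>+x. ?n s * (?n (x - s) * f x) \<partial>lborel \<partial>lborel)"
  proof (rule nn_integral_cong)
    fix s
    show "(\<integral>\<^sup>+t. ?n s * (?n t * f (s + t)) \<partial>lborel) = (\<integral>\<^sup>+x. ?n s * (?n (x - s) * f x) \<partial>lborel)"
      by (subst (2) nn_integral_real_affine[where c=1 and t=s]) auto
  qed
  also have "\<dots> = (\<integral>\<^sup>+x. \<integral>\<^sup>+s. ?n s * (?n (x - s) * f x) \<partial>lborel \<partial>lborel)"
    by (rule lborel_pair.Fubini'[symmetric]) measurable
  also have "\<dots> = (\<integral>\<^sup>+x. (\<integral>\<^sup>+s. ennreal (std_normal_density (x - s) * std_normal_density s) \<partial>lborel) * f x \<partial>lborel)"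
    by (intro nn_integral_cong, subst nn_integral_multc[symmetric]) (auto simp: ennreal_mult mult_ac)
  also have "\<dots> = (\<integral>\<^sup>+x. ennreal (normal_density 0 (sqrt 2) x) * f x \<partial>lborel)"
    using fun_cong[OF conv_normal_density_zero_mean[of 1 1]] by simp
  also have "\<dots> = (\<integral>\<^sup>+x. ennreal (sqrt 2) * (ennreal (normal_density 0 (sqrt 2) (sqrt 2 * x)) * f (sqrt 2 * x)) \<partial>lborel)"
    by (subst nn_integral_real_affine[where c="sqrt 2" and t=0]) (auto simp: nn_integral_cmult)
  also have "\<dots> = (\<integral>\<^sup>+x. ?n x * f (sqrt 2 * x) \<partial>lborel)"
  proof (rule nn_integral_cong)
    fix x :: real
    have "sqrt 2 * normal_density 0 (sqrt 2) (sqrt 2 * x) = std_normal_density x"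
      by (simp add: normal_density_def std_normal_density_def real_sqrt_mult power_mult_distrib field_simps)
    then have "ennreal (sqrt 2) * ennreal (normal_density 0 (sqrt 2) (sqrt 2 * x)) = ?n x"
      by (simp add: ennreal_mult[symmetric])
    then show "ennreal (sqrt 2) * (ennreal (normal_density 0 (sqrt 2) (sqrt 2 * x)) * f (sqrt 2 * x)) = ?n x * f (sqrt 2 * x)"
      by (simp add: mult.assoc[symmetric])
  qed
  also have "\<dots> = (\<integral>\<^sup>+t. f (sqrt 2 * t) \<partial>gauss)" by (simp add: nn_integral_gauss)
  finally show ?thesis .
qed

section \<open>Laws of weighted Gaussian sums\<close>

text \<open>The law of \<open>\<Sum>(v, c)\<leftarrow>L. sqrt (2 * c) * G * v\<close> with independent standard normal \<open>G\<close>, so the weight \<open>c\<close> is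
  the time of a diffusion with generator \<open>\<partial>\<^sup>2/\<partial>v\<^sup>2\<close>.\<close>

primrec gauss_law :: "('a::euclidean_space \<times> real) list \<Rightarrow> 'a measure" where
  "gauss_law [] = return borel 0"
| "gauss_law (p # L) = distr (gauss \<Otimes>\<^sub>M gauss_law L) borel (\<lambda>(t, z). (sqrt (2 * snd p) * t) *\<^sub>R fst p + z)"

lemma sets_gauss_law[measurable_cong, simp]: "sets (gauss_law L) = sets borel"
  by (cases L) auto

lemma space_gauss_law[simp]: "space (gauss_law L) = UNIV"
  by (cases L) auto

lemma prob_space_gauss_law: "prob_space (gauss_law L)"
proof (induction L)
  case Nil
  show ?case by (simp add: prob_space_return)
next
  case (Cons p L)
  interpret prob_space "gauss_law L" by fact
  interpret pair_prob_space gauss "gauss_law L" ..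
  show ?case unfolding gauss_law.simps by (rule P.prob_space_distr) measurable
qed

lemma sigma_finite_gauss_law: "sigma_finite_measure (gauss_law L)"
  by (rule prob_space_imp_sigma_finite[OF prob_space_gauss_law])

lemmas borel_measurable_nn_integral_gauss_law[measurable (raw)] = sigma_finite_measure.borel_measurable_nn_integral[OF sigma_finite_gauss_law]

interpretation gauss_law: prob_space "gauss_law L" for L
  by (rule prob_space_gauss_law)

interpretation gauss_gauss_law: pair_sigma_finite gauss "gauss_law L" for L ..
interpretation lborel_gauss_law: pair_sigma_finite lborel "gauss_law L" for L ..

lemma nn_integral_gauss_law_const: "(\<integral>\<^sup>+z. c \<partial>gauss_law L) = c"
  using prob_space.emeasure_space_1[OF prob_space_gauss_law, of L] by simp

lemma nn_integral_gauss_law_Nil: "f \<in> borel_measurable borel \<Longrightarrow> (\<integral>\<^sup>+z. f z \<partial>gauss_law []) = f 0"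
  by (simp add: nn_integral_return)

lemma nn_integral_gauss_law_Cons:
  assumes [measurable]: "f \<in> borel_measurable borel"
  shows "(\<integral>\<^sup>+z. f z \<partial>gauss_law (p # L)) = (\<integral>\<^sup>+t. \<integral>\<^sup>+z. f ((sqrt (2 * snd p) * t) *\<^sub>R fst p + z) \<partial>gauss_law L \<partial>gauss)"
proof -
  have "(\<integral>\<^sup>+z. f z \<partial>gauss_law (p # L)) = (\<integral>\<^sup>+x. f (case x of (t, z) \<Rightarrow> (sqrt (2 * snd p) * t) *\<^sub>R fst p + z) \<partial>(gauss \<Otimes>\<^sub>M gauss_law L))"
    unfolding gauss_law.simps by (rule nn_integral_distr) measurable
  also have "\<dots> = (\<integral>\<^sup>+t. \<integral>\<^sup>+z. f (case (t, z) of (t, z) \<Rightarrow> (sqrt (2 * snd p) * t) *\<^sub>R fst p + z) \<partial>gauss_law L \<partial>gauss)"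
    by (rule sigma_finite_measure.nn_integral_fst[OF sigma_finite_gauss_law, symmetric]) measurable
  finally show ?thesis by simp
qed

text \<open>Each Gaussian coefficient is symmetric. This makes the smoothing operator
  self-adjoint.\<close>

lemma nn_integral_gauss_law_uminus:
  assumes "f \<in> borel_measurable borel"
  shows "(\<integral>\<^sup>+z. f (- z) \<partial>gauss_law L) = (\<integral>\<^sup>+z. f z \<partial>gauss_law L)"
  using assms
proof (induction L arbitrary: f)
  case Nil
  then show ?case by (subst (1 2) nn_integral_gauss_law_Nil) auto
next
  case (Cons p L)
  note [measurable] = Cons.prems
  let ?a = "sqrt (2 * snd p)" and ?v = "fst p"
  have "(\<integral>\<^sup>+z. f (- z) \<partial>gauss_law (p # L)) = (\<integral>\<^sup>+t. \<integral>\<^sup>+z. f (- ((?a * t) *\<^sub>R ?v + z)) \<partial>gauss_law L \<partial>gauss)"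
    by (rule nn_integral_gauss_law_Cons) measurable
  also have "\<dots> = (\<integral>\<^sup>+t. \<integral>\<^sup>+z. f ((?a * (- t)) *\<^sub>R ?v + z) \<partial>gauss_law L \<partial>gauss)"
  proof (rule nn_integral_cong)
    fix t
    show "(\<integral>\<^sup>+z. f (- ((?a * t) *\<^sub>R ?v + z)) \<partial>gauss_law L) = (\<integral>\<^sup>+z. f ((?a * (- t)) *\<^sub>R ?v + z) \<partial>gauss_law L)"
      by (subst (2) Cons.IH[symmetric]) auto
  qed
  also have "\<dots> = (\<integral>\<^sup>+t. \<integral>\<^sup>+z. f ((?a * t) *\<^sub>R ?v + z) \<partial>gauss_law L \<partial>gauss)"
    by (rule nn_integral_gauss_uminus) measurable
  also have "\<dots> = (\<integral>\<^sup>+z. f z \<partial>gauss_law (p # L))"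
    by (rule nn_integral_gauss_law_Cons[symmetric]) fact
  finally show ?case .
qed

definition halve :: "('a \<times> real) list \<Rightarrow> ('a \<times> real) list" where
  "halve L = map (\<lambda>(v, c). (v, c / 2)) L"

lemma halve_simps[simp]: "halve [] = []" "halve ((v, c) # L) = (v, c / 2) # halve L"
  by (auto simp: halve_def)

text \<open>Two independent steps with halved weights have the law of one full step. Hence smoothing
  along \<open>halve L\<close> is the operator square root of smoothing along
  \<open>L\<close>.\<close>

lemma nn_integral_gauss_law_halve:
  assumes "f \<in> borel_measurable borel"
  shows "(\<integral>\<^sup>+z. \<integral>\<^sup>+z'. f (z + z') \<partial>gauss_law (halve L) \<partial>gauss_law (halve L)) = (\<integral>\<^sup>+z. f z \<partial>gauss_law L)"
  using assms
proof (induction L arbitrary: f)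
  case Nil
  note [measurable] = Nil
  show ?case by (simp only: halve_simps, subst nn_integral_gauss_law_Nil, simp, subst (1 2) nn_integral_gauss_law_Nil, auto)
next
  case (Cons p L)
  note [measurable] = Cons.prems
  obtain v c where p: "p = (v, c)" by (cases p)
  let ?H = "halve L" and ?a = "sqrt (2 * (c / 2))"
  have "(\<integral>\<^sup>+z. \<integral>\<^sup>+z'. f (z + z') \<partial>gauss_law (halve (p # L)) \<partial>gauss_law (halve (p # L)))
    = (\<integral>\<^sup>+z. \<integral>\<^sup>+t'. \<integral>\<^sup>+z'. f (z + ((?a * t') *\<^sub>R v + z')) \<partial>gauss_law ?H \<partial>gauss \<partial>gauss_law ((v, c/2) # ?H))"
    unfolding p halve_simps by (subst nn_integral_gauss_law_Cons) auto
  also have "\<dots> = (\<integral>\<^sup>+t. \<integral>\<^sup>+z. \<integral>\<^sup>+t'. \<integral>\<^sup>+z'. f ((?a * t) *\<^sub>R v + z + ((?a * t') *\<^sub>R v + z')) \<partial>gauss_law ?H \<partial>gauss \<partial>gauss_law ?H \<partial>gauss)"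
    by (subst nn_integral_gauss_law_Cons) auto
  also have "\<dots> = (\<integral>\<^sup>+t. \<integral>\<^sup>+t'. \<integral>\<^sup>+z. \<integral>\<^sup>+z'. f ((?a * t) *\<^sub>R v + z + ((?a * t') *\<^sub>R v + z')) \<partial>gauss_law ?H \<partial>gauss_law ?H \<partial>gauss \<partial>gauss)"
    by (intro nn_integral_cong gauss_gauss_law.Fubini') measurable
  also have "\<dots> = (\<integral>\<^sup>+t. \<integral>\<^sup>+t'. \<integral>\<^sup>+z. f ((?a * (t + t')) *\<^sub>R v + z) \<partial>gauss_law L \<partial>gauss \<partial>gauss)"
  proof (intro nn_integral_cong)
    fix t t'
    have "(\<integral>\<^sup>+z. \<integral>\<^sup>+z'. f ((?a * t) *\<^sub>R v + z + ((?a * t') *\<^sub>R v + z')) \<partial>gauss_law ?H \<partial>gauss_law ?H)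
      = (\<integral>\<^sup>+z. \<integral>\<^sup>+z'. f ((?a * (t + t')) *\<^sub>R v + (z + z')) \<partial>gauss_law ?H \<partial>gauss_law ?H)"
      by (intro nn_integral_cong arg_cong[where f=f]) (simp add: algebra_simps)
    also have "\<dots> = (\<integral>\<^sup>+z. f ((?a * (t + t')) *\<^sub>R v + z) \<partial>gauss_law L)"
      by (rule Cons.IH) measurable
    finally show "(\<integral>\<^sup>+z. \<integral>\<^sup>+z'. f ((?a * t) *\<^sub>R v + z + ((?a * t') *\<^sub>R v + z')) \<partial>gauss_law ?H \<partial>gauss_law ?H)
      = (\<integral>\<^sup>+z. f ((?a * (t + t')) *\<^sub>R v + z) \<partial>gauss_law L)" .
  qed
  also have "\<dots> = (\<integral>\<^sup>+t. \<integral>\<^sup>+z. f ((?a * (sqrt 2 * t)) *\<^sub>R v + z) \<partial>gauss_law L \<partial>gauss)"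
    by (rule nn_integral_gauss_convolution) measurable
  also have "\<dots> = (\<integral>\<^sup>+z. f z \<partial>gauss_law (p # L))"
    unfolding p by (subst nn_integral_gauss_law_Cons) (auto simp: real_sqrt_mult mult_ac)
  finally show ?case .
qed

abbreviation cost :: "('a \<times> real) list \<Rightarrow> real" where
  "cost L \<equiv> (\<Sum>p\<leftarrow>L. snd p)"

text \<open>Adding the values at \<open>t\<close> and \<open>- t\<close> removes the mixed term by
  the parallelogram law, so that only nonnegative integrals occur.\<close>

lemma nn_integral_gauss_law_norm_square:
  assumes "\<And>p. p \<in> set L \<Longrightarrow> 0 \<le> snd p"
  shows "(\<integral>\<^sup>+z. ennreal ((norm z)\<^sup>2) \<partial>gauss_law L) = ennreal (\<Sum>p\<leftarrow>L. 2 * snd p * (norm (fst p))\<^sup>2)"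
  using assms
proof (induction L)
  case Nil
  show ?case by (subst nn_integral_gauss_law_Nil) auto
next
  case (Cons p L)
  let ?a = "sqrt (2 * snd p)" and ?v = "fst p"
  have p: "snd p \<ge> 0" using Cons.prems by auto
  define S where "S = (\<Sum>p\<leftarrow>L. 2 * snd p * (norm (fst p))\<^sup>2)"
  have S: "S \<ge> 0" unfolding S_def using Cons.prems by (intro sum_list_nonneg) fastforce
  have IH: "(\<integral>\<^sup>+z. ennreal ((norm z)\<^sup>2) \<partial>gauss_law L) = ennreal S"
    unfolding S_def using Cons by auto
  have two: "ennreal (2 * (x + y)) = 2 * (ennreal x + ennreal y)" if "0 \<le> x" "0 \<le> y" for x y
  proof -
    have "ennreal (2 * (x + y)) = ennreal 2 * ennreal (x + y)" using that by (intro ennreal_mult) auto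
    also have "ennreal (x + y) = ennreal x + ennreal y" using that by (rule ennreal_plus)
    finally show ?thesis by simp
  qed
  let ?I = "\<lambda>t. \<integral>\<^sup>+z. ennreal ((norm ((?a * t) *\<^sub>R ?v + z))\<^sup>2) \<partial>gauss_law L"
  have I: "?I t + ?I (- t) = 2 * (ennreal (2 * snd p * (norm ?v)\<^sup>2) * ennreal (t\<^sup>2) + ennreal S)" for t
  proof -
    have pl: "(norm ((?a * t) *\<^sub>R ?v + z))\<^sup>2 + (norm ((?a * (- t)) *\<^sub>R ?v + z))\<^sup>2
       = 2 * ((2 * snd p * (norm ?v)\<^sup>2) * t\<^sup>2 + (norm z)\<^sup>2)" for z
    proof -
      have par: "(norm (w + z))\<^sup>2 + (norm (- w + z))\<^sup>2 = 2 * ((norm w)\<^sup>2 + (norm z)\<^sup>2)" for w :: 'a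
        by (simp only: power2_norm_eq_inner inner_add_left inner_add_right inner_minus_left inner_minus_right)
          (simp add: inner_commute)
      have "(norm ((?a * t) *\<^sub>R ?v))\<^sup>2 = (2 * snd p * (norm ?v)\<^sup>2) * t\<^sup>2"
        using p by (simp add: power_mult_distrib)
      then show ?thesis using par[of "(?a * t) *\<^sub>R ?v"] by simp
    qed
    have "?I t + ?I (- t) = (\<integral>\<^sup>+z. ennreal ((norm ((?a * t) *\<^sub>R ?v + z))\<^sup>2) + ennreal ((norm ((?a * (- t)) *\<^sub>R ?v + z))\<^sup>2) \<partial>gauss_law L)"
      by (rule nn_integral_add[symmetric]) measurable
    also have "\<dots> = (\<integral>\<^sup>+z. 2 * (ennreal ((2 * snd p * (norm ?v)\<^sup>2) * t\<^sup>2) + ennreal ((norm z)\<^sup>2)) \<partial>gauss_law L)"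
    proof (rule nn_integral_cong)
      fix z
      have "ennreal ((norm ((?a * t) *\<^sub>R ?v + z))\<^sup>2) + ennreal ((norm ((?a * (- t)) *\<^sub>R ?v + z))\<^sup>2)
        = ennreal (2 * ((2 * snd p * (norm ?v)\<^sup>2) * t\<^sup>2 + (norm z)\<^sup>2))"
        by (subst ennreal_plus[symmetric], simp, simp, subst pl, rule refl)
      also have "\<dots> = 2 * (ennreal ((2 * snd p * (norm ?v)\<^sup>2) * t\<^sup>2) + ennreal ((norm z)\<^sup>2))"
        using p by (intro two) auto
      finally show "ennreal ((norm ((?a * t) *\<^sub>R ?v + z))\<^sup>2) + ennreal ((norm ((?a * (- t)) *\<^sub>R ?v + z))\<^sup>2)
        = 2 * (ennreal ((2 * snd p * (norm ?v)\<^sup>2) * t\<^sup>2) + ennreal ((norm z)\<^sup>2))" .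
    qed
    also have "\<dots> = 2 * ((\<integral>\<^sup>+z. ennreal ((2 * snd p * (norm ?v)\<^sup>2) * t\<^sup>2) \<partial>gauss_law L) + (\<integral>\<^sup>+z. ennreal ((norm z)\<^sup>2) \<partial>gauss_law L))"
      by (subst nn_integral_cmult, measurable, subst nn_integral_add, measurable)
    also have "\<dots> = 2 * (ennreal ((2 * snd p * (norm ?v)\<^sup>2) * t\<^sup>2) + ennreal S)"
      unfolding IH nn_integral_gauss_law_const ..
    also have "ennreal ((2 * snd p * (norm ?v)\<^sup>2) * t\<^sup>2) = ennreal (2 * snd p * (norm ?v)\<^sup>2) * ennreal (t\<^sup>2)"
      using p by (intro ennreal_mult) auto
    finally show ?thesis .
  qed
  have J: "(\<integral>\<^sup>+z. ennreal ((norm z)\<^sup>2) \<partial>gauss_law (p # L)) = (\<integral>\<^sup>+t. ?I t \<partial>gauss)"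
    by (rule nn_integral_gauss_law_Cons) measurable
  define X where "X = (\<integral>\<^sup>+t. ?I t \<partial>gauss)"
  have "(\<integral>\<^sup>+t. ?I (- t) \<partial>gauss) = X"
    unfolding X_def by (rule nn_integral_gauss_uminus[where f="?I"]) measurable
  then have "2 * X = (\<integral>\<^sup>+t. ?I t \<partial>gauss) + (\<integral>\<^sup>+t. ?I (- t) \<partial>gauss)"
    unfolding X_def[symmetric] by (simp only: mult_2)
  also have "\<dots> = (\<integral>\<^sup>+t. ?I t + ?I (- t) \<partial>gauss)"
    by (rule nn_integral_add[symmetric]) measurable
  also have "\<dots> = (\<integral>\<^sup>+t. 2 * (ennreal (2 * snd p * (norm ?v)\<^sup>2) * ennreal (t\<^sup>2) + ennreal S) \<partial>gauss)"
    unfolding I ..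
  also have "\<dots> = 2 * (ennreal (2 * snd p * (norm ?v)\<^sup>2) * (\<integral>\<^sup>+t. ennreal (t\<^sup>2) \<partial>gauss) + (\<integral>\<^sup>+t. ennreal S \<partial>gauss))"
    by (subst nn_integral_cmult, measurable, subst nn_integral_add, measurable, subst nn_integral_cmult, measurable)
  also have "\<dots> = 2 * (ennreal (2 * snd p * (norm ?v)\<^sup>2) + ennreal S)"
    unfolding nn_integral_const nn_integral_gauss_square by (simp only: gauss.emeasure_space_1 mult_1_right)
  finally have "X = ennreal (2 * snd p * (norm ?v)\<^sup>2) + ennreal S"
    by (simp only: ennreal_mult_cancel_left) auto
  also have "\<dots> = ennreal (2 * snd p * (norm ?v)\<^sup>2 + S)"
    using p S by (intro ennreal_plus[symmetric]) auto
  finally show ?case unfolding J X_def[symmetric] by (simp add: S_def)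
qed

section \<open>Gaussian smoothing compressed to a set\<close>

lemma log_concave_gauss_law:
  fixes F :: "'a::euclidean_space \<times> 'b::real_vector \<Rightarrow> ennreal"
  assumes "log_concave F" and "\<And>p. (\<lambda>y. F (y, p)) \<in> borel_measurable borel"
  shows "log_concave (\<lambda>x. \<integral>\<^sup>+z. F (fst x + z, snd x) \<partial>gauss_law L)"
  using assms
proof (induction L)
  case Nil
  have "(\<lambda>x. \<integral>\<^sup>+z. F (fst x + z, snd x) \<partial>gauss_law []) = F"
  proof
    fix x :: "'a \<times> 'b"
    have [measurable]: "(\<lambda>y. F (y, snd x)) \<in> borel_measurable borel" by fact
    show "(\<integral>\<^sup>+z. F (fst x + z, snd x) \<partial>gauss_law []) = F x"
      by (subst nn_integral_gauss_law_Nil) auto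
  qed
  then show ?case using Nil by simp
next
  case (Cons p L)
  define H where "H = (\<lambda>x. \<integral>\<^sup>+z. F (fst x + z, snd x) \<partial>gauss_law L)"
  let ?a = "sqrt (2 * snd p)" and ?v = "fst p"
  have mF[measurable]: "(\<lambda>y. F (y, q)) \<in> borel_measurable borel" for q by (rule Cons.prems)
  have mH[measurable]: "(\<lambda>y. H (y, q)) \<in> borel_measurable borel" for q
    unfolding H_def by simp
  have H: "log_concave H" unfolding H_def by (rule Cons.IH) fact+
  \<comment> \<open>One Gaussian coefficient is exposed as an extra real coordinate and then
    integrated out by \<open>log_concave_marginal\<close>. The second component of the pair is a
    parameter on which no integration acts; later it is the half-length of a chord.\<close>
  let ?G = "\<lambda>s. ennreal (std_normal_density (fst s)) * H (fst (snd s) + (?a * fst s) *\<^sub>R ?v, snd (snd s))"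
  have G: "log_concave ?G"
  proof (rule log_concave_mult)
    show "log_concave (\<lambda>s::real \<times> 'a \<times> 'b. ennreal (std_normal_density (fst s)))"
      by (rule log_concave_linear[OF linear_fst log_concave_std_normal])
    show "log_concave (\<lambda>s. H (fst (snd s) + (?a * fst s) *\<^sub>R ?v, snd (snd s)))"
      by (rule log_concave_linear[OF _ H]) (auto intro!: linearI simp: algebra_simps)
  qed
  have "log_concave (\<lambda>x. \<integral>\<^sup>+t. ?G (t, x) \<partial>lborel)"
    by (rule log_concave_marginal[OF G]) simp
  moreover have "(\<integral>\<^sup>+t. ?G (t, x) \<partial>lborel) = (\<integral>\<^sup>+z. F (fst x + z, snd x) \<partial>gauss_law (p # L))" for x
    by (subst nn_integral_gauss_law_Cons) (simp_all add: nn_integral_gauss H_def add.assoc)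
  ultimately show ?case by simp
qed

text \<open>The variable \<open>y\<close> is split into its coordinates in \<open>Basis\<close>, and
  these are integrated out one at a time by the one-dimensional marginal lemma.\<close>

lemma log_concave_lborel:
  fixes F :: "'a::euclidean_space \<times> 'b::real_vector \<Rightarrow> ennreal"
  assumes F: "log_concave F" and [measurable]: "\<And>p. (\<lambda>y. F (y, p)) \<in> borel_measurable borel"
  shows "log_concave (\<lambda>p. \<integral>\<^sup>+y. F (y, p) \<partial>lborel)"
proof -
  interpret product_sigma_finite "\<lambda>_::'a. lborel :: real measure" ..
  have *: "log_concave (\<lambda>x. \<integral>\<^sup>+\<omega>. F (fst x + (\<Sum>b\<in>B. \<omega> b *\<^sub>R b), snd x) \<partial>PiM B (\<lambda>_. lborel))"
    if "finite B" for B :: "'a set"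
    using that
  proof induction
    case empty
    then show ?case using F by (simp add: PiM_empty nn_integral_count_space_finite)
  next
    case (insert i B)
    define H where "H = (\<lambda>x. \<integral>\<^sup>+\<omega>. F (fst x + (\<Sum>b\<in>B. \<omega> b *\<^sub>R b), snd x) \<partial>PiM B (\<lambda>_. lborel))"
    interpret B: finite_product_sigma_finite "\<lambda>_::'a. lborel :: real measure" B by standard fact
    have mH[measurable]: "(\<lambda>y. H (y, q)) \<in> borel_measurable borel" for q
      unfolding H_def by simp
    have "log_concave (\<lambda>s :: real \<times> 'a \<times> 'b. H (fst (snd s) + fst s *\<^sub>R i, snd (snd s)))"
      using insert.IH unfolding H_def[symmetric]
      by (rule log_concave_linear[rotated]) (auto intro!: linearI simp: algebra_simps)
    then have "log_concave (\<lambda>x. \<integral>\<^sup>+t. H (fst x + t *\<^sub>R i, snd x) \<partial>lborel)"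
      by (rule log_concave_marginal[where F="\<lambda>s. H (fst (snd s) + fst s *\<^sub>R i, snd (snd s))", simplified])
    moreover have "(\<integral>\<^sup>+t. H (fst x + t *\<^sub>R i, snd x) \<partial>lborel)
      = (\<integral>\<^sup>+\<omega>. F (fst x + (\<Sum>b\<in>insert i B. \<omega> b *\<^sub>R b), snd x) \<partial>PiM (insert i B) (\<lambda>_. lborel))" for x
    proof -
      have "(\<Sum>b\<in>B. fun_upd \<omega> i t b *\<^sub>R b) = (\<Sum>b\<in>B. \<omega> b *\<^sub>R b)" for \<omega> :: "'a \<Rightarrow> real" and t
        using insert by (intro sum.cong) auto
      then show ?thesis using insert
        by (subst product_nn_integral_insert_rev) (auto simp: H_def add.assoc)
    qed
    ultimately show ?case by simp
  qed
  have "log_concave (\<lambda>p. \<integral>\<^sup>+\<omega>. F (fst (0::'a, p) + (\<Sum>b\<in>Basis. \<omega> b *\<^sub>R b), snd (0::'a, p)) \<partial>PiM (Basis :: 'a set) (\<lambda>_. lborel))"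
    by (rule log_concave_linear[OF _ *[of Basis], of "\<lambda>p. (0, p)"]) (auto intro!: linearI)
  moreover have "(\<integral>\<^sup>+y. F (y, p) \<partial>lborel) = (\<integral>\<^sup>+\<omega>. F (\<Sum>b\<in>Basis. \<omega> b *\<^sub>R b, p) \<partial>PiM (Basis :: 'a set) (\<lambda>_. lborel))" for p
    by (subst lborel_eq, subst nn_integral_distr) auto
  ultimately show ?thesis by simp
qed

section \<open>The smoothing form and its principal eigenvalue\<close>

definition smooth :: "('a::euclidean_space \<times> real) list \<Rightarrow> ('a \<Rightarrow> ennreal) \<Rightarrow> 'a \<Rightarrow> ennreal" where
  "smooth L f y = (\<integral>\<^sup>+z. f (y + z) \<partial>gauss_law L)"

definition killed :: "'a set \<Rightarrow> ('a::euclidean_space \<times> real) list \<Rightarrow> ('a \<Rightarrow> ennreal) \<Rightarrow> 'a \<Rightarrow> ennreal" where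
  "killed K L f y = indicator K y * smooth L f y"

abbreviation ip :: "('a::euclidean_space \<Rightarrow> ennreal) \<Rightarrow> ('a \<Rightarrow> ennreal) \<Rightarrow> ennreal" where
  "ip f g \<equiv> \<integral>\<^sup>+y. f y * g y \<partial>lborel"

definition autocorr :: "('a::euclidean_space \<Rightarrow> ennreal) \<Rightarrow> 'a \<Rightarrow> ennreal" where
  "autocorr f z = (\<integral>\<^sup>+y. f y * f (y + z) \<partial>lborel)"

text \<open>Values in \<open>ennreal\<close> make every state nonnegative, which costs nothing
  because Gaussian averaging preserves positivity. The bound \<open>M\<close> lets a state be
  dominated by a multiple of the indicator of \<open>K\<close>.\<close>

definition unit_state :: "'a::euclidean_space set \<Rightarrow> ('a \<Rightarrow> ennreal) set" where
  "unit_state K = {f \<in> borel_measurable borel. (\<forall>y. y \<notin> K \<longrightarrow> f y = 0) \<and> (\<exists>M::real. \<forall>y. f y \<le> ennreal M) \<and> ip f f = 1}"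

definition prin_eig :: "('a::euclidean_space \<times> real) list \<Rightarrow> 'a set \<Rightarrow> ennreal" where
  "prin_eig L K = (SUP f\<in>unit_state K. ip f (smooth L f))"

lemma measurable_smooth[measurable]:
  assumes [measurable]: "f \<in> borel_measurable borel"
  shows "smooth L f \<in> borel_measurable borel"
  unfolding smooth_def[abs_def] by measurable

lemma measurable_killed[measurable]:
  assumes [measurable]: "f \<in> borel_measurable borel" "K \<in> sets borel"
  shows "killed K L f \<in> borel_measurable borel"
  unfolding killed_def[abs_def] by measurable

lemma measurable_autocorr[measurable]:
  assumes [measurable]: "f \<in> borel_measurable borel"
  shows "autocorr f \<in> borel_measurable borel"
  unfolding autocorr_def[abs_def] by measurable

lemma nn_integral_lborel_translate:
  fixes f :: "'a::euclidean_space \<Rightarrow> ennreal"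
  assumes [measurable]: "f \<in> borel_measurable borel"
  shows "(\<integral>\<^sup>+y. f (y + z) \<partial>lborel) = (\<integral>\<^sup>+y. f y \<partial>lborel)"
proof -
  have "(\<integral>\<^sup>+y. f y \<partial>lborel) = (\<integral>\<^sup>+y. f y \<partial>(distr lborel borel ((+) z)))"
    by (simp only: lborel_distr_plus)
  also have "\<dots> = (\<integral>\<^sup>+y. f (y + z) \<partial>lborel)"
    by (subst nn_integral_distr) (auto simp: add.commute)
  finally show ?thesis by simp
qed

lemma ip_smooth:
  assumes [measurable]: "f \<in> borel_measurable borel" "g \<in> borel_measurable borel"
  shows "ip f (smooth L g) = (\<integral>\<^sup>+z. \<integral>\<^sup>+y. f y * g (y + z) \<partial>lborel \<partial>gauss_law L)"
proof -
  have "ip f (smooth L g) = (\<integral>\<^sup>+y. \<integral>\<^sup>+z. f y * g (y + z) \<partial>gauss_law L \<partial>lborel)"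
    unfolding smooth_def by (intro nn_integral_cong nn_integral_cmult[symmetric]) measurable
  also have "\<dots> = (\<integral>\<^sup>+z. \<integral>\<^sup>+y. f y * g (y + z) \<partial>lborel \<partial>gauss_law L)"
    by (rule lborel_gauss_law.Fubini'[symmetric]) measurable
  finally show ?thesis .
qed

lemma ip_smooth_autocorr:
  "f \<in> borel_measurable borel \<Longrightarrow> ip f (smooth L f) = (\<integral>\<^sup>+z. autocorr f z \<partial>gauss_law L)"
  unfolding autocorr_def by (rule ip_smooth)

text \<open>Self-adjointness: the Gaussian law is symmetric and Lebesgue measure is translation
  invariant.\<close>

lemma ip_smooth_commute:
  assumes [measurable]: "f \<in> borel_measurable borel" "g \<in> borel_measurable borel"
  shows "ip f (smooth L g) = ip (smooth L f) g"
proof -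
  have "ip f (smooth L g) = (\<integral>\<^sup>+z. \<integral>\<^sup>+y. f y * g (y + z) \<partial>lborel \<partial>gauss_law L)"
    by (rule ip_smooth) fact+
  also have "\<dots> = (\<integral>\<^sup>+z. \<integral>\<^sup>+y. f y * g (y + - z) \<partial>lborel \<partial>gauss_law L)"
    by (rule nn_integral_gauss_law_uminus[symmetric]) measurable
  also have "\<dots> = (\<integral>\<^sup>+z. \<integral>\<^sup>+y. g y * f (y + z) \<partial>lborel \<partial>gauss_law L)"
  proof (rule nn_integral_cong)
    fix z
    show "(\<integral>\<^sup>+y. f y * g (y + - z) \<partial>lborel) = (\<integral>\<^sup>+y. g y * f (y + z) \<partial>lborel)"
      by (subst nn_integral_lborel_translate[symmetric, of _ z]) (auto simp: mult.commute)
  qed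
  also have "\<dots> = ip g (smooth L f)"
    by (rule ip_smooth[symmetric]) fact+
  finally show ?thesis by (simp add: mult.commute)
qed

lemma smooth_halve:
  assumes [measurable]: "f \<in> borel_measurable borel"
  shows "smooth (halve L) (smooth (halve L) f) = smooth L f"
proof
  fix y
  show "smooth (halve L) (smooth (halve L) f) y = smooth L f y"
    unfolding smooth_def by (subst nn_integral_gauss_law_halve[symmetric]) (auto simp: add.assoc)
qed

lemma ip_smooth_halve:
  assumes [measurable]: "f \<in> borel_measurable borel" "g \<in> borel_measurable borel"
  shows "ip f (smooth L g) = ip (smooth (halve L) f) (smooth (halve L) g)"
  by (subst smooth_halve[symmetric], simp, subst ip_smooth_commute) auto

lemma ip_Cauchy_Schwarz:
  assumes "f \<in> borel_measurable borel" "g \<in> borel_measurable borel"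
  shows "(ip f g)\<^sup>2 \<le> ip f f * ip g g"
  using Cauchy_Schwarz_nn_integral[of f lborel g] assms by (simp add: power2_eq_square)

text \<open>The form is positive semidefinite, because it is the plain inner product of the
  functions smoothed along \<open>halve L\<close>.\<close>

lemma ip_smooth_Cauchy_Schwarz:
  assumes [measurable]: "f \<in> borel_measurable borel" "g \<in> borel_measurable borel"
  shows "(ip f (smooth L g))\<^sup>2 \<le> ip f (smooth L f) * ip g (smooth L g)"
  by (subst (1 2 3) ip_smooth_halve) (auto intro!: ip_Cauchy_Schwarz)

lemma ennreal_power2_le_imp_le: "x\<^sup>2 \<le> y\<^sup>2 \<Longrightarrow> x \<le> (y::ennreal)"
  by (cases x; cases y) (auto simp: ennreal_power power_mono_iff top_unique)

lemma autocorr_le: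
  assumes [measurable]: "f \<in> borel_measurable borel"
  shows "autocorr f z \<le> ip f f"
proof (rule ennreal_power2_le_imp_le)
  have "(autocorr f z)\<^sup>2 \<le> ip f f * ip (\<lambda>y. f (y + z)) (\<lambda>y. f (y + z))"
    unfolding autocorr_def by (rule ip_Cauchy_Schwarz) auto
  also have "ip (\<lambda>y. f (y + z)) (\<lambda>y. f (y + z)) = ip f f"
    by (rule nn_integral_lborel_translate) simp
  finally show "(autocorr f z)\<^sup>2 \<le> (ip f f)\<^sup>2" by (simp add: power2_eq_square)
qed

lemma ip_smooth_le:
  assumes [measurable]: "f \<in> borel_measurable borel"
  shows "ip f (smooth L f) \<le> ip f f"
proof -
  have "ip f (smooth L f) \<le> (\<integral>\<^sup>+z. ip f f \<partial>gauss_law L)"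
    unfolding ip_smooth_autocorr[OF assms] by (intro nn_integral_mono autocorr_le assms)
  then show ?thesis unfolding nn_integral_gauss_law_const .
qed

lemma prin_eig_le_1: "prin_eig L K \<le> 1"
  unfolding prin_eig_def by (rule SUP_least) (use ip_smooth_le in \<open>fastforce simp: unit_state_def\<close>)

lemma prin_eig_real:
  obtains r where "0 \<le> r" "r \<le> 1" "prin_eig L K = ennreal r"
  using prin_eig_le_1[of L K] by (cases "prin_eig L K") (auto simp: top_unique)

lemma prin_eig_mono: "K \<subseteq> K' \<Longrightarrow> prin_eig L K \<le> prin_eig L K'"
  unfolding prin_eig_def by (rule SUP_subset_mono) (auto simp: unit_state_def)

lemma ip_smooth_scale:
  assumes [measurable]: "f \<in> borel_measurable borel"
  shows "ip (\<lambda>y. c * f y) (smooth L (\<lambda>y. c * f y)) = c\<^sup>2 * ip f (smooth L f)"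
proof -
  have "smooth L (\<lambda>y. c * f y) = (\<lambda>y. c * smooth L f y)"
    unfolding smooth_def[abs_def] by (intro ext nn_integral_cmult) measurable
  then have "ip (\<lambda>y. c * f y) (smooth L (\<lambda>y. c * f y)) = (\<integral>\<^sup>+y. c\<^sup>2 * (f y * smooth L f y) \<partial>lborel)"
    by (simp add: power2_eq_square mult_ac)
  also have "\<dots> = c\<^sup>2 * ip f (smooth L f)" by (rule nn_integral_cmult) measurable
  finally show ?thesis .
qed

lemma ip_smooth_le_prin_eig:
  assumes [measurable]: "f \<in> borel_measurable borel" and f: "\<And>y. y \<notin> K \<Longrightarrow> f y = 0" "\<And>y. f y \<le> ennreal M"
    and fin: "ip f f < top"
  shows "ip f (smooth L f) \<le> prin_eig L K * ip f f"
proof (cases "ip f f = 0")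
  case True
  then show ?thesis using ip_smooth_le[of f L] by simp
next
  case False
  then obtain n where n: "n > 0" "ip f f = ennreal n"
    using fin by (cases "ip f f") (auto simp: less_le)
  define c where "c = ennreal (1 / sqrt n)"
  have c2: "c\<^sup>2 * ennreal n = 1" using n
    by (simp add: c_def ennreal_power ennreal_mult'[symmetric] power_divide)
  have "(\<lambda>y. c * f y) \<in> unit_state K"
  proof -
    have "c * f y \<le> ennreal (1 / sqrt n * max 0 M)" for y
    proof -
      have "c * f y \<le> ennreal (1 / sqrt n) * ennreal (max 0 M)"
        unfolding c_def by (intro mult_left_mono order_trans[OF f(2)[of y]]) (auto intro: ennreal_leI)
      also have "\<dots> = ennreal (1 / sqrt n * max 0 M)" using n by (intro ennreal_mult[symmetric]) auto
      finally show ?thesis .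
    qed
    moreover have "ip (\<lambda>y. c * f y) (\<lambda>y. c * f y) = (\<integral>\<^sup>+y. c\<^sup>2 * (f y * f y) \<partial>lborel)"
      by (intro nn_integral_cong) (simp add: power2_eq_square mult_ac)
    moreover have "\<dots> = c\<^sup>2 * ip f f" by (rule nn_integral_cmult) measurable
    ultimately show ?thesis using f c2 n by (auto simp: unit_state_def)
  qed
  then have "ip (\<lambda>y. c * f y) (smooth L (\<lambda>y. c * f y)) \<le> prin_eig L K"
    unfolding prin_eig_def by (rule SUP_upper)
  then have "c\<^sup>2 * ip f (smooth L f) \<le> prin_eig L K" by (simp add: ip_smooth_scale)
  then have "c\<^sup>2 * ip f (smooth L f) * ennreal n \<le> prin_eig L K * ennreal n" by (rule mult_right_mono) simp
  also have "c\<^sup>2 * ip f (smooth L f) * ennreal n = (c\<^sup>2 * ennreal n) * ip f (smooth L f)" by (simp add: mult_ac)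
  finally show ?thesis using c2 n by simp
qed

text \<open>For a unit vector \<open>f\<close> and the square root \<open>P\<close> of the
  smoothing, Cauchy-Schwarz gives \<open><f, P f>^2 \<le> <P f, P f> = <f, P^2 f>\<close>. This is
  what allows the weights to be scaled down.\<close>

lemma prin_eig_halve: "(prin_eig (halve L) K)\<^sup>2 \<le> prin_eig L K"
proof (rule ccontr)
  assume "\<not> ?thesis"
  then have lt: "prin_eig L K < (prin_eig (halve L) K)\<^sup>2" by simp
  have sq: "(ip f (smooth (halve L) f))\<^sup>2 \<le> prin_eig L K" if f: "f \<in> unit_state K" for f
  proof -
    have [measurable]: "f \<in> borel_measurable borel" and 1: "ip f f = 1" using f by (auto simp: unit_state_def)
    have "(ip f (smooth (halve L) f))\<^sup>2 \<le> ip f f * ip (smooth (halve L) f) (smooth (halve L) f)"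
      by (rule ip_Cauchy_Schwarz) auto
    also have "\<dots> = ip f (smooth L f)" using 1 by (simp add: ip_smooth_halve[symmetric])
    also have "\<dots> \<le> prin_eig L K" unfolding prin_eig_def using f by (rule SUP_upper)
    finally show ?thesis .
  qed
  obtain r where r: "r \<ge> 0" "prin_eig L K = ennreal r" by (rule prin_eig_real)
  have "ip f (smooth (halve L) f) \<le> ennreal (sqrt r)" if f: "f \<in> unit_state K" for f
    by (rule ennreal_power2_le_imp_le) (use sq[OF f] r in \<open>simp add: ennreal_power\<close>)
  then have "prin_eig (halve L) K \<le> ennreal (sqrt r)" unfolding prin_eig_def by (rule SUP_least)
  then have "(prin_eig (halve L) K)\<^sup>2 \<le> (ennreal (sqrt r))\<^sup>2" by (rule power_mono) simp
  also have "\<dots> = prin_eig L K" using r by (simp add: ennreal_power)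
  finally show False using lt by simp
qed


section \<open>Survival of the killed walk and log-concavity of the eigenvalue\<close>

definition survival :: "'a set \<Rightarrow> ('a::euclidean_space \<times> real) list \<Rightarrow> nat \<Rightarrow> ennreal" where
  "survival K L N = (\<integral>\<^sup>+y. (killed K L ^^ N) (indicator K) y \<partial>lborel)"

lemma measurable_killed_pow[measurable]:
  assumes [measurable]: "f \<in> borel_measurable borel" "K \<in> sets borel"
  shows "(killed K L ^^ N) f \<in> borel_measurable borel"
  by (induction N) auto

lemma killed_pow_Suc: "(killed K L ^^ Suc N) f y = indicator K y * smooth L ((killed K L ^^ N) f) y"
  by (simp add: killed_def)

lemma killed_pow_eq_0: "(\<And>y. y \<notin> K \<Longrightarrow> f y = 0) \<Longrightarrow> y \<notin> K \<Longrightarrow> (killed K L ^^ N) f y = 0"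
  by (cases N) (auto simp: killed_pow_Suc simp del: funpow.simps(2))

lemma killed_pow_mono:
  assumes "\<And>y. f y \<le> g y"
  shows "(killed K L ^^ N) f y \<le> (killed K L ^^ N) g y"
  using assms
proof (induction N arbitrary: y)
  case (Suc N)
  then show ?case unfolding killed_pow_Suc smooth_def
    by (intro mult_left_mono nn_integral_mono) auto
qed simp

lemma killed_pow_scale:
  assumes [measurable]: "f \<in> borel_measurable borel" "K \<in> sets borel"
  shows "(killed K L ^^ N) (\<lambda>y. c * f y) = (\<lambda>y. c * (killed K L ^^ N) f y)"
proof (induction N)
  case (Suc N)
  have "smooth L (\<lambda>y. c * (killed K L ^^ N) f y) = (\<lambda>y. c * smooth L ((killed K L ^^ N) f) y)"
    unfolding smooth_def[abs_def] by (intro ext nn_integral_cmult) measurable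
  then show ?case by (intro ext) (simp only: killed_pow_Suc Suc.IH mult.left_commute)
qed simp

lemma killed_pow_indicator_le_1:
  assumes [measurable]: "K \<in> sets borel"
  shows "(killed K L ^^ N) (indicator K) y \<le> 1"
proof (induction N arbitrary: y)
  case (Suc N)
  have "smooth L ((killed K L ^^ N) (indicator K)) y \<le> (\<integral>\<^sup>+z. 1 \<partial>gauss_law L)"
    unfolding smooth_def by (intro nn_integral_mono Suc)
  also have "\<dots> = 1" by (rule nn_integral_gauss_law_const)
  finally show ?case unfolding killed_pow_Suc by (auto simp: indicator_def)
qed (auto simp: indicator_def)

lemma ip_killed:
  assumes "\<And>y. y \<notin> K \<Longrightarrow> f y = 0"
  shows "ip f (killed K L g) = ip f (smooth L g)"
  by (intro nn_integral_cong) (use assms in \<open>auto simp: killed_def indicator_def\<close>)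

lemma ip_killed_pow_commute:
  assumes [measurable]: "f \<in> borel_measurable borel" "g \<in> borel_measurable borel" "K \<in> sets borel"
    and f: "\<And>y. y \<notin> K \<Longrightarrow> f y = 0" and g: "\<And>y. y \<notin> K \<Longrightarrow> g y = 0"
  shows "ip f ((killed K L ^^ (a + b)) g) = ip ((killed K L ^^ a) f) ((killed K L ^^ b) g)"
  using assms(1,4)
proof (induction a arbitrary: f)
  case (Suc a)
  note [measurable] = Suc.prems(1)
  let ?h = "(killed K L ^^ (a + b)) g"
  have "ip f ((killed K L ^^ (Suc a + b)) g) = ip f (smooth L ?h)"
    using ip_killed[of K f L ?h] Suc.prems(2) by simp
  also have "\<dots> = ip (smooth L f) ?h" by (rule ip_smooth_commute) measurable
  also have "\<dots> = ip (killed K L f) ?h"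
  proof (rule nn_integral_cong)
    fix y
    show "smooth L f y * ?h y = killed K L f y * ?h y"
      using killed_pow_eq_0[of K g y "a + b" L] g by (cases "y \<in> K") (auto simp: killed_def)
  qed
  also have "\<dots> = ip ((killed K L ^^ a) (killed K L f)) ((killed K L ^^ b) g)"
    by (rule Suc.IH) (auto simp: killed_def)
  finally show ?case by (simp add: funpow_swap1)
qed simp

text \<open>\<open>survival K L N\<close> is the integral over the starting point of the probability
  that a walk with Gaussian steps is in \<open>K\<close> at all times from 0 to \<open>N\<close>.
  Each use of Cauchy-Schwarz doubles the number of steps, hence the powers of 2; at the end
  \<open>f\<close> is dominated by \<open>M\<close> times the indicator of \<open>K\<close>.\<close>

lemma ip_smooth_power_le_survival:
  assumes f: "f \<in> unit_state K" and [measurable]: "K \<in> sets borel" and M: "\<And>y. f y \<le> M"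
  shows "(ip f (smooth L f)) ^ (2 ^ k) \<le> M\<^sup>2 * survival K L (2 ^ k)"
proof -
  have [measurable]: "f \<in> borel_measurable borel" and 0: "\<And>y. y \<notin> K \<Longrightarrow> f y = 0" and 1: "ip f f = 1"
    using f by (auto simp: unit_state_def)
  have dbl: "(ip f ((killed K L ^^ m) f))\<^sup>2 \<le> ip f ((killed K L ^^ (m + m)) f)" for m
    using ip_Cauchy_Schwarz[of f "(killed K L ^^ m) f"] by (subst ip_killed_pow_commute) (auto simp: 0 1)
  have "(ip f (smooth L f)) ^ (2 ^ k) \<le> ip f ((killed K L ^^ (2 ^ k)) f)"
  proof (induction k)
    case 0
    have "ip f (killed K L f) = ip f (smooth L f)" by (rule ip_killed) fact
    then show ?case by simp
  next
    case (Suc k)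
    have "(ip f (smooth L f)) ^ (2 ^ Suc k) = ((ip f (smooth L f)) ^ (2 ^ k))\<^sup>2"
      by (simp add: power_mult[symmetric] mult.commute)
    also have "\<dots> \<le> (ip f ((killed K L ^^ (2 ^ k)) f))\<^sup>2" by (rule power_mono[OF Suc]) simp
    also have "\<dots> \<le> ip f ((killed K L ^^ (2 ^ Suc k)) f)" using dbl[of "2 ^ k"] by (simp add: mult_2)
    finally show ?case .
  qed
  also have "\<dots> \<le> ip (\<lambda>y. M * indicator K y) ((killed K L ^^ (2 ^ k)) (\<lambda>y. M * indicator K y))"
    by (intro nn_integral_mono mult_mono killed_pow_mono) (use M 0 in \<open>auto simp: indicator_def\<close>)
  also have "\<dots> = (\<integral>\<^sup>+y. M\<^sup>2 * (killed K L ^^ (2 ^ k)) (indicator K) y \<partial>lborel)"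
    by (subst killed_pow_scale, simp, simp, rule nn_integral_cong)
      (use killed_pow_eq_0[of K "indicator K"] in \<open>auto simp: indicator_def power2_eq_square mult_ac\<close>)
  also have "\<dots> = M\<^sup>2 * survival K L (2 ^ k)"
    unfolding survival_def by (rule nn_integral_cmult) measurable
  finally show ?thesis .
qed

text \<open>For the killed operator \<open>T\<close> the numbers \<open>b m = <1_K, T^m 1_K>\<close>
  gain at most the factor \<open>prin_eig L K\<close> per step. From even \<open>m\<close> this is
  the Rayleigh bound for \<open>T^j 1_K\<close>; from odd \<open>m\<close> it follows by
  Cauchy-Schwarz and the step after it, which starts from an even number.\<close>

lemma survival_le_prin_eig_power:
  assumes [measurable]: "K \<in> sets borel" and fin: "emeasure lborel K < top"
  shows "survival K L N \<le> prin_eig L K ^ N * emeasure lborel K"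
proof -
  let ?e = "indicator K :: 'a \<Rightarrow> ennreal"
  let ?T = "\<lambda>j. (killed K L ^^ j) ?e"
  define b where "b m = ip ?e (?T m)" for m
  have [measurable]: "?T j \<in> borel_measurable borel" for j by measurable
  have 0: "?T j y = 0" if "y \<notin> K" for j y by (rule killed_pow_eq_0[OF _ that]) auto
  have b2: "b (i + j) = ip (?T i) (?T j)" for i j
    unfolding b_def by (rule ip_killed_pow_commute) auto
  have Qb: "survival K L N = b N" for N
    unfolding survival_def b_def by (intro nn_integral_cong) (use 0 in \<open>auto simp: indicator_def\<close>)
  have le1: "?T j y \<le> 1" for j y by (rule killed_pow_indicator_le_1) measurable
  have le: "b N \<le> emeasure lborel K" for N
  proof -
    have "b N \<le> (\<integral>\<^sup>+y. ?e y \<partial>lborel)" unfolding b_def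
      by (intro nn_integral_mono) (use le1 in \<open>auto simp: indicator_def\<close>)
    then show ?thesis by simp
  qed
  have odd: "b (Suc (j + j)) = ip (?T j) (smooth L (?T j))" for j
    using b2[of j "Suc j"] ip_killed[of K "?T j" L "?T j"] 0 by simp
  have S1: "b (Suc (j + j)) \<le> prin_eig L K * b (j + j)" for j
    unfolding odd b2 by (rule ip_smooth_le_prin_eig[where M=1])
      (use 0 le1 le[of "j + j"] fin in \<open>auto simp: b2[symmetric] intro: le_less_trans\<close>)
  have step: "b (Suc m) \<le> prin_eig L K * b m" for m
  proof (cases "even m")
    case True
    then obtain j where "m = j + j" by (auto simp: mult_2 elim: evenE)
    then show ?thesis using S1 by simp
  next
    case False
    then obtain j where m: "m = Suc (j + j)" by (auto simp: mult_2 elim: oddE)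
    have e: "Suc m = j + Suc (Suc j)" using m by simp
    have "(b (Suc m))\<^sup>2 = (ip (?T j) (smooth L (?T (Suc j))))\<^sup>2"
      unfolding e b2 using ip_killed[of K "?T j" L "?T (Suc j)"] 0 by simp
    also have "\<dots> \<le> ip (?T j) (smooth L (?T j)) * ip (?T (Suc j)) (smooth L (?T (Suc j)))"
      by (rule ip_smooth_Cauchy_Schwarz) auto
    also have "\<dots> = b m * b (Suc (Suc j + Suc j))" unfolding odd m ..
    also have "\<dots> \<le> b m * (prin_eig L K * b (Suc j + Suc j))"
      by (intro mult_left_mono S1) auto
    also have "Suc j + Suc j = Suc m" using m by simp
    finally have *: "(b (Suc m))\<^sup>2 \<le> (prin_eig L K * b m) * b (Suc m)" by (simp add: mult_ac)
    show ?thesis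
    proof (cases "b (Suc m) = 0")
      case False
      have t: "b (Suc m) \<noteq> top" using le[of "Suc m"] fin by auto
      have "b (Suc m) * b (Suc m) / b (Suc m) \<le> (prin_eig L K * b m) * b (Suc m) / b (Suc m)"
        using * by (intro divide_right_mono_ennreal) (simp add: power2_eq_square)
      then show ?thesis using False t by (simp add: ennreal_mult_divide_eq)
    qed simp
  qed
  have "b N \<le> prin_eig L K ^ N * b 0"
  proof (induction N)
    case (Suc N)
    have "b (Suc N) \<le> prin_eig L K * b N" by (rule step)
    also have "\<dots> \<le> prin_eig L K * (prin_eig L K ^ N * b 0)" by (intro mult_left_mono Suc) auto
    finally show ?case by (simp add: mult_ac)
  qed simp
  also have "\<dots> \<le> prin_eig L K ^ N * emeasure lborel K" by (intro mult_left_mono le) auto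
  finally show ?thesis unfolding Qb .
qed

text \<open>Each step of the walk integrates out a Gaussian and multiplies by the indicator of a set
  that is convex in \<open>(y, p)\<close> jointly; both preserve log-concavity. The starting point
  is integrated out last.\<close>

lemma log_concave_survival:
  fixes Kf :: "real \<Rightarrow> 'a::euclidean_space set"
  assumes conv: "convex {(y, p). y \<in> Kf p}" and [measurable]: "\<And>p. Kf p \<in> sets borel"
  shows "log_concave (\<lambda>p. survival (Kf p) L N)"
proof -
  have ind: "log_concave (\<lambda>x. indicator (Kf (snd x)) (fst x))"
  proof -
    have "(\<lambda>x. indicator (Kf (snd x)) (fst x) :: ennreal) = indicator {(y, p). y \<in> Kf p}"
      by (auto simp: indicator_def fun_eq_iff)
    then show ?thesis using log_concave_indicator[OF conv] by simp
  qed
  have "log_concave (\<lambda>x. (killed (Kf (snd x)) L ^^ N) (indicator (Kf (snd x))) (fst x))"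
  proof (induction N)
    case 0
    then show ?case using ind by simp
  next
    case (Suc N)
    let ?F = "\<lambda>x. (killed (Kf (snd x)) L ^^ N) (indicator (Kf (snd x))) (fst x)"
    have "log_concave (\<lambda>x. \<integral>\<^sup>+z. ?F (fst x + z, snd x) \<partial>gauss_law L)"
      by (rule log_concave_gauss_law[OF Suc]) simp
    from log_concave_mult[OF ind this] show ?case by (simp add: killed_pow_Suc smooth_def del: funpow.simps(2))
  qed
  from log_concave_lborel[OF this] show ?thesis by (simp add: survival_def)
qed

text \<open>Constant factors disappear under the root of order \<open>2 ^ k\<close>.\<close>

lemma le_of_power_le:
  fixes x y C D :: real
  assumes "\<And>k. C * x ^ (2 ^ k) \<le> D * y ^ (2 ^ k)" "C > 0" "x > 0" "y \<ge> 0"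
  shows "x \<le> y"
proof (rule ccontr)
  assume "\<not> x \<le> y"
  then have "y / x < 1" "y / x \<ge> 0" using assms by auto
  have lim: "(\<lambda>k. D * (y / x) ^ (2 ^ k)) \<longlonglongrightarrow> D * 0"
  proof (intro tendsto_mult tendsto_const)
    have "(\<lambda>n. (y / x) ^ n) \<longlonglongrightarrow> 0" by (rule LIMSEQ_realpow_zero) fact+
    moreover have "strict_mono (\<lambda>k. 2 ^ k :: nat)" by (auto simp: strict_mono_def)
    ultimately show "(\<lambda>k. (y / x) ^ (2 ^ k)) \<longlonglongrightarrow> 0"
      using LIMSEQ_subseq_LIMSEQ[of "\<lambda>n. (y / x) ^ n" 0 "\<lambda>k. 2 ^ k"] by (simp add: o_def)
  qed
  have "C \<le> D * (y / x) ^ (2 ^ k)" for k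
    using assms(1)[of k] assms(3) by (simp add: power_divide field_simps)
  then have "C \<le> D * 0" by (intro LIMSEQ_le_const[OF lim]) auto
  then show False using assms by simp
qed

text \<open>Up to constants, survival after \<open>2 ^ k\<close> steps is at most that power of the
  eigenvalue and at least that power of any smaller positive number. Log-concavity of survival
  therefore passes to its exponential rate.\<close>

theorem log_concave_prin_eig:
  fixes Kf :: "real \<Rightarrow> 'a::euclidean_space set"
  assumes conv: "convex {(y, p). y \<in> Kf p}" and [measurable]: "\<And>p. Kf p \<in> sets borel"
    and fin: "\<And>p. emeasure lborel (Kf p) < top"
  shows "log_concave (\<lambda>p. prin_eig L (Kf p))"
proof (rule log_concaveI)
  fix p q m a b :: real
  assume m: "0 < m" "m < 1" and ab: "0 < a" "0 < b"
    and a: "ennreal a \<le> prin_eig L (Kf p)" and b: "ennreal b \<le> prin_eig L (Kf q)"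
  let ?c = "(1 - m) *\<^sub>R p + m *\<^sub>R q"
  obtain r where r: "r \<ge> 0" "prin_eig L (Kf ?c) = ennreal r" by (rule prin_eig_real)
  obtain V where V: "V \<ge> 0" "emeasure lborel (Kf ?c) = ennreal V"
    using fin[of ?c] by (cases "emeasure lborel (Kf ?c)") auto
  \<comment> \<open>\<open>M\<close> depends on the near-extremal state but not on \<open>k\<close>,
    so it does not affect the rate.\<close>
  have ex: "\<exists>M>0. \<forall>k. ennreal (\<alpha> ^ (2 ^ k) / M) \<le> survival (Kf p) L (2 ^ k)"
    if \<alpha>: "0 < \<alpha>" "ennreal \<alpha> < prin_eig L (Kf p)" for \<alpha> p
  proof -
    obtain f where f: "f \<in> unit_state (Kf p)" "ennreal \<alpha> < ip f (smooth L f)"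
      using \<alpha>(2) unfolding prin_eig_def by (auto simp: less_SUP_iff)
    obtain M' where M': "\<And>y. f y \<le> ennreal M'" using f(1) by (auto simp: unit_state_def)
    define M where "M = max 1 M'"
    have M: "M > 0" "f y \<le> ennreal M" for y
      unfolding M_def using M'[of y] by (auto intro: order_trans ennreal_leI)
    have "ennreal (\<alpha> ^ (2 ^ k) / M\<^sup>2) \<le> survival (Kf p) L (2 ^ k)" for k
    proof -
      have "ennreal (\<alpha> ^ (2 ^ k)) = ennreal \<alpha> ^ (2 ^ k)" using \<alpha> by (simp add: ennreal_power)
      also have "\<dots> \<le> (ip f (smooth L f)) ^ (2 ^ k)" using f(2) by (intro power_mono) auto
      also have "\<dots> \<le> ennreal M ^ 2 * survival (Kf p) L (2 ^ k)"
        by (rule ip_smooth_power_le_survival[OF f(1) _ M(2)]) simp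
      finally have "ennreal (1 / M\<^sup>2) * ennreal (\<alpha> ^ (2 ^ k)) \<le> ennreal (1 / M\<^sup>2) * (ennreal M ^ 2 * survival (Kf p) L (2 ^ k))"
        by (rule mult_left_mono) simp
      also have "\<dots> = (ennreal (1 / M\<^sup>2) * ennreal (M\<^sup>2)) * survival (Kf p) L (2 ^ k)"
        using M(1) by (simp add: ennreal_power mult_ac)
      also have "ennreal (1 / M\<^sup>2) * ennreal (M\<^sup>2) = 1"
        using M(1) by (subst ennreal_mult[symmetric]) auto
      also have "ennreal (1 / M\<^sup>2) * ennreal (\<alpha> ^ (2 ^ k)) = ennreal (\<alpha> ^ (2 ^ k) / M\<^sup>2)"
        using \<alpha> M(1) by (subst ennreal_mult[symmetric]) auto
      finally show ?thesis by simp
    qed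
    then show ?thesis using M(1) by (intro exI[of _ "M\<^sup>2"]) auto
  qed
  have "s * (a powr (1 - m) * b powr m) \<le> r" if s: "0 < s" "s < 1" for s
  proof -
    have "ennreal (s * a) < ennreal a" "ennreal (s * b) < ennreal b" using s ab by (auto simp: ennreal_less_iff)
    then have sa: "0 < s * a" "ennreal (s * a) < prin_eig L (Kf p)" and sb: "0 < s * b" "ennreal (s * b) < prin_eig L (Kf q)"
      using a b s ab by auto
    obtain M where M: "M > 0" "\<And>k. ennreal ((s * a) ^ (2 ^ k) / M) \<le> survival (Kf p) L (2 ^ k)" using ex[OF sa] by blast
    obtain M' where M': "M' > 0" "\<And>k. ennreal ((s * b) ^ (2 ^ k) / M') \<le> survival (Kf q) L (2 ^ k)" using ex[OF sb] by blast
    define x where "x = (s * a) powr (1 - m) * (s * b) powr m"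
    define C where "C = (1 / M) powr (1 - m) * (1 / M') powr m"
    have "C * x ^ (2 ^ k) \<le> V * r ^ (2 ^ k)" for k
    proof -
      have "ennreal (((s * a) ^ (2 ^ k) / M) powr (1 - m) * ((s * b) ^ (2 ^ k) / M') powr m) \<le> survival (Kf ?c) L (2 ^ k)"
        by (rule log_concaveD[OF log_concave_survival[OF conv] m]) (use sa sb M M' in auto)
      also have "\<dots> \<le> prin_eig L (Kf ?c) ^ (2 ^ k) * emeasure lborel (Kf ?c)"
        by (rule survival_le_prin_eig_power) (use fin in auto)
      also have "\<dots> = ennreal (V * r ^ (2 ^ k))" using r V by (simp add: ennreal_power ennreal_mult mult.commute)
      also have "((s * a) ^ (2 ^ k) / M) powr (1 - m) * ((s * b) ^ (2 ^ k) / M') powr m = C * x ^ (2 ^ k)"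
      proof -
        have pp: "(u ^ n / N) powr e = (1 / N) powr e * (u powr e) ^ n" if "u > 0" "N > 0" for u N e :: real and n :: nat
        proof -
          have "(u ^ n / N) powr e = (1 / N * u powr (real n)) powr e" using that by (simp add: powr_realpow)
          also have "\<dots> = (1 / N) powr e * (u powr e) powr (real n)"
            using that by (subst powr_mult) (auto simp: powr_powr mult.commute)
          finally show ?thesis using that by (simp add: powr_realpow)
        qed
        show ?thesis unfolding C_def x_def pp[OF sa(1) M(1)] pp[OF sb(1) M'(1)] by (simp add: power_mult_distrib mult_ac)
      qed
      finally show ?thesis using V r by simp
    qed
    moreover have "C > 0" "x > 0" unfolding C_def x_def by (intro mult_pos_pos; use M M' s ab in simp)+
    ultimately have "x \<le> r" using r(1) by (rule le_of_power_le)
    also have "x = s powr (1 - m + m) * (a powr (1 - m) * b powr m)"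
      unfolding powr_add x_def using s ab by (simp add: powr_mult)
    finally show ?thesis using s by simp
  qed
  then have "a powr (1 - m) * b powr m \<le> r" by (rule field_le_mult_one_interval)
  then show "ennreal (a powr (1 - m) * b powr m) \<le> prin_eig L (Kf ?c)" using r by (simp add: ennreal_leI)
qed

section \<open>Windows and order statistics\<close>

text \<open>A chord is recorded by its end parameters \<open>s\<close> and \<open>t\<close> instead
  of a length, so that openness, symmetry and joint convexity in \<open>(y, p)\<close> are read off
  from \<open>K\<close>.\<close>

definition window :: "'a::euclidean_space set \<Rightarrow> 'a \<Rightarrow> real \<Rightarrow> 'a set" where
  "window K v p = {y. \<exists>s\<in>{-3..3}. \<exists>t\<in>{-3..3}. 2 * p \<le> t - s \<and> y + s *\<^sub>R v \<in> K \<and> y + t *\<^sub>R v \<in> K}"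

lemma open_window:
  assumes "open K"
  shows "open (window K v p)"
proof -
  have eq: "window K v p = (\<Union>s\<in>{-3..3}. \<Union>t\<in>{t\<in>{-3..3}. 2 * p \<le> t - s}. (\<lambda>y. y + s *\<^sub>R v) -` K \<inter> (\<lambda>y. y + t *\<^sub>R v) -` K)"
    unfolding window_def by blast
  have opn: "open ((\<lambda>y. y + s *\<^sub>R v) -` K \<inter> (\<lambda>y. y + t *\<^sub>R v) -` K)" for s t :: real
    using assms by (intro open_Int open_vimage continuous_intros) auto
  show ?thesis unfolding eq by (intro open_UN ballI opn)
qed

lemma bounded_window:
  assumes "bounded K"
  shows "bounded (window K v p)"
proof -
  obtain B where B: "\<And>x. x \<in> K \<Longrightarrow> norm x \<le> B" using assms by (auto simp: bounded_iff)
  have "norm y \<le> B + 3 * norm v" if y: "y \<in> window K v p" for y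
  proof -
    obtain s where s: "s \<in> {-3..3}" "y + s *\<^sub>R v \<in> K" using y unfolding window_def by blast
    have "norm y \<le> norm (y + s *\<^sub>R v) + norm (s *\<^sub>R v)" by (metis add_diff_cancel norm_triangle_ineq4)
    also have "norm (s *\<^sub>R v) \<le> 3 * norm v" using s by (auto intro!: mult_right_mono)
    finally show ?thesis using B[OF s(2)] by simp
  qed
  then show ?thesis by (auto simp: bounded_iff)
qed

text \<open>End parameters combine linearly, and \<open>2 * p \<le> t - s\<close> is a linear
  constraint. Convexity in the pair is what \<open>log_concave_prin_eig\<close> asks for.\<close>

lemma convex_window_graph:
  assumes "convex K"
  shows "convex {(y, p). y \<in> window K v p}"
proof (rule convexI)
  fix x x' and \<alpha> \<beta> :: real
  assume x: "x \<in> {(y, p). y \<in> window K v p}" and x': "x' \<in> {(y, p). y \<in> window K v p}"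
    and \<alpha>\<beta>: "0 \<le> \<alpha>" "0 \<le> \<beta>" "\<alpha> + \<beta> = 1"
  obtain y p where y: "x = (y, p)" by (cases x)
  obtain y' p' where y': "x' = (y', p')" by (cases x')
  obtain s t where st: "s \<in> {-3..3}" "t \<in> {-3..3}" "2 * p \<le> t - s" "y + s *\<^sub>R v \<in> K" "y + t *\<^sub>R v \<in> K"
    using x y by (auto simp: window_def)
  obtain s' t' where st': "s' \<in> {-3..3}" "t' \<in> {-3..3}" "2 * p' \<le> t' - s'" "y' + s' *\<^sub>R v \<in> K" "y' + t' *\<^sub>R v \<in> K"
    using x' y' by (auto simp: window_def)
  let ?s = "\<alpha> * s + \<beta> * s'" and ?t = "\<alpha> * t + \<beta> * t'"
  have "\<alpha> *\<^sub>R (y + s *\<^sub>R v) + \<beta> *\<^sub>R (y' + s' *\<^sub>R v) \<in> K" "\<alpha> *\<^sub>R (y + t *\<^sub>R v) + \<beta> *\<^sub>R (y' + t' *\<^sub>R v) \<in> K"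
    using convexD[OF assms] st st' \<alpha>\<beta> by auto
  then have "(\<alpha> *\<^sub>R y + \<beta> *\<^sub>R y') + ?s *\<^sub>R v \<in> K" "(\<alpha> *\<^sub>R y + \<beta> *\<^sub>R y') + ?t *\<^sub>R v \<in> K"
    by (simp_all add: algebra_simps)
  moreover have "?s \<in> {-3..3}" "?t \<in> {-3..3}"
    using convexD[OF convex_real_interval(5)[of "-3" 3], of s s' \<alpha> \<beta>] convexD[OF convex_real_interval(5)[of "-3" 3], of t t' \<alpha> \<beta>]
      st st' \<alpha>\<beta> by auto
  moreover have "2 * (\<alpha> * p + \<beta> * p') \<le> ?t - ?s"
  proof -
    have "\<alpha> * (2 * p) + \<beta> * (2 * p') \<le> \<alpha> * (t - s) + \<beta> * (t' - s')"
      using st st' \<alpha>\<beta> by (intro add_mono mult_left_mono) auto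
    then show ?thesis by (simp add: algebra_simps)
  qed
  ultimately have "\<alpha> *\<^sub>R y + \<beta> *\<^sub>R y' \<in> window K v (\<alpha> * p + \<beta> * p')"
    unfolding window_def by blast
  then show "\<alpha> *\<^sub>R x + \<beta> *\<^sub>R x' \<in> {(y, p). y \<in> window K v p}"
    unfolding y y' by simp
qed

lemma convex_window:
  assumes "convex K"
  shows "convex (window K v p)"
proof (rule convexI)
  fix x y and a b :: real
  assume *: "x \<in> window K v p" "y \<in> window K v p" "0 \<le> a" "0 \<le> b" "a + b = 1"
  have "a *\<^sub>R (x, p) + b *\<^sub>R (y, p) \<in> {(y, p). y \<in> window K v p}"
    by (rule convexD[OF convex_window_graph[OF assms]]) (use * in auto)
  moreover have "a * p + b * p = p" using * by (simp add: distrib_right[symmetric])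
  ultimately show "a *\<^sub>R x + b *\<^sub>R y \<in> window K v p" by simp
qed

text \<open>Reflection in the origin turns the end parameters \<open>(s, t)\<close> into
  \<open>(- t, - s)\<close>.\<close>

lemma window_symmetric:
  assumes "\<And>x. x \<in> K \<Longrightarrow> - x \<in> K" "y \<in> window K v p"
  shows "- y \<in> window K v p"
proof -
  obtain s t where st: "s \<in> {-3..3}" "t \<in> {-3..3}" "2 * p \<le> t - s" "y + s *\<^sub>R v \<in> K" "y + t *\<^sub>R v \<in> K"
    using assms(2) unfolding window_def by blast
  have "- y + (- t) *\<^sub>R v \<in> K" "- y + (- s) *\<^sub>R v \<in> K"
    using assms(1)[OF st(4)] assms(1)[OF st(5)] by simp_all
  moreover have "- t \<in> {-3..3}" "- s \<in> {-3..3}" "2 * p \<le> - s - - t" using st by auto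
  ultimately show ?thesis unfolding window_def by blast
qed

lemma window_antimono: "p \<le> q \<Longrightarrow> window K v q \<subseteq> window K v p"
  unfolding window_def by force

text \<open>The half-length 3 of the window is the largest one for which an interval of length 2 inside it
  must contain \<open>1\<close> or \<open>-1\<close>.\<close>

lemma window_1_sign:
  assumes K: "convex K" and y: "y \<in> window K v 1"
  shows "y + v \<in> K \<or> y - v \<in> K"
proof -
  obtain s t where st: "s \<in> {-3..3}" "t \<in> {-3..3}" "2 * 1 \<le> t - s" "y + s *\<^sub>R v \<in> K" "y + t *\<^sub>R v \<in> K"
    using y by (auto simp: window_def)
  have mem: "y + w *\<^sub>R v \<in> K" if "s \<le> w" "w \<le> t" for w
  proof -
    define \<theta> where "\<theta> = (w - s) / (t - s)"
    have "\<theta> * (t - s) = w - s" using st(3) by (simp add: \<theta>_def)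
    then have \<theta>: "w = (1 - \<theta>) * s + \<theta> * t" "0 \<le> \<theta>" "\<theta> \<le> 1"
      using that st(3) by (simp add: algebra_simps) (use that st(3) in \<open>simp_all add: \<theta>_def field_simps\<close>)
    have "(1 - \<theta>) *\<^sub>R (y + s *\<^sub>R v) + \<theta> *\<^sub>R (y + t *\<^sub>R v) \<in> K"
      using \<theta>(2,3) by (intro convexD[OF K st(4,5)]) auto
    also have "(1 - \<theta>) *\<^sub>R (y + s *\<^sub>R v) + \<theta> *\<^sub>R (y + t *\<^sub>R v) = y + w *\<^sub>R v"
      unfolding \<theta>(1) by (simp add: algebra_simps)
    finally show ?thesis .
  qed
  show ?thesis
  \<comment> \<open>If \<open>s \<le> -1\<close>, then \<open>t \<ge> s + 2 \<ge> -1\<close>, and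
    the parameter -1 lies on the chord. Otherwise \<open>t > 1\<close>, while
    \<open>t \<le> 3\<close> forces \<open>s \<le> 1\<close>.\<close>
  proof (cases "s \<le> -1")
    case True
    then show ?thesis using mem[of "-1"] st by auto
  next
    case False
    then show ?thesis using mem[of 1] st by auto
  qed
qed

section \<open>Order statistics and the rearrangement inequality\<close>

definition order_stat :: "nat \<Rightarrow> (nat \<Rightarrow> real) \<Rightarrow> nat \<Rightarrow> real" where
  "order_stat k z j = sort (map z [0..<k]) ! j"

text \<open>The induction step of the rearrangement inequality along insertion sort. When
  \<open>x\<close> and \<open>y\<close> fall on different sides of the two heads, uncrossing the
  pairs gains a nonnegative product of differences.\<close>

lemma sum_list_mult_insort:
  fixes x y :: real
  assumes "sorted X" "sorted Y" "length X = length Y"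
  shows "x * y + (\<Sum>(a, b)\<leftarrow>zip X Y. a * b) \<le> (\<Sum>(a, b)\<leftarrow>zip (insort x X) (insort y Y). a * b)"
  using assms(3,1,2)
proof (induction X Y arbitrary: x y rule: list_induct2)
  case (Cons x1 X y1 Y)
  have X: "insort x1 X = x1 # X" and Y: "insort y1 Y = y1 # Y"
    using Cons.prems by (auto intro: insort_is_Cons)
  have s: "sorted X" "sorted Y" using Cons.prems by auto
  consider "x \<le> x1" "y \<le> y1" | "x \<le> x1" "y > y1" | "x > x1" "y \<le> y1" | "x > x1" "y > y1" by linarith
  then show ?case
  proof cases
    case 2
    have "x1 * y + (\<Sum>(a, b)\<leftarrow>zip X Y. a * b) \<le> (\<Sum>(a, b)\<leftarrow>zip (insort x1 X) (insort y Y). a * b)"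
      using s by (rule Cons.IH)
    moreover have "(x1 - x) * (y - y1) \<ge> 0" using 2 by (intro mult_nonneg_nonneg) auto
    ultimately show ?thesis using 2 X by (simp add: algebra_simps)
  next
    case 3
    have "x * y1 + (\<Sum>(a, b)\<leftarrow>zip X Y. a * b) \<le> (\<Sum>(a, b)\<leftarrow>zip (insort x X) (insort y1 Y). a * b)"
      using s by (rule Cons.IH)
    moreover have "(x - x1) * (y1 - y) \<ge> 0" using 3 by (intro mult_nonneg_nonneg) auto
    ultimately show ?thesis using 3 Y by (simp add: algebra_simps)
  next
    case 4
    then show ?thesis using Cons.IH[OF s, of x y] by simp
  qed simp
qed simp

lemma sum_list_mult_sort:
  fixes X Y :: "real list"
  assumes "length X = length Y"
  shows "(\<Sum>(a, b)\<leftarrow>zip X Y. a * b) \<le> (\<Sum>(a, b)\<leftarrow>zip (sort X) (sort Y). a * b)"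
  using assms
proof (induction X Y rule: list_induct2)
  case (Cons x X y Y)
  have "(\<Sum>(a, b)\<leftarrow>zip (x # X) (y # Y). a * b) \<le> x * y + (\<Sum>(a, b)\<leftarrow>zip (sort X) (sort Y). a * b)"
    using Cons.IH by simp
  also have "\<dots> \<le> (\<Sum>(a, b)\<leftarrow>zip (insort x (sort X)) (insort y (sort Y)). a * b)"
    by (rule sum_list_mult_insort) (use Cons.hyps in auto)
  finally show ?case by simp
qed simp

lemma order_stat_rearrangement:
  "(\<Sum>a<k. z a * z' a) \<le> (\<Sum>j<k. order_stat k z j * order_stat k z' j)"
proof -
  have e: "(\<Sum>(a, b)\<leftarrow>zip X Y. a * b) = (\<Sum>j<length X. X ! j * Y ! j)"
    if "length X = length Y" for X Y :: "real list"
    using that by (simp add: sum_list_sum_nth atLeast0LessThan)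
  show ?thesis
    using sum_list_mult_sort[of "map z [0..<k]" "map z' [0..<k]"]
      e[of "map z [0..<k]" "map z' [0..<k]"] e[of "sort (map z [0..<k])" "sort (map z' [0..<k])"]
    by (simp add: order_stat_def)
qed

lemma sum_order_stat: "(\<Sum>j<k. g (order_stat k z j)) = (\<Sum>a<k. g (z a))"
  for g :: "real \<Rightarrow> real"
proof -
  have "(\<Sum>j<k. g (order_stat k z j)) = sum_list (map g (sort (map z [0..<k])))"
    by (simp add: sum_list_sum_nth atLeast0LessThan order_stat_def)
  also have "\<dots> = sum_mset (image_mset g (mset (sort (map z [0..<k]))))"
    by (simp flip: sum_mset_sum_list)
  also have "\<dots> = sum_list (map g (map z [0..<k]))"
    by (simp only: mset_sort mset_map[symmetric] sum_mset_sum_list)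
  also have "\<dots> = (\<Sum>a<k. g (z a))"
    by (simp add: sum_list_sum_nth atLeast0LessThan)
  finally show ?thesis .
qed

text \<open>The sum runs over unordered pairs of positions, so it does not change under sorting.
  This links sampled values to their order statistics.\<close>

primrec pair_min :: "real list \<Rightarrow> real" where
  "pair_min [] = 0"
| "pair_min (x # X) = (\<Sum>y\<leftarrow>X. (min x y)\<^sup>2) + pair_min X"

lemma sum_list_insort: "(\<Sum>y\<leftarrow>insort x X. g y) = g x + (\<Sum>y\<leftarrow>X. g y)" for g :: "real \<Rightarrow> real"
  by (induction X) auto

lemma sum_list_sort: "(\<Sum>y\<leftarrow>sort X. g y) = (\<Sum>y\<leftarrow>X. g y)" for g :: "real \<Rightarrow> real"
  by (induction X) (auto simp: sum_list_insort)

lemma pair_min_insort: "pair_min (insort x X) = pair_min (x # X)"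
  by (induction X) (auto simp: sum_list_insort min.commute)

lemma pair_min_sort: "pair_min (sort X) = pair_min X"
  by (induction X) (auto simp: pair_min_insort sum_list_sort)

lemma pair_min_sorted:
  "sorted X \<Longrightarrow> pair_min X = (\<Sum>j<length X. real (length X - 1 - j) * (X ! j)\<^sup>2)"
proof (induction X)
  case (Cons x X)
  have "(\<Sum>y\<leftarrow>X. (min x y)\<^sup>2) = (\<Sum>y\<leftarrow>X. x\<^sup>2)"
    using Cons.prems by (intro arg_cong[where f=sum_list] map_cong) (auto simp: min_def)
  then have "(\<Sum>y\<leftarrow>X. (min x y)\<^sup>2) = real (length X) * x\<^sup>2" by (simp add: sum_list_triv)
  then show ?case using Cons by (simp add: sum.lessThan_Suc_shift del: sum.lessThan_Suc)
qed simp

lemma pair_min_append: "pair_min (X @ [x]) = pair_min X + (\<Sum>y\<leftarrow>X. (min y x)\<^sup>2)"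
  by (induction X) auto

lemma pair_min_map: "pair_min (map z [0..<k]) = (\<Sum>b<k. \<Sum>a<b. (min (z a) (z b))\<^sup>2)"
  by (induction k) (auto simp: pair_min_append sum_list_sum_nth atLeast0LessThan)

text \<open>In the sorted list the entry of rank \<open>j\<close> is the minimum in its pairs with
  the \<open>k - 1 - j\<close> later entries.\<close>

lemma sum_order_stat_weighted:
  "(\<Sum>j<k. real (k - 1 - j) * (order_stat k z j)\<^sup>2) = (\<Sum>b<k. \<Sum>a<b. (min (z a) (z b))\<^sup>2)"
  using pair_min_sorted[of "sort (map z [0..<k])"]
  by (simp add: pair_min_sort pair_min_map order_stat_def)

text \<open>Describing order statistics by counts gives both their measurability and the location of
  their supports.\<close>

lemma less_order_stat_iff:
  assumes j: "j < k"
  shows "u < order_stat k z j \<longleftrightarrow> k - j \<le> card {a. a < k \<and> u < z a}"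
proof -
  let ?X = "sort (map z [0..<k])"
  have "length (filter (\<lambda>x. u < x) ?X) = card {i. i < k \<and> u < ?X ! i}"
    by (simp add: length_filter_conv_card)
  moreover have "length (filter (\<lambda>x. u < x) ?X) = card {a. a < k \<and> u < z a}"
    by (simp add: filter_sort length_filter_conv_card cong: conj_cong del: length_filter_map)
  ultimately have c: "card {a. a < k \<and> u < z a} = card {i. i < k \<and> u < ?X ! i}" by simp
  have mono: "?X ! i \<le> ?X ! i'" if "i \<le> i'" "i' < k" for i i'
    using that by (intro sorted_nth_mono) auto
  show ?thesis
  proof
    assume "u < order_stat k z j"
    then have "{j..<k} \<subseteq> {i. i < k \<and> u < ?X ! i}"
      using mono by (fastforce simp: order_stat_def)
    then have "card {j..<k} \<le> card {i. i < k \<and> u < ?X ! i}" by (intro card_mono) auto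
    then show "k - j \<le> card {a. a < k \<and> u < z a}" using c by simp
  next
    assume le: "k - j \<le> card {a. a < k \<and> u < z a}"
    show "u < order_stat k z j"
    proof (rule ccontr)
      assume n: "\<not> u < order_stat k z j"
      have "{i. i < k \<and> u < ?X ! i} \<subseteq> {Suc j..<k}"
      proof
        fix i assume i: "i \<in> {i. i < k \<and> u < ?X ! i}"
        have "\<not> i \<le> j" using mono[of i j] i n j by (auto simp: order_stat_def)
        then show "i \<in> {Suc j..<k}" using i by auto
      qed
      then have "card {i. i < k \<and> u < ?X ! i} \<le> card {Suc j..<k}" by (intro card_mono) auto
      then show False using le c j by simp
    qed
  qed
qed

text \<open>At least \<open>k - j\<close> samples are positive, and that many distinct indices span
  a distance of at least \<open>k - 1 - j\<close>. For a state on \<open>K\<close> this produces a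
  chord of \<open>K\<close>.\<close>

lemma order_stat_pos_spread:
  assumes "j < k" "0 < order_stat k z j"
  obtains a b where "a < k" "b < k" "0 < z a" "0 < z b" "a + (k - 1 - j) \<le> b"
proof -
  let ?S = "{a. a < k \<and> 0 < z a}"
  have c: "k - j \<le> card ?S" using less_order_stat_iff[OF assms(1), of 0 z] assms(2) by simp
  have fin: "finite ?S" by auto
  have ne: "?S \<noteq> {}" using c assms(1) by (metis card.empty diff_is_0_eq le_zero_eq not_le)
  have "?S \<subseteq> {Min ?S..Max ?S}" using fin by auto
  then have "card ?S \<le> card {Min ?S..Max ?S}" by (intro card_mono) auto
  then have "Min ?S + (k - 1 - j) \<le> Max ?S" using c assms(1) by auto
  then show ?thesis using that[of "Min ?S" "Max ?S"] Min_in[OF fin ne] Max_in[OF fin ne] by auto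
qed

lemma order_stat_nonneg: "j < k \<Longrightarrow> (\<And>a. a < k \<Longrightarrow> 0 \<le> z a) \<Longrightarrow> 0 \<le> order_stat k z j"
proof -
  assume "j < k" and z: "\<And>a. a < k \<Longrightarrow> 0 \<le> z a"
  then have "order_stat k z j \<in> set (sort (map z [0..<k]))"
    unfolding order_stat_def by (intro nth_mem) auto
  then show ?thesis using z by auto
qed

lemma order_stat_le: "j < k \<Longrightarrow> (\<And>a. a < k \<Longrightarrow> z a \<le> M) \<Longrightarrow> order_stat k z j \<le> M"
proof -
  assume "j < k" and z: "\<And>a. a < k \<Longrightarrow> z a \<le> M"
  then have "order_stat k z j \<in> set (sort (map z [0..<k]))"
    unfolding order_stat_def by (intro nth_mem) auto
  then show ?thesis using z by auto
qed

lemma measurable_order_stat: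
  assumes [measurable]: "\<And>a. z a \<in> borel_measurable M" and j: "j < k"
  shows "(\<lambda>y. order_stat k (\<lambda>a. z a y) j) \<in> borel_measurable M"
proof (rule borel_measurable_iff_greater[THEN iffD2], intro allI)
  fix u
  have "{y \<in> space M. u < order_stat k (\<lambda>a. z a y) j}
    = {y \<in> space M. real (k - j) \<le> (\<Sum>a<k. indicator {x. u < x} (z a y))}"
  proof (intro Collect_cong conj_cong refl)
    fix y
    have "(\<Sum>a<k. indicator {x. u < x} (z a y) :: real) = real (card {a. a < k \<and> u < z a y})"
    proof -
      have "{a. a < k \<and> u < z a y} = {a \<in> {..<k}. u < z a y}" by auto
      then show ?thesis by (simp add: indicator_def sum.If_cases Int_def)
    qed
    then show "(u < order_stat k (\<lambda>a. z a y) j) = (real (k - j) \<le> (\<Sum>a<k. indicator {x. u < x} (z a y)))"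
      using less_order_stat_iff[OF j, of u "\<lambda>a. z a y"] by simp
  qed
  also have "\<dots> \<in> sets M" by measurable
  finally show "{y \<in> space M. u < order_stat k (\<lambda>a. z a y) j} \<in> sets M" .
qed

section \<open>Decomposing a state along a window\<close>

definition L2 :: "('a::euclidean_space \<Rightarrow> real) \<Rightarrow> bool" where
  "L2 u \<longleftrightarrow> u \<in> borel_measurable borel \<and> integrable lborel (\<lambda>y. (u y)\<^sup>2)"

lemma L2_mult: "L2 u \<Longrightarrow> L2 w \<Longrightarrow> integrable lborel (\<lambda>y. u y * w y)"
proof -
  assume u: "L2 u" and w: "L2 w"
  have [measurable]: "u \<in> borel_measurable borel" "w \<in> borel_measurable borel" using u w by (auto simp: L2_def)
  show ?thesis
  proof (rule Bochner_Integration.integrable_bound[where f="\<lambda>y. (u y)\<^sup>2 + (w y)\<^sup>2"])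
    show "AE y in lborel. norm (u y * w y) \<le> norm ((u y)\<^sup>2 + (w y)\<^sup>2)"
    proof (rule AE_I2)
      fix y
      have "2 * (\<bar>u y\<bar> * \<bar>w y\<bar>) \<le> \<bar>u y\<bar>\<^sup>2 + \<bar>w y\<bar>\<^sup>2" using sum_squares_bound[of "\<bar>u y\<bar>" "\<bar>w y\<bar>"] by simp
      moreover have "0 \<le> \<bar>u y\<bar> * \<bar>w y\<bar>" by simp
      ultimately have "\<bar>u y\<bar> * \<bar>w y\<bar> \<le> \<bar>u y\<bar>\<^sup>2 + \<bar>w y\<bar>\<^sup>2" by linarith
      then show "norm (u y * w y) \<le> norm ((u y)\<^sup>2 + (w y)\<^sup>2)" by (simp add: abs_mult)
    qed
  qed (use u w in \<open>auto simp: L2_def\<close>)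
qed

lemma L2_add: "L2 u \<Longrightarrow> L2 w \<Longrightarrow> L2 (\<lambda>y. u y + w y)"
  using L2_mult[of u w] by (auto simp: L2_def power2_sum mult.assoc)

lemma L2_diff: "L2 u \<Longrightarrow> L2 w \<Longrightarrow> L2 (\<lambda>y. u y - w y)"
  using L2_mult[of u w] by (auto simp: L2_def power2_diff mult.assoc)

lemma lborel_translate:
  fixes u :: "'a::euclidean_space \<Rightarrow> real"
  assumes "integrable lborel u"
  shows "integrable lborel (\<lambda>y. u (y + z))" "(\<integral>y. u (y + z) \<partial>lborel) = (\<integral>y. u y \<partial>lborel)"
proof -
  have "integrable (distr lborel borel ((+) z)) u" using assms by (simp only: lborel_distr_plus)
  from integrable_distr[OF _ this] show "integrable lborel (\<lambda>y. u (y + z))" by (simp add: add.commute)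
  have "(\<integral>y. u y \<partial>lborel) = (\<integral>y. u y \<partial>distr lborel borel ((+) z))" by (simp only: lborel_distr_plus)
  also have "\<dots> = (\<integral>y. u (y + z) \<partial>lborel)"
    using assms by (subst integral_distr) (auto simp: add.commute)
  finally show "(\<integral>y. u (y + z) \<partial>lborel) = (\<integral>y. u y \<partial>lborel)" by simp
qed

lemma L2_translate: "L2 u \<Longrightarrow> L2 (\<lambda>y. u (y + z))"
  using lborel_translate(1)[of "\<lambda>y. (u y)\<^sup>2" z] by (auto simp: L2_def)

definition norm_L2 :: "('a::euclidean_space \<Rightarrow> real) \<Rightarrow> real" where
  "norm_L2 u = sqrt (\<integral>y. (u y)\<^sup>2 \<partial>lborel)"

lemma norm_L2_nonneg: "0 \<le> norm_L2 u"
  by (simp add: norm_L2_def)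

lemma norm_L2_square: "(norm_L2 u)\<^sup>2 = (\<integral>y. (u y)\<^sup>2 \<partial>lborel)"
  by (simp add: norm_L2_def)

lemma L2_Cauchy_Schwarz:
  assumes u: "L2 u" and w: "L2 w"
  shows "(\<integral>y. \<bar>u y * w y\<bar> \<partial>lborel) \<le> norm_L2 u * norm_L2 w"
proof (rule power2_le_imp_le)
  have [measurable]: "u \<in> borel_measurable borel" "w \<in> borel_measurable borel" using u w by (auto simp: L2_def)
  have i: "integrable lborel (\<lambda>y. \<bar>u y * w y\<bar>)" using L2_mult[OF u w] by simp
  have "(\<integral>\<^sup>+y. ennreal \<bar>u y\<bar> * ennreal \<bar>w y\<bar> \<partial>lborel)\<^sup>2
    \<le> (\<integral>\<^sup>+y. ennreal \<bar>u y\<bar> ^ 2 \<partial>lborel) * (\<integral>\<^sup>+y. ennreal \<bar>w y\<bar> ^ 2 \<partial>lborel)"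
    by (rule Cauchy_Schwarz_nn_integral) auto
  also have "(\<integral>\<^sup>+y. ennreal \<bar>u y\<bar> * ennreal \<bar>w y\<bar> \<partial>lborel) = ennreal (\<integral>y. \<bar>u y * w y\<bar> \<partial>lborel)"
    using i by (subst nn_integral_eq_integral[symmetric]) (auto simp: ennreal_mult abs_mult)
  also have "(\<integral>\<^sup>+y. ennreal \<bar>u y\<bar> ^ 2 \<partial>lborel) = ennreal (\<integral>y. (u y)\<^sup>2 \<partial>lborel)"
    using u by (subst nn_integral_eq_integral[symmetric]) (auto simp: ennreal_power L2_def)
  also have "(\<integral>\<^sup>+y. ennreal \<bar>w y\<bar> ^ 2 \<partial>lborel) = ennreal (\<integral>y. (w y)\<^sup>2 \<partial>lborel)"
    using w by (subst nn_integral_eq_integral[symmetric]) (auto simp: ennreal_power L2_def)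
  finally have "(\<integral>y. \<bar>u y * w y\<bar> \<partial>lborel)\<^sup>2 \<le> (\<integral>y. (u y)\<^sup>2 \<partial>lborel) * (\<integral>y. (w y)\<^sup>2 \<partial>lborel)"
    by (simp add: ennreal_power ennreal_mult[symmetric])
  then show "(\<integral>y. \<bar>u y * w y\<bar> \<partial>lborel)\<^sup>2 \<le> (norm_L2 u * norm_L2 w)\<^sup>2"
    by (simp add: power_mult_distrib norm_L2_square)
qed (simp add: norm_L2_nonneg)

lemma norm_L2_triangle:
  assumes u: "L2 u" and w: "L2 w"
  shows "norm_L2 (\<lambda>y. u y + w y) \<le> norm_L2 u + norm_L2 w"
proof (rule power2_le_imp_le)
  have i: "integrable lborel (\<lambda>y. (u y)\<^sup>2)" "integrable lborel (\<lambda>y. (w y)\<^sup>2)" "integrable lborel (\<lambda>y. u y * w y)"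
    using u w L2_mult by (auto simp: L2_def)
  have "(norm_L2 (\<lambda>y. u y + w y))\<^sup>2 = (\<integral>y. (u y)\<^sup>2 + (w y)\<^sup>2 + 2 * (u y * w y) \<partial>lborel)"
    by (simp add: norm_L2_square power2_sum mult.assoc)
  also have "\<dots> = (norm_L2 u)\<^sup>2 + (norm_L2 w)\<^sup>2 + 2 * (\<integral>y. u y * w y \<partial>lborel)"
    using i by (simp add: norm_L2_square)
  also have "(\<integral>y. u y * w y \<partial>lborel) \<le> (\<integral>y. \<bar>u y * w y\<bar> \<partial>lborel)"
    using i by (intro integral_mono) auto
  also have "\<dots> \<le> norm_L2 u * norm_L2 w" by (rule L2_Cauchy_Schwarz) fact+
  finally show "(norm_L2 (\<lambda>y. u y + w y))\<^sup>2 \<le> (norm_L2 u + norm_L2 w)\<^sup>2"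
    by (simp add: power2_sum)
qed (simp add: norm_L2_nonneg)

text \<open>The modulus of continuity in \<open>L2\<close> along \<open>z\<close>. It is subadditive
  in \<open>z\<close>, and for a unit state it determines the autocorrelation.\<close>

definition shift_dist :: "('a::euclidean_space \<Rightarrow> real) \<Rightarrow> 'a \<Rightarrow> real" where
  "shift_dist u z = norm_L2 (\<lambda>y. u (y + z) - u y)"

lemma shift_dist_nonneg: "0 \<le> shift_dist u z"
  by (simp add: shift_dist_def norm_L2_nonneg)

lemma shift_dist_0: "shift_dist u 0 = 0"
  by (simp add: shift_dist_def norm_L2_def)

lemma shift_dist_add:
  assumes u: "L2 u"
  shows "shift_dist u (z + z') \<le> shift_dist u z + shift_dist u z'"
proof -
  note L = L2_diff[OF L2_translate[OF u] u]
  have "shift_dist u (z + z') = norm_L2 (\<lambda>y. (u ((y + z) + z') - u (y + z)) + (u (y + z) - u y))"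
    by (simp add: shift_dist_def add.assoc)
  also have "\<dots> \<le> norm_L2 (\<lambda>y. u ((y + z) + z') - u (y + z)) + norm_L2 (\<lambda>y. u (y + z) - u y)"
    by (rule norm_L2_triangle) (rule L2_translate[OF L, where z=z], rule L)
  also have "norm_L2 (\<lambda>y. u ((y + z) + z') - u (y + z)) = norm_L2 (\<lambda>y. u (y + z') - u y)"
    unfolding norm_L2_def
    using L[of z'] by (subst lborel_translate(2)[symmetric, of "\<lambda>y. (u (y + z') - u y)\<^sup>2" z]) (auto simp: L2_def)
  finally show ?thesis by (simp add: shift_dist_def)
qed

lemma shift_dist_multiple:
  assumes u: "L2 u"
  shows "shift_dist u (real m *\<^sub>R z) \<le> real m * shift_dist u z"
proof (induction m)
  case (Suc m)
  have "shift_dist u (real (Suc m) *\<^sub>R z) = shift_dist u (z + real m *\<^sub>R z)" by (simp add: algebra_simps)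
  also have "\<dots> \<le> shift_dist u z + shift_dist u (real m *\<^sub>R z)" by (rule shift_dist_add) fact
  finally show ?case using Suc by (simp add: algebra_simps)
qed (simp add: shift_dist_0)

lemma shift_dist_square:
  assumes u: "L2 u" and 1: "(\<integral>y. (u y)\<^sup>2 \<partial>lborel) = 1"
  shows "(shift_dist u z)\<^sup>2 = 2 - 2 * (\<integral>y. u y * u (y + z) \<partial>lborel)"
proof -
  have i: "integrable lborel (\<lambda>y. (u y)\<^sup>2)" "integrable lborel (\<lambda>y. u y * u (y + z))"
    using u L2_mult[OF u L2_translate[OF u]] by (auto simp: L2_def)
  note t = lborel_translate[OF i(1), of z]
  have "(shift_dist u z)\<^sup>2 = (\<integral>y. (u (y + z))\<^sup>2 + (u y)\<^sup>2 - 2 * (u y * u (y + z)) \<partial>lborel)"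
    by (simp add: shift_dist_def norm_L2_square power2_diff mult_ac)
  also have "\<dots> = 2 - 2 * (\<integral>y. u y * u (y + z) \<partial>lborel)"
    using i t 1 by simp
  finally show ?thesis .
qed

text \<open>The square of \<open>min a b\<close> is half of \<open>a^2 + b^2 - |b^2 - a^2|\<close>.
  The last term factors into the difference and the sum of the two functions, and Cauchy-Schwarz
  bounds its integral by the shift distance times the norm of the sum, which is at most 2.\<close>

lemma integral_min_square_ge:
  assumes u: "L2 u" and nn: "\<And>y. 0 \<le> u y" and 1: "(\<integral>y. (u y)\<^sup>2 \<partial>lborel) = 1"
  shows "integrable lborel (\<lambda>y. (min (u y) (u (y + z)))\<^sup>2)"
    and "1 - shift_dist u z \<le> (\<integral>y. (min (u y) (u (y + z)))\<^sup>2 \<partial>lborel)"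
proof -
  let ?w = "\<lambda>y. u (y + z)"
  have w: "L2 ?w" by (rule L2_translate[OF u])
  have [measurable]: "u \<in> borel_measurable borel" using u by (auto simp: L2_def)
  have i: "integrable lborel (\<lambda>y. (u y)\<^sup>2)" using u by (auto simp: L2_def)
  note t = lborel_translate[OF i, of z]
  have diff: "L2 (\<lambda>y. ?w y - u y)" "L2 (\<lambda>y. ?w y + u y)" by (intro L2_diff L2_add u w)+
  have eq: "(min (u y) (?w y))\<^sup>2 = ((u y)\<^sup>2 + (?w y)\<^sup>2 - \<bar>(?w y - u y) * (?w y + u y)\<bar>) / 2" for y
  proof -
    have "(?w y - u y) * (?w y + u y) = (?w y)\<^sup>2 - (u y)\<^sup>2" by (simp add: power2_eq_square algebra_simps)
    then show ?thesis
      using power_mono[OF _ nn, of y "?w y" 2] power_mono[OF _ nn, of "y + z" "u y" 2]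
      by (cases "u y \<le> ?w y") (auto simp: min_def)
  qed
  have iabs: "integrable lborel (\<lambda>y. \<bar>(?w y - u y) * (?w y + u y)\<bar>)"
    using L2_mult[OF diff] by simp
  show "integrable lborel (\<lambda>y. (min (u y) (u (y + z)))\<^sup>2)"
    unfolding eq using i t iabs by auto
  have n2: "norm_L2 (\<lambda>y. ?w y + u y) \<le> 2"
  proof -
    have "norm_L2 (\<lambda>y. ?w y + u y) \<le> norm_L2 ?w + norm_L2 u" by (rule norm_L2_triangle[OF w u])
    also have "\<dots> = 2" using t 1 by (simp add: norm_L2_def)
    finally show ?thesis .
  qed
  have "(\<integral>y. \<bar>(?w y - u y) * (?w y + u y)\<bar> \<partial>lborel) \<le> norm_L2 (\<lambda>y. ?w y - u y) * norm_L2 (\<lambda>y. ?w y + u y)"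
    by (rule L2_Cauchy_Schwarz[OF diff])
  also have "\<dots> \<le> shift_dist u z * 2"
    unfolding shift_dist_def by (intro mult_left_mono n2 norm_L2_nonneg)
  finally have "(\<integral>y. \<bar>(?w y - u y) * (?w y + u y)\<bar> \<partial>lborel) \<le> shift_dist u z * 2" .
  moreover have "(\<integral>y. (min (u y) (?w y))\<^sup>2 \<partial>lborel)
    = ((\<integral>y. (u y)\<^sup>2 \<partial>lborel) + (\<integral>y. (?w y)\<^sup>2 \<partial>lborel) - (\<integral>y. \<bar>(?w y - u y) * (?w y + u y)\<bar> \<partial>lborel)) / 2"
    unfolding eq using i t iabs by simp
  ultimately show "1 - shift_dist u z \<le> (\<integral>y. (min (u y) (u (y + z)))\<^sup>2 \<partial>lborel)"
    using t 1 by simp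
qed

lemma unit_stateE:
  assumes "f \<in> unit_state K"
  obtains u M where "f = (\<lambda>y. ennreal (u y))" "\<And>y. 0 \<le> u y" "L2 u" "(\<integral>y. (u y)\<^sup>2 \<partial>lborel) = 1"
    "\<And>y. y \<notin> K \<Longrightarrow> u y = 0" "\<And>y. u y \<le> M"
proof -
  obtain M where M: "\<And>y. f y \<le> ennreal M" using assms by (auto simp: unit_state_def)
  have [measurable]: "f \<in> borel_measurable borel" using assms by (auto simp: unit_state_def)
  define u where "u y = enn2real (f y)" for y
  have fu: "f y = ennreal (u y)" for y
  proof -
    have "f y < top" using M[of y] ennreal_less_top by (rule le_less_trans)
    then show ?thesis by (simp add: u_def ennreal_enn2real)
  qed
  have u0: "0 \<le> u y" for y by (simp add: u_def)
  have [measurable]: "u \<in> borel_measurable borel" unfolding u_def[abs_def] by measurable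
  have "(\<integral>\<^sup>+y. ennreal ((u y)\<^sup>2) \<partial>lborel) = 1"
    using assms by (simp add: unit_state_def fu power2_eq_square ennreal_mult u0)
  then have "integrable lborel (\<lambda>y. (u y)\<^sup>2)" "(\<integral>y. (u y)\<^sup>2 \<partial>lborel) = 1"
    by (auto intro!: integrableI_nonneg simp: integral_eq_nn_integral)
  moreover have "u y \<le> max 0 M" for y
    using M[of y] fu[of y] u0[of y] by (cases "0 \<le> M") (auto simp: ennreal_neg)
  moreover have "u y = 0" if "y \<notin> K" for y using assms that by (auto simp: unit_state_def u_def)
  ultimately show ?thesis using that[of u "max 0 M"] fu u0 by (auto simp: L2_def)
qed

section \<open>Sorting a state along the window\<close>

lemma sum_pair_gaps: "(\<Sum>b<k. \<Sum>a<b. 1 - real (b - a) * \<delta>) = real k * (real k - 1) / 2 - \<delta> * (real k * ((real k)\<^sup>2 - 1) / 6)"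
proof -
  have inner: "(\<Sum>a<b. 1 - real (b - a) * \<delta>) = real b - \<delta> * (real b * (real b + 1) / 2)" for b
  proof (induction b)
    case (Suc b)
    have "(\<Sum>a<Suc b. 1 - real (Suc b - a) * \<delta>) = (1 - real (Suc b) * \<delta>) + (\<Sum>a<b. 1 - real (Suc b - Suc a) * \<delta>)"
      by (subst sum.lessThan_Suc_shift) simp
    then show ?case using Suc by (simp add: field_simps)
  qed simp
  show ?thesis
  proof (induction k)
    case (Suc k)
    show ?case unfolding sum.lessThan_Suc[of _ k] Suc unfolding inner by (simp add: power2_eq_square field_simps)
  qed simp
qed

text \<open>The state is sampled at \<open>k\<close> points of the window with spacing
  \<open>t\<close>. Sorting the samples at each \<open>y\<close> cannot decrease the form, and the
  sample of rank \<open>j\<close> is a function on the set of points whose window contains a chord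
  of parameter length at least \<open>(k - 1 - j) * t\<close>. The weight \<open>w j\<close> is its
  share of the total squared norm.\<close>

lemma window_decomposition:
  fixes K :: "'a::euclidean_space set"
  assumes f: "f \<in> unit_state K" and u: "f = (\<lambda>y. ennreal (u y))" "\<And>y. 0 \<le> u y" "L2 u" "(\<integral>y. (u y)\<^sup>2 \<partial>lborel) = 1"
    and k: "k > 0" and t: "t > 0" "real (k - 1) * t \<le> 6"
  obtains w :: "nat \<Rightarrow> real" where "\<And>j. j < k \<Longrightarrow> 0 \<le> w j" "(\<Sum>j<k. w j) = 1"
    "t / 2 * ((real k - 1) / 2 - shift_dist u (t *\<^sub>R v) * (((real k)\<^sup>2 - 1) / 6)) \<le> (\<Sum>j<k. w j * (real (k - 1 - j) * t / 2))"
    "ip f (smooth L f) \<le> (\<Sum>j<k. prin_eig L (window K v (real (k - 1 - j) * t / 2)) * ennreal (w j))"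
proof -
  obtain M' where M': "\<And>y. f y \<le> ennreal M'" and f0: "\<And>y. y \<notin> K \<Longrightarrow> f y = 0" using f by (auto simp: unit_state_def)
  define M where "M = max 0 M'"
  have M0: "0 \<le> M" by (simp add: M_def)
  have M: "f y \<le> ennreal M" for y
    by (rule order_trans[OF M'[of y]]) (simp add: M_def ennreal_leI)
  have [measurable]: "u \<in> borel_measurable borel" using u by (auto simp: L2_def)
  \<comment> \<open>Sample parameters start at -3 and advance by \<open>t\<close>; the last one, of
    index \<open>k - 1\<close>, stays at most 3 by hypothesis.\<close>
  define z where "z a y = u (y + (- 3 + real a * t) *\<^sub>R v)" for a y
  have [measurable]: "z a \<in> borel_measurable borel" for a unfolding z_def[abs_def] by measurable
  have z0: "0 \<le> z a y" for a y by (simp add: z_def u)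
  define r where "r j y = order_stat k (\<lambda>a. z a y) j" for j y
  have r0: "0 \<le> r j y" if "j < k" for j y unfolding r_def using that z0 by (intro order_stat_nonneg)
  have rm[measurable]: "r j \<in> borel_measurable borel" if "j < k" for j
    unfolding r_def[abs_def] using that by (intro measurable_order_stat) measurable
  have iz: "integrable lborel (\<lambda>y. (z a y)\<^sup>2)" "(\<integral>y. (z a y)\<^sup>2 \<partial>lborel) = 1" for a
    using lborel_translate[of "\<lambda>y. (u y)\<^sup>2"] u by (auto simp: z_def L2_def)
  have rsum: "(\<Sum>j<k. (r j y)\<^sup>2) = (\<Sum>a<k. (z a y)\<^sup>2)" for y
    unfolding r_def by (rule sum_order_stat)
  have ir: "integrable lborel (\<lambda>y. (r j y)\<^sup>2)" if "j < k" for j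
  proof (rule Bochner_Integration.integrable_bound[where f="\<lambda>y. \<Sum>a<k. (z a y)\<^sup>2"])
    show "AE y in lborel. norm ((r j y)\<^sup>2) \<le> norm (\<Sum>a<k. (z a y)\<^sup>2)"
    proof (rule AE_I2)
      fix y
      have "(r j y)\<^sup>2 \<le> (\<Sum>j<k. (r j y)\<^sup>2)" using that by (intro member_le_sum) auto
      also have "\<dots> = (\<Sum>a<k. (z a y)\<^sup>2)" by (rule rsum)
      also have "\<dots> = norm (\<Sum>a<k. (z a y)\<^sup>2)" by (simp add: sum_nonneg)
      finally show "norm ((r j y)\<^sup>2) \<le> norm (\<Sum>a<k. (z a y)\<^sup>2)" by simp
    qed
  qed (use iz rm[OF that] in auto)
  define N where "N j = (\<integral>y. (r j y)\<^sup>2 \<partial>lborel)" for j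
  have N0: "0 \<le> N j" for j by (simp add: N_def)
  have Nsum: "(\<Sum>j<k. N j) = real k"
  proof -
    have "(\<Sum>j<k. N j) = (\<integral>y. (\<Sum>j<k. (r j y)\<^sup>2) \<partial>lborel)"
      unfolding N_def by (rule Bochner_Integration.integral_sum[symmetric]) (use ir in auto)
    also have "\<dots> = (\<Sum>a<k. (\<integral>y. (z a y)\<^sup>2 \<partial>lborel))"
      unfolding rsum by (rule Bochner_Integration.integral_sum) (use iz in auto)
    finally show ?thesis by (simp add: iz)
  qed
  define \<delta> where "\<delta> = shift_dist u (t *\<^sub>R v)"
  \<comment> \<open>The weighted sum of ranks is a sum over pairs of samples, and
    \<open>integral_min_square_ge\<close> bounds each pair. A pair at index distance
    \<open>b - a\<close> loses at most that many single shifts.\<close>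
  have mean: "real k * (real k - 1) / 2 - \<delta> * (real k * ((real k)\<^sup>2 - 1) / 6) \<le> (\<Sum>j<k. real (k - 1 - j) * N j)"
  proof -
    have im: "integrable lborel (\<lambda>y. (min (z a y) (z b y))\<^sup>2)"
      and mm: "1 - real (b - a) * \<delta> \<le> (\<integral>y. (min (z a y) (z b y))\<^sup>2 \<partial>lborel)" if "a < b" for a b
    proof -
      let ?s = "(- 3 + real a * t) *\<^sub>R v" and ?d = "real (b - a) *\<^sub>R (t *\<^sub>R v)"
      have e: "(\<lambda>y. (min (z a y) (z b y))\<^sup>2) = (\<lambda>y. (min (u (y + ?s)) (u ((y + ?s) + ?d)))\<^sup>2)"
        using that by (auto simp: z_def fun_eq_iff algebra_simps of_nat_diff)
      note g = integral_min_square_ge[OF u(3,2,4), of ?d]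
      note tr = lborel_translate[OF g(1), of ?s]
      show "integrable lborel (\<lambda>y. (min (z a y) (z b y))\<^sup>2)" unfolding e by (rule tr(1))
      have "1 - real (b - a) * \<delta> \<le> 1 - shift_dist u ?d"
        unfolding \<delta>_def using shift_dist_multiple[OF u(3), of "b - a" "t *\<^sub>R v"] by simp
      also note g(2)
      finally show "1 - real (b - a) * \<delta> \<le> (\<integral>y. (min (z a y) (z b y))\<^sup>2 \<partial>lborel)" unfolding e tr(2) .
    qed
    have "real k * (real k - 1) / 2 - \<delta> * (real k * ((real k)\<^sup>2 - 1) / 6) = (\<Sum>b<k. \<Sum>a<b. 1 - real (b - a) * \<delta>)"
      by (rule sum_pair_gaps[symmetric])
    also have "\<dots> \<le> (\<Sum>b<k. \<Sum>a<b. (\<integral>y. (min (z a y) (z b y))\<^sup>2 \<partial>lborel))"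
      by (intro sum_mono mm) auto
    also have "\<dots> = (\<integral>y. (\<Sum>b<k. \<Sum>a<b. (min (z a y) (z b y))\<^sup>2) \<partial>lborel)"
      using im by (subst Bochner_Integration.integral_sum) (auto intro!: sum.cong Bochner_Integration.integral_sum[symmetric])
    also have "\<dots> = (\<integral>y. (\<Sum>j<k. real (k - 1 - j) * (r j y)\<^sup>2) \<partial>lborel)"
      by (simp only: sum_order_stat_weighted r_def)
    also have "\<dots> = (\<Sum>j<k. real (k - 1 - j) * N j)"
      unfolding N_def using ir by (subst Bochner_Integration.integral_sum) auto
    finally show ?thesis .
  qed
  define w where "w j = N j / real k" for j
  have w1: "(\<Sum>j<k. w j) = 1" using Nsum k by (simp add: w_def sum_divide_distrib[symmetric])
  have w2: "t / 2 * ((real k - 1) / 2 - shift_dist u (t *\<^sub>R v) * (((real k)\<^sup>2 - 1) / 6)) \<le> (\<Sum>j<k. w j * (real (k - 1 - j) * t / 2))"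
  proof -
    have "t / 2 * ((real k - 1) / 2 - \<delta> * (((real k)\<^sup>2 - 1) / 6))
      = t / (2 * real k) * (real k * (real k - 1) / 2 - \<delta> * (real k * ((real k)\<^sup>2 - 1) / 6))"
      using k by (simp add: field_simps)
    also have "\<dots> \<le> t / (2 * real k) * (\<Sum>j<k. real (k - 1 - j) * N j)"
      using t by (intro mult_left_mono mean) auto
    also have "\<dots> = (\<Sum>j<k. w j * (real (k - 1 - j) * t / 2))"
      by (simp add: w_def sum_distrib_left field_simps)
    finally show ?thesis by (simp add: \<delta>_def)
  qed
  let ?r = "\<lambda>j y. ennreal (r j y)" and ?z = "\<lambda>a y. ennreal (z a y)"
  have ipr: "ip (?r j) (?r j) = ennreal (N j)" if "j < k" for j
    unfolding N_def using ir[OF that] r0[OF that]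
    by (subst nn_integral_eq_integral[symmetric]) (auto simp: ennreal_mult power2_eq_square)
  \<comment> \<open>Positivity of the sample of rank \<open>j\<close> at \<open>y\<close> gives two
    positive samples at index distance at least \<open>k - 1 - j\<close>, hence two points of
    \<open>K\<close> in the window that are far enough apart.\<close>
  have le: "ip (?r j) (smooth L (?r j)) \<le> prin_eig L (window K v (real (k - 1 - j) * t / 2)) * ennreal (N j)" if j: "j < k" for j
    unfolding ipr[OF j, symmetric]
  proof (rule ip_smooth_le_prin_eig[where M=M])
    note rm[OF j, measurable]
    show "?r j \<in> borel_measurable borel" by measurable
    show "?r j y = 0" if y: "y \<notin> window K v (real (k - 1 - j) * t / 2)" for y
    proof (rule ccontr)
      assume "?r j y \<noteq> 0"
      then have "0 < order_stat k (\<lambda>a. z a y) j" using r0[OF j, of y] by (auto simp: r_def less_le)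
      from order_stat_pos_spread[OF j this] obtain a b where ab: "a < k" "b < k" "0 < z a y" "0 < z b y" "a + (k - 1 - j) \<le> b"
        by metis
      have in_K: "y + (- 3 + real c * t) *\<^sub>R v \<in> K" if "0 < z c y" for c
        using that f0[of "y + (- 3 + real c * t) *\<^sub>R v"] u(1) by (auto simp: z_def)
      have rng: "- 3 + real c * t \<in> {-3..3}" if "c < k" for c
      proof -
        have "real c * t \<le> real (k - 1) * t" using that t by (intro mult_right_mono) auto
        then have "real c * t \<le> 6" using t by linarith
        then show ?thesis using t by simp
      qed
      have "real (a + (k - 1 - j)) * t \<le> real b * t" using ab t by (intro mult_right_mono) auto
      then have "2 * (real (k - 1 - j) * t / 2) \<le> (- 3 + real b * t) - (- 3 + real a * t)"
        by (simp add: algebra_simps)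
      then have "y \<in> window K v (real (k - 1 - j) * t / 2)"
        unfolding window_def using rng[OF ab(1)] rng[OF ab(2)] in_K[OF ab(3)] in_K[OF ab(4)] by blast
      then show False using y by simp
    qed
    show "?r j y \<le> ennreal M" for y
    proof -
      have "z a y \<le> M" if "a < k" for a
        using M[of "y + (- 3 + real a * t) *\<^sub>R v"] z0[of a y] u(1)
        using M0 by (auto simp: z_def)
      then have "r j y \<le> M" unfolding r_def using j by (intro order_stat_le)
      then show ?thesis by (rule ennreal_leI)
    qed
    show "ip (?r j) (?r j) < top" unfolding ipr[OF j] by simp
  qed
  have "of_nat k * ip f (smooth L f) \<le> (\<Sum>j<k. ip (?r j) (smooth L (?r j)))"
  proof -
    \<comment> \<open>Each sample is a translate of the state, so all \<open>k\<close> forms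
      agree.\<close>
    have za: "ip (?z a) (smooth L (?z a)) = ip f (smooth L f)" for a
    proof -
      let ?s = "(- 3 + real a * t) *\<^sub>R v"
      have "smooth L (?z a) y = smooth L f (y + ?s)" for y
        unfolding smooth_def by (simp add: z_def u(1) algebra_simps)
      then have "ip (?z a) (smooth L (?z a)) = (\<integral>\<^sup>+y. f (y + ?s) * smooth L f (y + ?s) \<partial>lborel)"
        by (simp add: z_def u(1))
      also have "\<dots> = ip f (smooth L f)"
        by (rule nn_integral_lborel_translate[where f="\<lambda>y. f y * smooth L f y"]) (simp add: u(1))
      finally show ?thesis .
    qed
    have "of_nat k * ip f (smooth L f) = (\<Sum>a<k. ip (?z a) (smooth L (?z a)))" by (simp add: za)
    also have "\<dots> = (\<Sum>a<k. \<integral>\<^sup>+x. \<integral>\<^sup>+y. ?z a y * ?z a (y + x) \<partial>lborel \<partial>gauss_law L)"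
      by (intro sum.cong refl ip_smooth) auto
    also have "\<dots> = (\<integral>\<^sup>+x. \<integral>\<^sup>+y. (\<Sum>a<k. ?z a y * ?z a (y + x)) \<partial>lborel \<partial>gauss_law L)"
      by (simp add: nn_integral_sum)
    \<comment> \<open>For every shift \<open>x\<close> the rearrangement inequality is applied to
      the samples at \<open>y\<close> and those at \<open>y + x\<close>, each sorted on its
      own.\<close>
    also have "\<dots> \<le> (\<integral>\<^sup>+x. \<integral>\<^sup>+y. (\<Sum>j<k. ?r j y * ?r j (y + x)) \<partial>lborel \<partial>gauss_law L)"
    proof (intro nn_integral_mono)
      fix x y
      have "(\<Sum>a<k. ?z a y * ?z a (y + x)) = ennreal (\<Sum>a<k. z a y * z a (y + x))"
        using z0 by (simp add: ennreal_mult[symmetric] sum_ennreal)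
      also have "\<dots> \<le> ennreal (\<Sum>j<k. r j y * r j (y + x))"
        unfolding r_def by (intro ennreal_leI order_stat_rearrangement)
      also have "\<dots> = (\<Sum>j<k. ?r j y * ?r j (y + x))"
        using r0 by (subst sum_ennreal[symmetric]) (auto simp: ennreal_mult)
      finally show "(\<Sum>a<k. ?z a y * ?z a (y + x)) \<le> (\<Sum>j<k. ?r j y * ?r j (y + x))" .
    qed
    also have "\<dots> = (\<Sum>j<k. \<integral>\<^sup>+x. \<integral>\<^sup>+y. ?r j y * ?r j (y + x) \<partial>lborel \<partial>gauss_law L)"
    proof -
      have "(\<integral>\<^sup>+x. \<integral>\<^sup>+y. (\<Sum>j<k. ?r j y * ?r j (y + x)) \<partial>lborel \<partial>gauss_law L)
        = (\<integral>\<^sup>+x. (\<Sum>j<k. \<integral>\<^sup>+y. ?r j y * ?r j (y + x) \<partial>lborel) \<partial>gauss_law L)"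
      proof (intro nn_integral_cong nn_integral_sum)
        fix x and j assume "j \<in> {..<k}"
        then have [measurable]: "r j \<in> borel_measurable borel" by simp
        show "(\<lambda>y. ?r j y * ?r j (y + x)) \<in> borel_measurable lborel" by measurable
      qed
      also have "\<dots> = (\<Sum>j<k. \<integral>\<^sup>+x. \<integral>\<^sup>+y. ?r j y * ?r j (y + x) \<partial>lborel \<partial>gauss_law L)"
      proof (intro nn_integral_sum)
        fix j assume "j \<in> {..<k}"
        then have [measurable]: "r j \<in> borel_measurable borel" by simp
        show "(\<lambda>x. \<integral>\<^sup>+y. ?r j y * ?r j (y + x) \<partial>lborel) \<in> borel_measurable (gauss_law L)" by measurable
      qed
      finally show ?thesis .
    qed
    also have "\<dots> = (\<Sum>j<k. ip (?r j) (smooth L (?r j)))"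
      by (intro sum.cong refl ip_smooth[symmetric]) auto
    finally show ?thesis .
  qed
  also have "\<dots> \<le> (\<Sum>j<k. prin_eig L (window K v (real (k - 1 - j) * t / 2)) * ennreal (N j))"
    by (intro sum_mono le) auto
  finally have *: "of_nat k * ip f (smooth L f) \<le> (\<Sum>j<k. prin_eig L (window K v (real (k - 1 - j) * t / 2)) * ennreal (N j))" .
  have w3: "ip f (smooth L f) \<le> (\<Sum>j<k. prin_eig L (window K v (real (k - 1 - j) * t / 2)) * ennreal (w j))"
  proof -
    have kk: "ennreal (1 / real k) * of_nat k = 1"
      using k by (simp add: ennreal_of_nat_eq_real_of_nat ennreal_mult[symmetric])
    have "ip f (smooth L f) = ennreal (1 / real k) * (of_nat k * ip f (smooth L f))"
      by (simp only: mult.assoc[symmetric] kk mult_1)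
    also have "\<dots> \<le> ennreal (1 / real k) * (\<Sum>j<k. prin_eig L (window K v (real (k - 1 - j) * t / 2)) * ennreal (N j))"
      by (intro mult_left_mono *) simp
    also have "\<dots> = (\<Sum>j<k. prin_eig L (window K v (real (k - 1 - j) * t / 2)) * ennreal (w j))"
      unfolding sum_distrib_left
    proof (intro sum.cong refl)
      fix j
      have "ennreal (w j) = ennreal (1 / real k) * ennreal (N j)"
        by (simp add: w_def ennreal_mult[symmetric] N0)
      then show "ennreal (1 / real k) * (prin_eig L (window K v (real (k - 1 - j) * t / 2)) * ennreal (N j))
        = prin_eig L (window K v (real (k - 1 - j) * t / 2)) * ennreal (w j)" by (simp add: mult_ac)
    qed
    finally show ?thesis .
  qed
  show ?thesis
    by (rule that[of w]) (use w1 w2 w3 N0 in \<open>auto simp: w_def\<close>)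
qed

section \<open>The variation of a state in one direction\<close>

lemma autocorr_shift_dist:
  assumes u: "\<And>y. 0 \<le> u y" "L2 u" "(\<integral>y. (u y)\<^sup>2 \<partial>lborel) = 1"
  shows "autocorr (\<lambda>y. ennreal (u y)) z = ennreal (1 - (shift_dist u z)\<^sup>2 / 2)"
proof -
  have "autocorr (\<lambda>y. ennreal (u y)) z = (\<integral>\<^sup>+y. ennreal (u y * u (y + z)) \<partial>lborel)"
    unfolding autocorr_def using u(1) by (simp add: ennreal_mult)
  also have "\<dots> = ennreal (\<integral>y. u y * u (y + z) \<partial>lborel)"
    using u L2_mult[OF u(2) L2_translate[OF u(2)]] by (intro nn_integral_eq_integral) auto
  also have "(\<integral>y. u y * u (y + z) \<partial>lborel) = 1 - (shift_dist u z)\<^sup>2 / 2"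
    using shift_dist_square[OF u(2,3), of z] by linarith
  finally show ?thesis .
qed

lemma shift_dist_uminus:
  assumes "L2 u"
  shows "shift_dist u (- z) = shift_dist u z"
proof -
  have i: "integrable lborel (\<lambda>y. (u (y + - z) - u y)\<^sup>2)"
    using L2_diff[OF L2_translate[OF assms, of "- z"] assms] by (auto simp: L2_def)
  show ?thesis
    unfolding shift_dist_def norm_L2_def
    using lborel_translate(2)[OF i, of z] by (simp add: power2_commute)
qed

lemma shift_dist_square_le:
  assumes u: "\<And>y. 0 \<le> u y" "L2 u" "(\<integral>y. (u y)\<^sup>2 \<partial>lborel) = 1"
  shows "(shift_dist u z)\<^sup>2 \<le> 2"
proof -
  have "0 \<le> (\<integral>y. u y * u (y + z) \<partial>lborel)" using u(1) by simp
  then show ?thesis using shift_dist_square[OF u(2,3), of z] by simp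
qed

text \<open>The truncation at \<open>b\<close> is done with the polynomial bound \<open>1 - s\<^sup>2 / b\<^sup>2 \<le> 1[\<bar>s\<bar> \<le> b]\<close>,
  so that only the fourth moment of the Gaussian is needed.\<close>

lemma ip_smooth_lag:
  assumes u: "\<And>y. 0 \<le> u y" "L2 u" "(\<integral>y. (u y)\<^sup>2 \<partial>lborel) = 1"
    and a: "a > 0" and b: "b > 0" and m: "m \<ge> 0" and lag: "\<And>t. 0 < t \<Longrightarrow> t \<le> b \<Longrightarrow> m * t \<le> shift_dist u (t *\<^sub>R v)"
  shows "ip (\<lambda>y. ennreal (u y)) (smooth [(v, a)] (\<lambda>y. ennreal (u y))) + ennreal (a * m\<^sup>2) \<le> ennreal (1 + 6 * a\<^sup>2 * m\<^sup>2 / b\<^sup>2)"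
proof -
  let ?f = "\<lambda>y. ennreal (u y)"
  have [measurable]: "u \<in> borel_measurable borel" using u(2) by (auto simp: L2_def)
  \<comment> \<open>\<open>?C\<close> makes \<open>?C * t^4\<close> dominate
    \<open>a * m\<^sup>2 * t\<^sup>2\<close> beyond the range of the lag hypothesis. With the fourth
    moment 3 this produces the constant 6.\<close>
  let ?s = "\<lambda>t. sqrt (2 * a) * t" and ?C = "2 * a\<^sup>2 * m\<^sup>2 / b\<^sup>2"
  have C0: "0 \<le> ?C" by simp
  have lag': "m * \<bar>t\<bar> \<le> shift_dist u (t *\<^sub>R v)" if "\<bar>t\<bar> \<le> b" for t
  proof -
    consider "t = 0" | "t > 0" | "t < 0" by linarith
    then show ?thesis
      using lag[of t] lag[of "- t"] that shift_dist_uminus[OF u(2), of "t *\<^sub>R v"]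
      by cases (auto simp: shift_dist_0)
  qed
  have pt: "autocorr ?f ((?s t) *\<^sub>R v) + ennreal (a * m\<^sup>2) * ennreal (t\<^sup>2) \<le> 1 + ennreal ?C * ennreal (t^4)" for t
  proof -
    let ?d = "shift_dist u ((?s t) *\<^sub>R v)"
    have s2: "(?s t)\<^sup>2 = 2 * a * t\<^sup>2" using a by (simp add: power_mult_distrib)
    have d2: "0 \<le> 1 - ?d\<^sup>2 / 2" using shift_dist_square_le[OF u, of "(?s t) *\<^sub>R v"] by simp
    have "1 - ?d\<^sup>2 / 2 + a * m\<^sup>2 * t\<^sup>2 \<le> 1 + ?C * t^4"
    proof (cases "\<bar>?s t\<bar> \<le> b")
      case True
      have "(m * \<bar>?s t\<bar>)\<^sup>2 \<le> ?d\<^sup>2" using lag'[OF True] m by (intro power_mono) auto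
      moreover have "(m * \<bar>?s t\<bar>)\<^sup>2 = m\<^sup>2 * (2 * a * t\<^sup>2)"
        by (simp only: power_mult_distrib[of m] power2_abs s2)
      ultimately have "a * m\<^sup>2 * t\<^sup>2 \<le> ?d\<^sup>2 / 2" by (simp add: mult_ac)
      moreover have "0 \<le> ?C * t^4" using C0 by (intro mult_nonneg_nonneg) auto
      ultimately show ?thesis by linarith
    next
      case False
      then have "b\<^sup>2 \<le> \<bar>?s t\<bar>\<^sup>2" using b by (intro power_mono) auto
      then have "b\<^sup>2 \<le> 2 * a * t\<^sup>2" unfolding power2_abs s2 .
      then have "a * m\<^sup>2 * t\<^sup>2 * b\<^sup>2 \<le> a * m\<^sup>2 * t\<^sup>2 * (2 * a * t\<^sup>2)" using a by (intro mult_left_mono) auto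
      then have "a * m\<^sup>2 * t\<^sup>2 \<le> ?C * t^4"
        using b by (simp add: field_simps power2_eq_square power4_eq_xxxx)
      then show ?thesis using zero_le_power2[of ?d] by linarith
    qed
    then have "ennreal (1 - ?d\<^sup>2 / 2 + a * m\<^sup>2 * t\<^sup>2) \<le> ennreal (1 + ?C * t^4)" by (rule ennreal_leI)
    moreover have "ennreal (1 - ?d\<^sup>2 / 2 + a * m\<^sup>2 * t\<^sup>2) = ennreal (1 - ?d\<^sup>2 / 2) + ennreal (a * m\<^sup>2) * ennreal (t\<^sup>2)"
      using d2 a by (subst ennreal_plus) (auto simp: ennreal_mult)
    moreover have "ennreal (1 + ?C * t^4) = 1 + ennreal ?C * ennreal (t^4)"
    proof -
      have "ennreal (1 + ?C * t^4) = ennreal 1 + ennreal (?C * t^4)" using C0 by (intro ennreal_plus mult_nonneg_nonneg) auto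
      also have "ennreal (?C * t^4) = ennreal ?C * ennreal (t^4)" using C0 by (intro ennreal_mult) auto
      finally show ?thesis by simp
    qed
    ultimately show ?thesis unfolding autocorr_shift_dist[OF u] by simp
  qed
  have "ip ?f (smooth [(v, a)] ?f) = (\<integral>\<^sup>+t. autocorr ?f ((?s t) *\<^sub>R v) \<partial>gauss)"
    unfolding ip_smooth_autocorr[of ?f, simplified] by (subst nn_integral_gauss_law_Cons, simp) (simp add: nn_integral_return)
  then have "ip ?f (smooth [(v, a)] ?f) + ennreal (a * m\<^sup>2)
    = (\<integral>\<^sup>+t. autocorr ?f ((?s t) *\<^sub>R v) \<partial>gauss) + ennreal (a * m\<^sup>2) * (\<integral>\<^sup>+t. ennreal (t\<^sup>2) \<partial>gauss)"
    by (simp add: nn_integral_gauss_square)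
  also have "\<dots> = (\<integral>\<^sup>+t. autocorr ?f ((?s t) *\<^sub>R v) + ennreal (a * m\<^sup>2) * ennreal (t\<^sup>2) \<partial>gauss)"
    by (subst nn_integral_cmult[symmetric], measurable, subst nn_integral_add[symmetric], measurable)
  also have "\<dots> \<le> (\<integral>\<^sup>+t. 1 + ennreal ?C * ennreal (t^4) \<partial>gauss)"
    by (intro nn_integral_mono pt)
  also have "\<dots> = 1 + ennreal ?C * 3"
    by (subst nn_integral_add, measurable, subst nn_integral_cmult, measurable)
      (simp add: nn_integral_gauss_fourth gauss.emeasure_space_1[unfolded space_gauss])
  also have "\<dots> = ennreal (1 + ?C * 3)"
  proof -
    have "ennreal (1 + ?C * 3) = ennreal 1 + ennreal (?C * 3)" using C0 by (intro ennreal_plus mult_nonneg_nonneg) auto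
    also have "ennreal (?C * 3) = ennreal ?C * ennreal 3" using C0 by (intro ennreal_mult) auto
    finally show ?thesis by simp
  qed
  also have "1 + ?C * 3 = 1 + 6 * a\<^sup>2 * m\<^sup>2 / b\<^sup>2" by (simp add: mult.assoc)
  finally show ?thesis .
qed

text \<open>The extra direction \<open>v\<close> is split off: the form equals
  \<open><P f, R f>\<close>, where \<open>P\<close> is the square root of the smoothing along
  \<open>L\<close> and \<open>R\<close> the smoothing along \<open>v\<close>, and Cauchy-Schwarz
  separates the two. This is why \<open>L\<close> is halved on the left and \<open>a\<close> is
  doubled on the right.\<close>

lemma ip_smooth_Cons_le:
  assumes [measurable]: "f \<in> borel_measurable borel"
  shows "(ip f (smooth ((v, a) # halve L) f))\<^sup>2 \<le> ip f (smooth L f) * ip f (smooth [(v, 2 * a)] f)"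
proof -
  let ?P = "smooth (halve L) f" and ?R = "smooth [(v, a)] f"
  have "ip f (smooth ((v, a) # halve L) f) = (\<integral>\<^sup>+z. autocorr f z \<partial>gauss_law ((v, a) # halve L))"
    by (rule ip_smooth_autocorr) measurable
  also have "\<dots> = (\<integral>\<^sup>+t. \<integral>\<^sup>+z. autocorr f ((sqrt (2 * a) * t) *\<^sub>R v + z) \<partial>gauss_law (halve L) \<partial>gauss)"
    by (subst nn_integral_gauss_law_Cons) auto
  also have "\<dots> = (\<integral>\<^sup>+t. ip f (smooth (halve L) (\<lambda>y. f (y + (sqrt (2 * a) * t) *\<^sub>R v))) \<partial>gauss)"
  proof (rule nn_integral_cong)
    fix t
    have "ip f (smooth (halve L) (\<lambda>y. f (y + (sqrt (2 * a) * t) *\<^sub>R v)))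
      = (\<integral>\<^sup>+z. \<integral>\<^sup>+y. f y * f (y + z + (sqrt (2 * a) * t) *\<^sub>R v) \<partial>lborel \<partial>gauss_law (halve L))"
      by (rule ip_smooth) measurable
    then show "(\<integral>\<^sup>+z. autocorr f ((sqrt (2 * a) * t) *\<^sub>R v + z) \<partial>gauss_law (halve L))
      = ip f (smooth (halve L) (\<lambda>y. f (y + (sqrt (2 * a) * t) *\<^sub>R v)))"
      by (simp add: autocorr_def add_ac)
  qed
  also have "\<dots> = (\<integral>\<^sup>+t. ip ?P (\<lambda>y. f (y + (sqrt (2 * a) * t) *\<^sub>R v)) \<partial>gauss)"
    by (intro nn_integral_cong ip_smooth_commute) measurable
  also have "\<dots> = (\<integral>\<^sup>+z. \<integral>\<^sup>+y. ?P y * f (y + z) \<partial>lborel \<partial>gauss_law [(v, a)])"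
    by (subst nn_integral_gauss_law_Cons, simp) (simp add: nn_integral_return)
  also have "\<dots> = ip ?P ?R"
    by (rule ip_smooth[symmetric]) measurable
  finally have "(ip f (smooth ((v, a) # halve L) f))\<^sup>2 = (ip ?P ?R)\<^sup>2" by simp
  also have "\<dots> \<le> ip ?P ?P * ip ?R ?R" by (rule ip_Cauchy_Schwarz) measurable
  also have "ip ?P ?P = ip f (smooth L f)" by (rule ip_smooth_halve[symmetric]) measurable
  also have "ip ?R ?R = ip f (smooth [(v, 2 * a)] f)"
    using ip_smooth_halve[of f f "[(v, 2 * a)]"] by simp
  finally show ?thesis .
qed

section \<open>Elementary estimates and the core inequality\<close>

lemma exp_le_quadratic:
  fixes y :: real
  assumes "\<bar>y\<bar> \<le> 1"
  shows "exp y \<le> 1 + y + y\<^sup>2"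
proof (cases "0 \<le> y")
  case True
  then show ?thesis using exp_bound[of y] assms by simp
next
  case False
  define w where "w = - y"
  have w: "0 < w" "w \<le> 1" using False assms by (auto simp: w_def)
  have pos: "1 - w + w\<^sup>2 > 0" using w by (smt (verit) zero_less_power)
  have "1 + w + w\<^sup>2 / 2 \<le> exp w" using w by (intro exp_lower_Taylor_quadratic) auto
  \<comment> \<open>For negative arguments the bound is proved for the reciprocal, by multiplying
    with the Taylor lower bound of \<open>exp w\<close>.\<close>
  have "1 \<le> (1 - w + w\<^sup>2) * (1 + w + w\<^sup>2 / 2)"
  proof -
    have "(1 - w + w\<^sup>2) * (1 + w + w\<^sup>2 / 2) = 1 + w\<^sup>2 / 2 + w^3 / 2 + w^4 / 2"
      by (simp add: power2_eq_square power3_eq_cube power4_eq_xxxx field_simps)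
    moreover have "0 \<le> w\<^sup>2 / 2 + w^3 / 2 + w^4 / 2" using w by simp
    ultimately show ?thesis by linarith
  qed
  also have "\<dots> \<le> (1 - w + w\<^sup>2) * exp w" using \<open>1 + w + w\<^sup>2 / 2 \<le> exp w\<close> pos by (intro mult_left_mono) auto
  finally have "1 / exp w \<le> 1 - w + w\<^sup>2" by (simp add: field_simps)
  then show ?thesis by (simp add: w_def exp_minus inverse_eq_divide)
qed

text \<open>Jensen's inequality points the other way, so the exponentials are expanded to second
  order. Since the \<open>p j\<close> stay within distance 2 of 1, the loss is at most
  \<open>4 * x\<^sup>2\<close>.\<close>

lemma weighted_exp_le:
  fixes w p :: "nat \<Rightarrow> real"
  assumes w: "\<And>j. j < k \<Longrightarrow> 0 \<le> w j" "(\<Sum>j<k. w j) = 1" and p: "\<And>j. j < k \<Longrightarrow> 0 \<le> p j \<and> p j \<le> 3"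
    and x: "0 \<le> x" "x \<le> 1/2"
  shows "(\<Sum>j<k. w j * exp (- x * (p j - 1))) \<le> exp (- x * ((\<Sum>j<k. w j * p j) - 1) + 4 * x\<^sup>2)"
proof -
  have "exp (- x * (p j - 1)) \<le> 1 - x * (p j - 1) + 4 * x\<^sup>2" if j: "j < k" for j
  proof -
    have pj: "\<bar>p j - 1\<bar> \<le> 2" using p[OF j] by auto
    have "\<bar>x\<bar> * \<bar>p j - 1\<bar> \<le> (1/2) * 2" using x pj by (intro mult_mono) auto
    then have "exp (- x * (p j - 1)) \<le> 1 + (- x * (p j - 1)) + (- x * (p j - 1))\<^sup>2"
      by (intro exp_le_quadratic) (simp add: abs_mult)
    also have "(- x * (p j - 1))\<^sup>2 = x\<^sup>2 * \<bar>p j - 1\<bar>\<^sup>2" by (simp add: power_mult_distrib)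
    also have "\<dots> \<le> x\<^sup>2 * 2\<^sup>2" using pj by (intro mult_left_mono power_mono) auto
    finally show ?thesis by simp
  qed
  then have "(\<Sum>j<k. w j * exp (- x * (p j - 1))) \<le> (\<Sum>j<k. w j * (1 - x * (p j - 1) + 4 * x\<^sup>2))"
    using w by (intro sum_mono mult_left_mono) auto
  also have "\<dots> = (\<Sum>j<k. (1 + x + 4 * x\<^sup>2) * w j - x * (w j * p j))"
    by (intro sum.cong) (auto simp: algebra_simps)
  also have "\<dots> = (1 + x + 4 * x\<^sup>2) * (\<Sum>j<k. w j) - x * (\<Sum>j<k. w j * p j)"
    by (simp add: sum_subtractf sum_distrib_left)
  also have "\<dots> = 1 + (- x * ((\<Sum>j<k. w j * p j) - 1) + 4 * x\<^sup>2)"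
    using w by (simp add: algebra_simps)
  also have "\<dots> \<le> exp (- x * ((\<Sum>j<k. w j * p j) - 1) + 4 * x\<^sup>2)"
    by (rule exp_ge_add_one_self)
  finally show ?thesis .
qed

text \<open>\<open>k\<close> counts the grid points of spacing \<open>t\<close> in a window of
  length 6. As \<open>t\<close> tends to 0 the lower bound tends to
  \<open>3 / 2 - 3 * m\<close>.\<close>

lemma window_mean_bound:
  fixes t \<delta> m :: real
  assumes t: "0 < t" "t \<le> 1" and k: "k = nat \<lfloor>6 / t\<rfloor> + 1" and \<delta>: "\<delta> \<le> m * t" and m: "0 \<le> m"
  shows "real (k - 1) * t \<le> 6" and "k > 0"
    and "3 / 2 - t / 4 - m * (3 + t) \<le> t / 2 * ((real k - 1) / 2 - \<delta> * (((real k)\<^sup>2 - 1) / 6))"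
proof -
  define q where "q = real (k - 1)"
  have fl: "real_of_int \<lfloor>6 / t\<rfloor> \<le> 6 / t" "6 / t < real_of_int \<lfloor>6 / t\<rfloor> + 1" by linarith+
  have "0 \<le> \<lfloor>6 / t\<rfloor>" using t by simp
  then have q: "q = real_of_int \<lfloor>6 / t\<rfloor>" "real k = q + 1" by (simp_all add: q_def k)
  have "q * t \<le> 6 / t * t" unfolding q using fl t by (intro mult_right_mono) auto
  then have qt: "q * t \<le> 6" using t by simp
  have "6 / t * t < (q + 1) * t" unfolding q using fl t by (intro mult_strict_right_mono) auto
  then have qt': "6 - t < q * t" using t by (simp add: algebra_simps)
  show "real (k - 1) * t \<le> 6" using qt by (simp add: q_def)
  show "k > 0" by (simp add: k)
  have q0: "0 \<le> q" by (simp add: q_def)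
  have "t / 2 * (\<delta> * (q * (q + 2) / 6)) \<le> t / 2 * ((m * t) * (q * (q + 2) / 6))"
    using \<delta> t q0 by (intro mult_left_mono mult_right_mono) auto
  also have "\<dots> = m * ((q * t) * (q * t + 2 * t)) / 12" by (simp add: algebra_simps)
  also have "\<dots> \<le> m * (6 * (6 + 2 * t)) / 12"
    using qt t q0 m by (intro divide_right_mono mult_left_mono mult_mono) auto
  finally have A: "t / 2 * (\<delta> * (q * (q + 2) / 6)) \<le> m * (3 + t)" by (simp add: algebra_simps)
  have "t / 2 * ((real k - 1) / 2 - \<delta> * (((real k)\<^sup>2 - 1) / 6)) = q * t / 4 - t / 2 * (\<delta> * (q * (q + 2) / 6))"
    unfolding q(2) by (simp add: power2_eq_square algebra_simps)
  then show "3 / 2 - t / 4 - m * (3 + t) \<le> t / 2 * ((real k - 1) / 2 - \<delta> * (((real k)\<^sup>2 - 1) / 6))"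
    using A qt' by linarith
qed


text \<open>The weight \<open>9 * x\<close> on \<open>v\<close> is the one for which \<open>9 * D - 3 * sqrt D + 1 / 4\<close> is a square;
  this fixes the constant \<open>1 / 36\<close>.  The hypothesis on \<open>\<epsilon>^4\<close> is a crude way of saying that \<open>x\<close> is small.\<close>

lemma core_inequality_aux:
  fixes K :: "'a::euclidean_space set"
  assumes f: "f \<in> unit_state K"
    and slope: "\<And>p. 0 \<le> p \<Longrightarrow> p \<le> 3 \<Longrightarrow> prin_eig L (window K v p) \<le> ennreal (\<sigma> * exp (- x * (p - 1)))"
    and \<sigma>: "0 \<le> \<sigma>" and x: "0 < x" "x \<le> 1/4" and \<epsilon>: "0 < \<epsilon>" "\<epsilon> \<le> 1" and xe: "10^6 * x \<le> \<epsilon>^4"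
  shows "ip f (smooth L f) * ip f (smooth [(v, 9 * x)] f) \<le> ennreal (\<sigma> * exp (- x / 4 + \<epsilon> * x))"
proof -
  obtain u M where u: "f = (\<lambda>y. ennreal (u y))" "\<And>y. 0 \<le> u y" "L2 u" "(\<integral>y. (u y)\<^sup>2 \<partial>lborel) = 1"
    using unit_stateE[OF f] by metis
  have fm[measurable]: "f \<in> borel_measurable borel" and f1: "ip f f = 1" using f by (auto simp: unit_state_def)
  let ?I = "ip f (smooth [(v, 9 * x)] f)"
  have "?I \<le> 1" using ip_smooth_le[OF fm] f1 by simp
  then obtain I where I: "0 \<le> I" "I \<le> 1" "?I = ennreal I" by (cases ?I) (auto simp: top_unique)
  \<comment> \<open>\<open>D\<close> plays the part of the Dirichlet energy in direction
    \<open>v\<close>, read off from smoothing with weight \<open>9 * x\<close>.\<close>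
  define D where "D = (1 - I) / (9 * x)"
  have D: "0 \<le> D" "I = 1 - 9 * x * D" using x I by (auto simp: D_def)
  \<comment> \<open>The window mean loses at most \<open>5 * b / 4\<close> and
    \<open>3 * e1\<close>, together \<open>\<epsilon> / 2\<close>. The other half of
    \<open>\<epsilon>\<close> pays for the second-order term \<open>4 * x\<^sup>2\<close>.\<close>
  define b where "b = \<epsilon> / 5"
  define e1 where "e1 = \<epsilon> / 12"
  have b: "0 < b" "b \<le> 1" and e1: "0 < e1" using \<epsilon> by (auto simp: b_def e1_def)
  define m where "m = sqrt D + e1"
  have m0: "0 < m" using D e1 by (auto simp: m_def intro: add_nonneg_pos)
  \<comment> \<open>A lag that moves the state by at most \<open>m * t\<close> is sought for
    \<open>D < 1/4\<close>. For larger \<open>D\<close> the charge \<open>9 * D\<close> suffices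
    alone, and any \<open>t\<close> will do.\<close>
  have "\<exists>t. 0 < t \<and> t \<le> b \<and> (D < 1/4 \<longrightarrow> shift_dist u (t *\<^sub>R v) \<le> m * t)"
  proof (cases "D < 1/4")
    case False
    then show ?thesis using b by (intro exI[of _ b]) auto
  next
    case True
    have sD: "sqrt D \<le> 1/2" using True real_sqrt_le_mono[of D "1/4"] by (simp add: real_sqrt_divide)
    have m1: "m \<le> 1" using sD \<epsilon> by (auto simp: m_def e1_def)
    show ?thesis
    proof (rule ccontr)
      assume *: "\<not> ?thesis"
      \<comment> \<open>If all lags up to \<open>b\<close> moved the state by at least
        \<open>m * t\<close>, then \<open>ip_smooth_lag\<close> would give
        \<open>m\<^sup>2 < D + e1\<^sup>2\<close>, against \<open>m = sqrt D + e1\<close>.\<close>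
      have far: "m * t \<le> shift_dist u (t *\<^sub>R v)" if "0 < t" "t \<le> b" for t
        using * that True by (meson linorder_le_cases)
      have "ip f (smooth [(v, 9 * x)] f) + ennreal (9 * x * m\<^sup>2) \<le> ennreal (1 + 6 * (9 * x)\<^sup>2 * m\<^sup>2 / b\<^sup>2)"
        unfolding u(1) by (rule ip_smooth_lag[OF u(2-4) _ b(1) _ far]) (use x m0 in auto)
      then have "ennreal I + ennreal (9 * x * m\<^sup>2) \<le> ennreal (1 + 6 * (9 * x)\<^sup>2 * m\<^sup>2 / b\<^sup>2)"
        unfolding I(3) .
      then have "ennreal (I + 9 * x * m\<^sup>2) \<le> ennreal (1 + 6 * (9 * x)\<^sup>2 * m\<^sup>2 / b\<^sup>2)"
        using I x by (subst ennreal_plus) auto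
      then have "I + 9 * x * m\<^sup>2 \<le> 1 + 6 * (9 * x)\<^sup>2 * m\<^sup>2 / b\<^sup>2"
        by (subst (asm) ennreal_le_iff) (auto intro!: add_nonneg_nonneg)
      then have "9 * x * m\<^sup>2 \<le> 9 * x * (D + 54 * x * m\<^sup>2 / b\<^sup>2)"
        unfolding D(2) by (simp add: algebra_simps power2_eq_square)
      then have "m\<^sup>2 \<le> D + 54 * x * m\<^sup>2 / b\<^sup>2" using x by simp
      also have "54 * x * m\<^sup>2 / b\<^sup>2 \<le> 54 * x * 1 / b\<^sup>2"
        using m1 m0 x by (intro divide_right_mono mult_left_mono) (auto simp: power_le_one)
      also have "54 * x * 1 / b\<^sup>2 < e1\<^sup>2"
      proof -
        have "54 * x * 1 < \<epsilon>^4 / 3600" using xe x by simp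
        then show ?thesis using b by (simp add: b_def e1_def field_simps power2_eq_square power4_eq_xxxx)
      qed
      finally have "m\<^sup>2 < D + e1\<^sup>2" by simp
      moreover have "m\<^sup>2 = D + 2 * sqrt D * e1 + e1\<^sup>2" using D by (simp add: m_def power2_sum)
      moreover have "0 \<le> 2 * sqrt D * e1" using D e1 by simp
      ultimately show False by linarith
    qed
  qed
  then obtain t where t: "0 < t" "t \<le> b" "D < 1/4 \<Longrightarrow> shift_dist u (t *\<^sub>R v) \<le> m * t" by blast
  define k where "k = nat \<lfloor>6 / t\<rfloor> + 1"
  have t1: "t \<le> 1" using t b by simp
  have kt: "real (k - 1) * t \<le> 6" "k > 0" using window_mean_bound(1,2)[OF t(1) t1 k_def, of 0 0] t by simp_all
  obtain w :: "nat \<Rightarrow> real" where w: "\<And>j. j < k \<Longrightarrow> 0 \<le> w j" "(\<Sum>j<k. w j) = 1"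
    "t / 2 * ((real k - 1) / 2 - shift_dist u (t *\<^sub>R v) * (((real k)\<^sup>2 - 1) / 6)) \<le> (\<Sum>j<k. w j * (real (k - 1 - j) * t / 2))"
    "ip f (smooth L f) \<le> (\<Sum>j<k. prin_eig L (window K v (real (k - 1 - j) * t / 2)) * ennreal (w j))"
    by (rule window_decomposition[OF f u kt(2) t(1) kt(1), where v=v and L=L]) (rule that, assumption+)
  define p where "p j = real (k - 1 - j) * t / 2" for j
  have p: "0 \<le> p j \<and> p j \<le> 3" for j
  proof -
    have "real (k - 1 - j) * t \<le> real (k - 1) * t" using t by (intro mult_right_mono) auto
    then have "real (k - 1 - j) * t \<le> 6" using kt by linarith
    then show ?thesis using t by (simp add: p_def)
  qed
  define E where "E = (\<Sum>j<k. w j * p j)"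
  have E0: "0 \<le> E" unfolding E_def using w p by (intro sum_nonneg mult_nonneg_nonneg) auto
  have S: "(\<Sum>j<k. w j * exp (- x * (p j - 1))) \<le> exp (- x * (E - 1) + 4 * x\<^sup>2)"
    unfolding E_def by (rule weighted_exp_le) (use w p x in auto)
  have "prin_eig L (window K v (p j)) \<le> ennreal (\<sigma> * exp (- x * (p j - 1)))" for j
    using p[of j] by (intro slope) auto
  then have "(\<Sum>j<k. prin_eig L (window K v (p j)) * ennreal (w j)) \<le> (\<Sum>j<k. ennreal (\<sigma> * exp (- x * (p j - 1))) * ennreal (w j))"
    by (intro sum_mono mult_right_mono) auto
  with w(4) have "ip f (smooth L f) \<le> (\<Sum>j<k. ennreal (\<sigma> * exp (- x * (p j - 1))) * ennreal (w j))"
    unfolding p_def by (rule order_trans)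
  also have "\<dots> = ennreal (\<sigma> * (\<Sum>j<k. w j * exp (- x * (p j - 1))))"
  proof -
    have "(\<Sum>j<k. ennreal (\<sigma> * exp (- x * (p j - 1))) * ennreal (w j)) = (\<Sum>j<k. ennreal (\<sigma> * (w j * exp (- x * (p j - 1)))))"
      by (intro sum.cong refl) (use \<sigma> w in \<open>simp add: ennreal_mult[symmetric] mult_ac\<close>)
    also have "\<dots> = ennreal (\<Sum>j<k. \<sigma> * (w j * exp (- x * (p j - 1))))"
      by (rule sum_ennreal) (use \<sigma> w in auto)
    finally show ?thesis by (simp only: sum_distrib_left)
  qed
  also have "\<dots> \<le> ennreal (\<sigma> * exp (- x * (E - 1) + 4 * x\<^sup>2))"
    using \<sigma> S by (intro ennreal_leI mult_left_mono)
  finally have J: "ip f (smooth L f) \<le> ennreal (\<sigma> * exp (- x * (E - 1) + 4 * x\<^sup>2))" .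
  have "I \<le> exp (- 9 * x * D)" using exp_ge_add_one_self[of "- 9 * x * D"] D by simp
  then have I': "?I \<le> ennreal (exp (- 9 * x * D))" unfolding I(3) by (rule ennreal_leI)
  have "- x * (E - 1) + 4 * x\<^sup>2 + - 9 * x * D \<le> - x / 4 + \<epsilon> * x"
  proof -
    have x2: "4 * x\<^sup>2 \<le> x * (\<epsilon> / 2)"
    proof -
      have "\<epsilon>^4 \<le> \<epsilon>" using \<epsilon> power_decreasing[of 1 4 \<epsilon>] by simp
      then have "4 * x \<le> \<epsilon> / 2" using xe x by simp
      then have "x * (4 * x) \<le> x * (\<epsilon> / 2)" using x by (intro mult_left_mono) auto
      then show ?thesis by (simp add: power2_eq_square mult_ac)
    qed
    have "- (E - 1) - 9 * D \<le> - 1 / 4 + \<epsilon> / 2"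
    proof (cases "D < 1/4")
      case False
      then show ?thesis using E0 \<epsilon> by simp
    next
      case True
      have sD: "0 \<le> sqrt D" "sqrt D \<le> 1/2" using True D real_sqrt_le_mono[of D "1/4"] by (simp_all add: real_sqrt_divide)
      have m1: "m \<le> 1" using sD \<epsilon> by (auto simp: m_def e1_def)
      \<comment> \<open>Up to the errors chosen above, the mean \<open>E\<close> is at least
        \<open>3/2 - 3 * sqrt D\<close>, so that adding the charge \<open>9 * D\<close> leaves a
        perfect square.\<close>
      have "3 / 2 - t / 4 - m * (3 + t) \<le> E"
        using window_mean_bound(3)[OF t(1) t1 k_def t(3)[OF True]] m0 w(3) by (simp add: E_def p_def)
      moreover have "m * t \<le> 1 * b" using m1 t m0 by (intro mult_mono) auto
      ultimately have "3 / 2 - b / 4 - 3 * m - b \<le> E" using t by (simp add: algebra_simps)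
      then have "- (E - 1) \<le> - 1 / 2 + 3 * sqrt D + \<epsilon> / 2" by (simp add: m_def e1_def b_def algebra_simps)
      moreover have "0 \<le> (3 * sqrt D - 1 / 2)\<^sup>2" by simp
      then have "3 * sqrt D \<le> 9 * D + 1 / 4" using D by (simp add: power2_diff power_mult_distrib power_divide)
      ultimately show ?thesis by linarith
    qed
    then have "x * (- (E - 1) - 9 * D) \<le> x * (- 1 / 4 + \<epsilon> / 2)" using x by (intro mult_left_mono) auto
    then show ?thesis using x2 by (simp add: algebra_simps)
  qed
  then have le: "\<sigma> * exp (- x * (E - 1) + 4 * x\<^sup>2 + - 9 * x * D) \<le> \<sigma> * exp (- x / 4 + \<epsilon> * x)"
    using \<sigma> by (intro mult_left_mono) auto
  have "ip f (smooth L f) * ?I \<le> ennreal (\<sigma> * exp (- x * (E - 1) + 4 * x\<^sup>2)) * ennreal (exp (- 9 * x * D))"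
    by (intro mult_mono J I') auto
  also have "\<dots> = ennreal (\<sigma> * exp (- x * (E - 1) + 4 * x\<^sup>2 + - 9 * x * D))"
    unfolding exp_add[of "- x * (E - 1) + 4 * x\<^sup>2" "- 9 * x * D"] using \<sigma> by (simp add: ennreal_mult[symmetric] mult_ac)
  also have "\<dots> \<le> ennreal (\<sigma> * exp (- x / 4 + \<epsilon> * x))" by (rule ennreal_leI[OF le])
  finally show ?thesis .
qed

text \<open>The weight \<open>9 * x / 2\<close> costs \<open>x / 8\<close> in the hypothesis, and
  squaring makes it \<open>x / 4\<close>. This cancels the gain in
  \<open>core_inequality_aux\<close>, so that only \<open>\<epsilon> * x\<close> is lost.\<close>

lemma core_inequality:
  fixes K :: "'a::euclidean_space set"
  assumes slope: "\<And>p. 0 \<le> p \<Longrightarrow> p \<le> 3 \<Longrightarrow> prin_eig L (window K v p) \<le> ennreal (\<sigma> * exp (- x * (p - 1)))"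
    and \<sigma>: "0 \<le> \<sigma>" and x: "0 < x" "x \<le> 1/4" and \<epsilon>: "0 < \<epsilon>" "\<epsilon> \<le> 1" and xe: "10^6 * x \<le> \<epsilon>^4"
    and H: "ennreal (exp (- c / 2 - x / 8)) \<le> prin_eig ((v, 9 * x / 2) # halve L) K"
  shows "exp (- c - \<epsilon> * x) \<le> \<sigma>"
proof -
  define B where "B = \<sigma> * exp (- x / 4 + \<epsilon> * x)"
  have B: "0 \<le> B" using \<sigma> by (simp add: B_def)
  have "ip f (smooth ((v, 9 * x / 2) # halve L) f) \<le> ennreal (sqrt B)" if f: "f \<in> unit_state K" for f
  proof (rule ennreal_power2_le_imp_le)
    have [measurable]: "f \<in> borel_measurable borel" using f by (auto simp: unit_state_def)
    have "(ip f (smooth ((v, 9 * x / 2) # halve L) f))\<^sup>2 \<le> ip f (smooth L f) * ip f (smooth [(v, 2 * (9 * x / 2))] f)"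
      by (rule ip_smooth_Cons_le) measurable
    also have "\<dots> \<le> ennreal B"
      using core_inequality_aux[OF f slope \<sigma> x \<epsilon> xe] by (simp add: B_def)
    also have "\<dots> = (ennreal (sqrt B))\<^sup>2" using B by (simp add: ennreal_power)
    finally show "(ip f (smooth ((v, 9 * x / 2) # halve L) f))\<^sup>2 \<le> (ennreal (sqrt B))\<^sup>2" .
  qed
  then have "prin_eig ((v, 9 * x / 2) # halve L) K \<le> ennreal (sqrt B)" unfolding prin_eig_def by (rule SUP_least)
  with H have "exp (- c / 2 - x / 8) \<le> sqrt B" using B by (simp add: order_trans[OF H] flip: ennreal_le_iff)
  then have "(exp (- c / 2 - x / 8))\<^sup>2 \<le> (sqrt B)\<^sup>2" by (intro power_mono) auto
  then have "exp (- c - x / 4) \<le> \<sigma> * exp (- x / 4 + \<epsilon> * x)"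
    using B by (simp add: B_def exp_double[symmetric] algebra_simps)
  then have "exp (- c - x / 4) * exp (x / 4 - \<epsilon> * x) \<le> \<sigma> * exp (- x / 4 + \<epsilon> * x) * exp (x / 4 - \<epsilon> * x)"
    by (rule mult_right_mono) simp
  then show ?thesis by (simp add: mult.assoc exp_add[symmetric])
qed

section \<open>Long chords, test states and the size of the slope\<close>

lemma long_chord_in_window:
  fixes K :: "'a::euclidean_space set"
  assumes H: "\<And>a. 0 \<le> a \<Longrightarrow> ennreal (exp (- a / 36)) \<le> prin_eig [(v, a)] K"
  shows "window K v (7/5) \<noteq> {}"
proof -
  \<comment> \<open>Any sufficiently small \<open>a\<close> serves: the energy along
    \<open>v\<close> is below \<open>3/100\<close>, a little more than \<open>1/36\<close>, whereas
    lags that move the state by \<open>t / 5\<close> would give about \<open>1/25\<close>.\<close>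
  define a :: real where "a = 1 / 10000"
  have "ennreal (1 - 3/100 * a) < ennreal (exp (- a / 36))"
    using exp_ge_add_one_self[of "- a / 36"] by (intro ennreal_lessI) (auto simp: a_def)
  also have "\<dots> \<le> prin_eig [(v, a)] K" by (rule H) (simp add: a_def)
  finally obtain f where f: "f \<in> unit_state K" "ennreal (1 - 3/100 * a) < ip f (smooth [(v, a)] f)"
    unfolding prin_eig_def by (auto simp: less_SUP_iff)
  obtain u M where u: "f = (\<lambda>y. ennreal (u y))" "\<And>y. 0 \<le> u y" "L2 u" "(\<integral>y. (u y)\<^sup>2 \<partial>lborel) = 1"
    and uK: "\<And>y. y \<notin> K \<Longrightarrow> u y = 0"
    using unit_stateE[OF f(1)] by metis
  have "\<exists>t. 0 < t \<and> t \<le> 1/10 \<and> shift_dist u (t *\<^sub>R v) < 1/5 * t"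
  proof (rule ccontr)
    assume "\<not> ?thesis"
    then have far: "1/5 * t \<le> shift_dist u (t *\<^sub>R v)" if "0 < t" "t \<le> 1/10" for t using that by (meson not_le)
    have "ip f (smooth [(v, a)] f) + ennreal (a * (1/5)\<^sup>2) \<le> ennreal (1 + 6 * a\<^sup>2 * (1/5)\<^sup>2 / (1/10)\<^sup>2)"
      unfolding u(1) by (rule ip_smooth_lag[OF u(2-4) _ _ _ far]) (auto simp: a_def)
    moreover have "ennreal (1 - 3/100 * a) + ennreal (a * (1/5)\<^sup>2) \<le> ip f (smooth [(v, a)] f) + ennreal (a * (1/5)\<^sup>2)"
      using f(2) by (intro add_right_mono) auto
    ultimately have "ennreal (1 - 3/100 * a) + ennreal (a * (1/5)\<^sup>2) \<le> ennreal (1 + 6 * a\<^sup>2 * (1/5)\<^sup>2 / (1/10)\<^sup>2)" by order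
    then have "ennreal (1 - 3/100 * a + a * (1/5)\<^sup>2) \<le> ennreal (1 + 6 * a\<^sup>2 * (1/5)\<^sup>2 / (1/10)\<^sup>2)"
      by (subst ennreal_plus) (auto simp: a_def)
    then show False by (subst (asm) ennreal_le_iff) (auto simp: a_def power2_eq_square)
  qed
  then obtain t where t: "0 < t" "t \<le> 1/10" "shift_dist u (t *\<^sub>R v) < 1/5 * t" by blast
  define n where "n = nat \<lfloor>3 / t\<rfloor>"
  have fl: "real_of_int \<lfloor>3 / t\<rfloor> \<le> 3 / t" "3 / t < real_of_int \<lfloor>3 / t\<rfloor> + 1" by linarith+
  have n: "real n = real_of_int \<lfloor>3 / t\<rfloor>" using t by (simp add: n_def)
  have "real n * t \<le> 3 / t * t" unfolding n using fl t by (intro mult_right_mono) auto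
  then have nt: "real n * t \<le> 3" using t by simp
  have "3 / t * t < (real n + 1) * t" unfolding n using fl t by (intro mult_strict_right_mono) auto
  then have nt': "29/10 \<le> real n * t" using t by (simp add: algebra_simps)
  \<comment> \<open>The multiple \<open>real n * t\<close> lies between 2.9 and 3, and a shift
    distance of at most 1 leaves an autocorrelation of at least 1/2. Hence two points of
    \<open>K\<close> differ by this multiple of \<open>v\<close>, and their midpoint is the centre
    of the window.\<close>
  let ?z = "real n *\<^sub>R (t *\<^sub>R v)"
  have "shift_dist u ?z \<le> real n * shift_dist u (t *\<^sub>R v)" by (rule shift_dist_multiple[OF u(3)])
  also have "\<dots> \<le> real n * (1/5 * t)" using t by (intro mult_left_mono) auto
  also have "\<dots> \<le> 1" using nt by simp
  finally have "(shift_dist u ?z)\<^sup>2 \<le> 1" using shift_dist_nonneg[of u ?z] by (simp add: power_le_one)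
  then have pos: "0 < (\<integral>y. u y * u (y + ?z) \<partial>lborel)" using shift_dist_square[OF u(3,4), of ?z] by linarith
  obtain y where "u y * u (y + ?z) \<noteq> 0"
  proof (rule ccontr)
    assume "\<not> thesis"
    then have "u y * u (y + ?z) = 0" for y using that by blast
    then have "(\<integral>y. u y * u (y + ?z) \<partial>lborel) = (\<integral>y. 0 \<partial>(lborel :: 'a measure))"
      by (intro Bochner_Integration.integral_cong) auto
    then show False using pos by simp
  qed
  then have y: "y \<in> K" "y + ?z \<in> K" using uK by (metis mult_eq_0_iff)+
  define h where "h = real n * t / 2"
  have "(y + h *\<^sub>R v) + (- h) *\<^sub>R v \<in> K" "(y + h *\<^sub>R v) + h *\<^sub>R v \<in> K"
    using y by (simp_all add: h_def scaleR_add_left[symmetric] add.assoc mult.commute)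
  moreover have "- h \<in> {-3..3}" "h \<in> {-3..3}" "2 * (7/5) \<le> h - - h"
  proof -
    have "h \<le> 3/2" "7/5 \<le> h" using nt nt' unfolding h_def by linarith+
    then show "- h \<in> {-3..3}" "h \<in> {-3..3}" "2 * (7/5) \<le> h - - h" by auto
  qed
  ultimately have "y + h *\<^sub>R v \<in> window K v (7/5)" unfolding window_def by blast
  then show ?thesis by auto
qed


text \<open>The state \<open>f\<close> is used as a test function. The displayed sum is the second
  moment of the Gaussian law, so the quadratic lower bound for the autocorrelation integrates to the
  claim.\<close>

lemma prin_eig_ge_of_autocorr:
  assumes f: "f \<in> unit_state K" and C: "0 \<le> C" and le: "\<And>z. ennreal (1 - C * (norm z)\<^sup>2) \<le> autocorr f z"
    and L: "\<And>p. p \<in> set L \<Longrightarrow> 0 \<le> snd p"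
  shows "ennreal (1 - C * (\<Sum>p\<leftarrow>L. 2 * snd p * (norm (fst p))\<^sup>2)) \<le> prin_eig L K"
proof -
  let ?S = "\<Sum>p\<leftarrow>L. 2 * snd p * (norm (fst p))\<^sup>2"
  have [measurable]: "f \<in> borel_measurable borel" using f by (auto simp: unit_state_def)
  have S0: "0 \<le> ?S" using L by (intro sum_list_nonneg) fastforce
  have pt: "1 \<le> autocorr f z + ennreal C * ennreal ((norm z)\<^sup>2)" for z
  proof -
    have "1 = ennreal 1" by simp
    also have "\<dots> \<le> ennreal (max 0 (1 - C * (norm z)\<^sup>2) + C * (norm z)\<^sup>2)" by (intro ennreal_leI) simp
    also have "\<dots> = ennreal (1 - C * (norm z)\<^sup>2) + ennreal C * ennreal ((norm z)\<^sup>2)"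
      using C by (subst ennreal_plus) (auto simp: ennreal_mult max_def ennreal_neg)
    also have "\<dots> \<le> autocorr f z + ennreal C * ennreal ((norm z)\<^sup>2)" by (intro add_right_mono le)
    finally show ?thesis .
  qed
  have "1 = (\<integral>\<^sup>+z. 1 \<partial>gauss_law L)" by (rule nn_integral_gauss_law_const[symmetric])
  also have "\<dots> \<le> (\<integral>\<^sup>+z. autocorr f z + ennreal C * ennreal ((norm z)\<^sup>2) \<partial>gauss_law L)" by (intro nn_integral_mono pt)
  also have "\<dots> = (\<integral>\<^sup>+z. autocorr f z \<partial>gauss_law L) + ennreal C * (\<integral>\<^sup>+z. ennreal ((norm z)\<^sup>2) \<partial>gauss_law L)"
    by (subst nn_integral_add, measurable, subst nn_integral_cmult, measurable)
  also have "\<dots> = ip f (smooth L f) + ennreal (C * ?S)"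
    using L C S0 by (subst nn_integral_gauss_law_norm_square) (auto simp: ip_smooth_autocorr ennreal_mult)
  also have "\<dots> \<le> prin_eig L K + ennreal (C * ?S)"
    unfolding prin_eig_def by (intro add_right_mono SUP_upper f)
  finally have le: "1 \<le> prin_eig L K + ennreal (C * ?S)" .
  obtain r where r: "0 \<le> r" "prin_eig L K = ennreal r" by (rule prin_eig_real)
  have "ennreal 1 \<le> ennreal (r + C * ?S)" using le r C S0 by (simp add: ennreal_plus)
  then have "1 \<le> r + C * ?S" using r C S0 by (subst (asm) ennreal_le_iff) auto
  then show ?thesis unfolding r(2) by (intro ennreal_leI) simp
qed

text \<open>A normalised tent on a ball inside \<open>W\<close> serves as test state. The constant
  depends only on \<open>W\<close>, so the distance of the eigenvalue from 1 is at most linear in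
  the weights as these are scaled down.\<close>

lemma prin_eig_open_ge:
  fixes W :: "'a::euclidean_space set"
  assumes "open W" "W \<noteq> {}"
  obtains C where "0 \<le> C"
    "\<And>L. (\<And>p. p \<in> set L \<Longrightarrow> 0 \<le> snd p) \<Longrightarrow> ennreal (1 - C * (\<Sum>p\<leftarrow>L. 2 * snd p * (norm (fst p))\<^sup>2)) \<le> prin_eig L W"
proof -
  obtain y0 R where R: "0 < R" "ball y0 R \<subseteq> W" using assms by (meson openE ex_in_conv)
  define \<psi> where "\<psi> y = max 0 (R - dist y0 y)" for y
  let ?B = "ball y0 R" and ?V = "measure lborel (ball y0 R)"
  have [measurable]: "\<psi> \<in> borel_measurable borel"
    unfolding \<psi>_def[abs_def] by (intro borel_measurable_continuous_onI continuous_intros)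
  have \<psi>0: "0 \<le> \<psi> y" "\<psi> y \<le> R" for y using R by (auto simp: \<psi>_def)
  have \<psi>B: "\<psi> y = 0" if "y \<notin> ?B" for y using that by (auto simp: \<psi>_def)
  have iB: "integrable lborel (\<lambda>y. indicator ?B y :: real)"
    by (rule integrable_real_indicator) (use emeasure_lborel_ball_finite in auto)
  have i\<psi>: "integrable lborel (\<lambda>y. (\<psi> y)\<^sup>2)"
  proof (rule Bochner_Integration.integrable_bound[where f="\<lambda>y. R\<^sup>2 * indicator ?B y"])
    show "AE y in lborel. norm ((\<psi> y)\<^sup>2) \<le> norm (R\<^sup>2 * indicator ?B y)"
    proof (rule AE_I2)
      fix y show "norm ((\<psi> y)\<^sup>2) \<le> norm (R\<^sup>2 * indicator ?B y)"
        using \<psi>0[of y] \<psi>B[of y] by (cases "y \<in> ?B") (auto intro!: power_mono)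
    qed
  qed (use iB in auto)
  define N where "N = (\<integral>y. (\<psi> y)\<^sup>2 \<partial>lborel)"
  have N: "0 < N"
  proof -
    have "0 < (R/2)\<^sup>2 * measure lborel (ball y0 (R/2))"
      using R content_ball_pos[of "R/2" y0] by simp
    also have "\<dots> = (\<integral>y. (R/2)\<^sup>2 * indicator (ball y0 (R/2)) y \<partial>lborel)" by simp
    also have "\<dots> \<le> N" unfolding N_def
    proof (rule integral_mono[OF _ i\<psi>])
      show "integrable lborel (\<lambda>y. (R/2)\<^sup>2 * indicator (ball y0 (R/2)) y)"
        by (intro integrable_mult_right integrable_real_indicator) (use emeasure_lborel_ball_finite in auto)
      fix y
      show "(R/2)\<^sup>2 * indicator (ball y0 (R/2)) y \<le> (\<psi> y)\<^sup>2"
        using R by (cases "y \<in> ball y0 (R/2)") (auto simp: \<psi>_def intro!: power_mono)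
    qed
    finally show ?thesis .
  qed
  define u where "u y = \<psi> y / sqrt N" for y
  have u0: "0 \<le> u y" for y using \<psi>0 N by (simp add: u_def)
  have uL: "L2 u" using i\<psi> by (simp add: L2_def u_def[abs_def] power_divide)
  have u1: "(\<integral>y. (u y)\<^sup>2 \<partial>lborel) = 1" using N by (simp add: u_def power_divide N_def[symmetric])
  define C where "C = ?V / N"
  have C0: "0 \<le> C" using N by (simp add: C_def)
  have sd: "(shift_dist u z)\<^sup>2 \<le> 2 * (C * (norm z)\<^sup>2)" for z
  proof -
    \<comment> \<open>The tent is 1-Lipschitz, and a difference of its values vanishes unless one of
      the two points lies in the ball.\<close>
    have lip: "(\<psi> (y + z) - \<psi> y)\<^sup>2 \<le> (norm z)\<^sup>2 * (indicator ?B (y + z) + indicator ?B y)" for y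
    proof (cases "y + z \<in> ?B \<or> y \<in> ?B")
      case True
      have "\<bar>\<psi> (y + z) - \<psi> y\<bar> \<le> norm z"
        using dist_triangle[of y0 "y + z" y] dist_triangle[of y0 y "y + z"] by (auto simp: \<psi>_def dist_norm norm_minus_commute)
      then have "(\<psi> (y + z) - \<psi> y)\<^sup>2 \<le> (norm z)\<^sup>2 * 1" using power_mono[of "\<bar>\<psi> (y + z) - \<psi> y\<bar>" "norm z" 2] by simp
      also have "\<dots> \<le> (norm z)\<^sup>2 * (indicator ?B (y + z) + indicator ?B y)"
        using True by (intro mult_left_mono) (auto simp: indicator_def)
      finally show ?thesis .
    next
      case False
      then show ?thesis using \<psi>B by simp
    qed
    note t = lborel_translate[OF iB, of z]
    have L: "L2 (\<lambda>y. \<psi> y)" using i\<psi> by (simp add: L2_def)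
    have "(shift_dist u z)\<^sup>2 = (\<integral>y. (\<psi> (y + z) - \<psi> y)\<^sup>2 / N \<partial>lborel)"
      unfolding shift_dist_def norm_L2_square u_def using N by (simp add: diff_divide_distrib[symmetric] power_divide)
    also have "\<dots> \<le> (\<integral>y. (norm z)\<^sup>2 * (indicator ?B (y + z) + indicator ?B y) / N \<partial>lborel)"
    proof (rule integral_mono)
      show "integrable lborel (\<lambda>y. (\<psi> (y + z) - \<psi> y)\<^sup>2 / N)"
        using L2_diff[OF L2_translate[OF L] L, of z] by (auto simp: L2_def)
    qed (use iB t lip N in \<open>auto intro!: divide_right_mono\<close>)
    also have "\<dots> = (norm z)\<^sup>2 * (2 * ?V) / N"
      using iB t by simp
    finally show ?thesis by (simp add: C_def mult_ac)
  qed
  let ?f = "\<lambda>y. ennreal (u y)"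
  have [measurable]: "u \<in> borel_measurable borel" using uL by (auto simp: L2_def)
  have unit_state: "?f \<in> unit_state W"
  proof -
    have "u y \<le> R / sqrt N" for y unfolding u_def using \<psi>0 N by (intro divide_right_mono) auto
    then have "\<forall>y. ?f y \<le> ennreal (R / sqrt N)" by (auto intro: ennreal_leI)
    moreover have "u y = 0" if "y \<notin> W" for y
    proof -
      have "y \<notin> ball y0 R" using that R by blast
      then show ?thesis using \<psi>B[of y] by (simp add: u_def)
    qed
    moreover have "ip ?f ?f = ennreal (\<integral>y. (u y)\<^sup>2 \<partial>lborel)"
      using uL u0 by (subst nn_integral_eq_integral[symmetric]) (auto simp: L2_def ennreal_mult power2_eq_square)
    ultimately show ?thesis using u1 by (auto simp: unit_state_def)
  qed
  have "ennreal (1 - C * (norm z)\<^sup>2) \<le> autocorr ?f z" for z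
    unfolding autocorr_shift_dist[OF u0 uL u1] using sd[of z] by (intro ennreal_leI) simp
  from that[OF C0 prin_eig_ge_of_autocorr[OF unit_state C0 this]] show ?thesis .
qed

text \<open>\<open>x\<close> is the supremum of the negated secant slopes of \<open>ln r\<close>
  from points in \<open>{0..<1}\<close> to 1, so \<open>- x\<close> is a supergradient there. The
  secant from 1 to \<open>7/5\<close> bounds it and accounts for the factor \<open>5/2\<close>.
  Further out \<open>r\<close> may vanish, so logarithms are taken only where it is
  positive.\<close>

lemma log_concave_slope:
  fixes r :: "real \<Rightarrow> real"
  assumes lc: "log_concave (\<lambda>p. ennreal (r p))" and r: "\<And>p. 0 \<le> r p" "\<And>p. r p \<le> 1"
    and anti: "\<And>p q. p \<le> q \<Longrightarrow> r q \<le> r p" and pos: "0 < r (7/5)"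
  obtains x where "0 \<le> x" "x \<le> - (5/2) * ln (r (7/5))"
    "\<And>p. 0 \<le> p \<Longrightarrow> r p \<le> r 1 * exp (- x * (p - 1))"
proof -
  have r1: "0 < r 1" using pos anti[of 1 "7/5"] by simp
  have rp: "0 < r p" if "p \<le> 1" for p using r1 anti[OF that] by simp
  define s where "s p = (ln (r p) - ln (r 1)) / (1 - p)" for p
  have le: "s p \<le> (ln (r 1) - ln (r q)) / (q - 1)" if pq: "p < 1" "1 < q" "0 < r q" for p q
  proof -
    define m where "m = (1 - p) / (q - p)"
    have m: "0 < m" "m < 1" using pq by (auto simp: m_def)
    have mid: "(1 - m) * p + m * q = 1"
    proof -
      have "m * (q - p) = 1 - p" using pq by (simp add: m_def)
      then show ?thesis by (simp add: algebra_simps)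
    qed
    have "ennreal (r p powr (1 - m) * r q powr m) \<le> ennreal (r ((1 - m) *\<^sub>R p + m *\<^sub>R q))"
      by (rule log_concaveD[OF lc m]) (use rp pq in auto)
    then have "r p powr (1 - m) * r q powr m \<le> r 1" using mid r by simp
    then have "ln (r p powr (1 - m) * r q powr m) \<le> ln (r 1)" using rp[of p] pq r1 by (subst ln_le_cancel_iff) auto
    then have "(1 - m) * ln (r p) + m * ln (r q) \<le> ln (r 1)" using rp[of p] pq by (simp add: ln_mult ln_powr)
    then have "(q - p) * ((1 - m) * ln (r p) + m * ln (r q)) \<le> (q - p) * ln (r 1)" using pq by (intro mult_left_mono) auto
    moreover have qm: "(q - p) * m = 1 - p" using pq by (simp add: m_def)
    then have "(q - p) * (1 - m) = q - 1" by (simp add: right_diff_distrib)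
    with qm have "(q - p) * ((1 - m) * ln (r p) + m * ln (r q)) = (q - 1) * ln (r p) + (1 - p) * ln (r q)"
      by (simp only: distrib_left mult.assoc[symmetric])
    ultimately have "(ln (r p) - ln (r 1)) * (q - 1) \<le> (ln (r 1) - ln (r q)) * (1 - p)" by (simp add: algebra_simps)
    then show ?thesis unfolding s_def using pq by (simp add: divide_le_eq le_divide_eq mult_ac)
  qed
  define x where "x = (SUP p\<in>{0..<1}. s p)"
  have bdd: "bdd_above (s ` {0..<1})"
    by (rule bdd_aboveI2[where M="(ln (r 1) - ln (r (7/5))) / (7/5 - 1)"]) (use le[of _ "7/5"] pos in auto)
  have xq: "x \<le> (ln (r 1) - ln (r q)) / (q - 1)" if "1 < q" "0 < r q" for q
    unfolding x_def by (rule cSUP_least) (use le that in auto)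
  have xs: "s p \<le> x" if "0 \<le> p" "p < 1" for p
    unfolding x_def by (rule cSUP_upper[OF _ bdd]) (use that in auto)
  have "0 \<le> s 0" unfolding s_def using anti[of 0 1] r1 rp[of 0] by simp
  then have x0: "0 \<le> x" using xs[of 0] by simp
  have "ln (r 1) \<le> 0" using r(2)[of 1] r1 by simp
  then have x1: "x \<le> - (5/2) * ln (r (7/5))" using xq[of "7/5"] pos by simp
  have "r p \<le> r 1 * exp (- x * (p - 1))" if p: "0 \<le> p" for p
  proof -
    consider "p < 1" | "p = 1" | "1 < p" "r p = 0" | "1 < p" "0 < r p" using r(1)[of p] by fastforce
    then show ?thesis
    proof cases
      case 1
      then have "ln (r p) - ln (r 1) \<le> x * (1 - p)" using xs[of p] p by (simp add: s_def divide_le_eq)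
      then have "exp (ln (r p)) \<le> exp (ln (r 1) + - x * (p - 1))" by (simp add: algebra_simps)
      then show ?thesis using 1 rp[of p] r1 by (simp only: exp_add exp_ln)
    next
      case 4
      then have "x * (p - 1) \<le> ln (r 1) - ln (r p)" using xq[of p] by (simp add: le_divide_eq)
      then have "exp (ln (r p)) \<le> exp (ln (r 1) + - x * (p - 1))" by simp
      then show ?thesis using 4 r1 by (simp only: exp_add exp_ln)
    qed (use r1 in auto)
  qed
  then show ?thesis using that x0 x1 by blast
qed


section \<open>Eliminating one vector\<close>

definition komlos_class :: "'a::euclidean_space set \<Rightarrow> 'a set \<Rightarrow> bool" where
  "komlos_class V K \<longleftrightarrow> (\<forall>L. (\<forall>p\<in>set L. fst p \<in> V \<and> 0 \<le> snd p) \<longrightarrow> ennreal (exp (- cost L / 36)) \<le> prin_eig L K)"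

lemma halve_pow:
  assumes "\<forall>p\<in>set L. fst p \<in> V \<and> 0 \<le> snd p"
  shows "\<forall>p\<in>set ((halve ^^ m) L). fst p \<in> V \<and> 0 \<le> snd p"
  using assms by (induction m) (force simp: halve_def)+

lemma sum_list_halve: "(\<Sum>p\<leftarrow>halve L. snd p * g (fst p)) = (\<Sum>p\<leftarrow>L. snd p * g (fst p)) / 2" for g :: "'a \<Rightarrow> real"
  by (induction L) (auto simp: halve_def)

lemma sum_list_halve_pow: "(\<Sum>p\<leftarrow>(halve ^^ m) L. snd p * g (fst p)) = (\<Sum>p\<leftarrow>L. snd p * g (fst p)) / 2 ^ m" for g :: "'a \<Rightarrow> real"
  by (induction m) (auto simp: sum_list_halve)

lemma cost_halve: "cost (halve L) = cost L / 2"
  using sum_list_halve[of "\<lambda>_. 1"] by simp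

lemma cost_halve_pow: "cost ((halve ^^ m) L) = cost L / 2 ^ m"
  using sum_list_halve_pow[of "\<lambda>_. 1"] by simp

lemma prin_eig_halve_pow: "(prin_eig ((halve ^^ m) L) K) ^ (2 ^ m) \<le> prin_eig L K"
proof (induction m)
  case (Suc m)
  have "(prin_eig ((halve ^^ Suc m) L) K) ^ (2 ^ Suc m) = ((prin_eig (halve ((halve ^^ m) L)) K)\<^sup>2) ^ (2 ^ m)"
    by (simp add: power_mult[symmetric])
  also have "\<dots> \<le> (prin_eig ((halve ^^ m) L) K) ^ (2 ^ m)" by (intro power_mono prin_eig_halve) simp
  also note Suc
  finally show ?case .
qed simp

text \<open>Raising to the power \<open>2 ^ m\<close> undoes the scaling. An error of
  \<open>\<epsilon> / 2 ^ m\<close> in the exponent becomes \<open>\<epsilon>\<close>, which is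
  arbitrary.\<close>

lemma prin_eig_ge_of_halve_pow:
  assumes "\<And>\<epsilon>. 0 < \<epsilon> \<Longrightarrow> \<exists>m. ennreal (exp (- (c + \<epsilon>) / 2 ^ m)) \<le> prin_eig ((halve ^^ m) L) K"
  shows "ennreal (exp (- c)) \<le> prin_eig L K"
proof -
  obtain r where r: "0 \<le> r" "prin_eig L K = ennreal r" by (rule prin_eig_real)
  have "z * exp (- c) \<le> r" if z: "0 < z" "z < 1" for z
  proof -
    obtain m where m: "ennreal (exp (- (c + (1 - z)) / 2 ^ m)) \<le> prin_eig ((halve ^^ m) L) K"
      using assms[of "1 - z"] z by auto
    have "exp (- (c + (1 - z))) = exp (- (c + (1 - z)) / 2 ^ m) ^ (2 ^ m)"
      by (simp add: exp_of_nat_mult[symmetric])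
    then have "ennreal (exp (- (c + (1 - z)))) = ennreal (exp (- (c + (1 - z)) / 2 ^ m)) ^ (2 ^ m)"
      by (simp add: ennreal_power)
    also have "\<dots> \<le> (prin_eig ((halve ^^ m) L) K) ^ (2 ^ m)" by (rule power_mono[OF m]) simp
    also have "\<dots> \<le> prin_eig L K" by (rule prin_eig_halve_pow)
    finally have "exp (- (c + (1 - z))) \<le> r" using r by simp
    moreover have "z \<le> exp (- (1 - z))" using exp_ge_add_one_self[of "- (1 - z)"] by simp
    then have "z * exp (- c) \<le> exp (- (1 - z)) * exp (- c)" by (intro mult_right_mono) auto
    then have "z * exp (- c) \<le> exp (- (c + (1 - z)))" by (simp add: exp_add[symmetric] add_ac)
    ultimately show ?thesis by simp
  qed
  then have "exp (- c) \<le> r" by (rule field_le_mult_one_interval)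
  then show ?thesis using r by (simp add: ennreal_leI)
qed

lemma exists_large_power_2: "\<exists>m. (B::real) / 2 ^ m \<le> \<eta>" if "0 < \<eta>"
proof -
  obtain m where "B / \<eta> < 2 ^ m" using real_arch_pow[of 2 "B / \<eta>"] by auto
  then have "B / 2 ^ m \<le> \<eta>" using that by (simp add: field_simps)
  then show ?thesis by blast
qed

text \<open>For the \<open>m\<close>-fold halved list the slope \<open>x\<close> at
  \<open>p = 1\<close> is at most of order \<open>1 / 2 ^ m\<close>. The loss
  \<open>\<epsilon> * x\<close> in \<open>core_inequality\<close> is then a small multiple of the
  scale, and \<open>prin_eig_ge_of_halve_pow\<close> removes it.\<close>

theorem komlos_class_window:
  fixes K :: "'a::euclidean_space set"
  assumes K: "open K" "convex K" "bounded K" and cls: "komlos_class (insert v V) K"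
  shows "komlos_class V (window K v 1)"
  unfolding komlos_class_def
proof (intro allI impI)
  fix L :: "('a \<times> real) list"
  assume L: "\<forall>p\<in>set L. fst p \<in> V \<and> 0 \<le> snd p"
  have open_w: "open (window K v p)" for p by (rule open_window[OF K(1)])
  \<comment> \<open>A nonempty open window set at a parameter beyond 1 has an eigenvalue close to 1
    for small weights, and this controls the slope at 1.\<close>
  have "window K v (7/5) \<noteq> {}"
    by (rule long_chord_in_window) (use cls[unfolded komlos_class_def, rule_format, of "[(v, a)]" for a] in auto)
  then obtain C where C: "0 \<le> C"
    "\<And>L. (\<And>p. p \<in> set L \<Longrightarrow> 0 \<le> snd p) \<Longrightarrow> ennreal (1 - C * (\<Sum>p\<leftarrow>L. 2 * snd p * (norm (fst p))\<^sup>2)) \<le> prin_eig L (window K v (7/5))"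
    using prin_eig_open_ge[OF open_w] by blast
  define S where "S = C * (\<Sum>p\<leftarrow>L. 2 * snd p * (norm (fst p))\<^sup>2)"
  have S0: "0 \<le> S" unfolding S_def using C(1) L by (intro mult_nonneg_nonneg sum_list_nonneg) auto
  have "ennreal (exp (- (cost L / 36))) \<le> prin_eig L (window K v 1)"
  proof (rule prin_eig_ge_of_halve_pow)
    fix \<epsilon>' :: real assume \<epsilon>': "0 < \<epsilon>'"
    \<comment> \<open>Together with \<open>x \<le> 5 * S / 2 ^ m\<close>, proved further down, this
      choice gives \<open>\<epsilon> * x \<le> \<epsilon>' / 2 ^ m\<close>.\<close>
    define \<epsilon> where "\<epsilon> = min 1 (\<epsilon>' / (5 * S + 1))"
    have \<epsilon>: "0 < \<epsilon>" "\<epsilon> \<le> 1" using \<epsilon>' S0 by (auto simp: \<epsilon>_def)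
    have \<epsilon>S: "\<epsilon> * (5 * S) \<le> \<epsilon>'"
    proof -
      have "\<epsilon> * (5 * S) \<le> \<epsilon>' / (5 * S + 1) * (5 * S + 1)" using S0 \<epsilon> \<epsilon>' by (intro mult_mono) (auto simp: \<epsilon>_def)
      then show ?thesis using S0 by simp
    qed
    \<comment> \<open>\<open>m\<close> is chosen for the smallness hypothesis
      \<open>10^6 * x \<le> \<epsilon>^4\<close> of \<open>core_inequality\<close>.\<close>
    have "0 < \<epsilon>^4 / 10^6" using \<epsilon> by simp
    from exists_large_power_2[OF this, of "5 * S"]
    obtain m where m: "5 * S / 2 ^ m \<le> \<epsilon>^4 / 10^6" by blast
    define Lm where "Lm = (halve ^^ m) L"
    define y where "y = S / 2 ^ m"
    have Lm: "\<forall>p\<in>set Lm. fst p \<in> V \<and> 0 \<le> snd p" unfolding Lm_def by (rule halve_pow[OF L])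
    have "\<epsilon>^4 \<le> 1" using \<epsilon> by (simp add: power_le_one)
    moreover have "5 * y \<le> \<epsilon>^4 / 10^6" using m by (simp add: y_def)
    moreover have "0 \<le> y" using S0 by (simp add: y_def)
    ultimately have y: "0 \<le> y" "y \<le> 1/100" "10^6 * (5 * y) \<le> \<epsilon>^4" by simp_all
    define r where "r p = enn2real (prin_eig Lm (window K v p))" for p
    have rr: "prin_eig Lm (window K v p) = ennreal (r p)" for p
      by (rule prin_eig_real[of Lm "window K v p"]) (simp add: r_def)
    have r01: "0 \<le> r p" "r p \<le> 1" for p using prin_eig_le_1[of Lm "window K v p"] by (simp_all add: r_def[of p] flip: rr) (simp add: rr)
    have anti: "r q \<le> r p" if "p \<le> q" for p q
      using prin_eig_mono[OF window_antimono[OF that], of Lm K v] r01(1)[of p] by (simp add: rr)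
    have r75: "1 - y \<le> r (7/5)"
    proof -
      have "(\<Sum>p\<leftarrow>Lm. 2 * snd p * (norm (fst p))\<^sup>2) = (\<Sum>p\<leftarrow>L. 2 * snd p * (norm (fst p))\<^sup>2) / 2 ^ m"
        using sum_list_halve_pow[of "\<lambda>v. 2 * (norm v)\<^sup>2" m L] by (simp add: Lm_def mult_ac)
      then have "ennreal (1 - y) \<le> prin_eig Lm (window K v (7/5))"
        using C(2)[of Lm] Lm by (simp add: y_def S_def)
      then show ?thesis using r01(1)[of "7/5"] by (simp add: rr)
    qed
    have lc: "log_concave (\<lambda>p. ennreal (r p))"
      unfolding rr[symmetric]
    proof (rule log_concave_prin_eig[OF convex_window_graph[OF K(2)]])
      show "window K v p \<in> sets borel" for p using open_w[of p] by simp
      show "emeasure lborel (window K v p) < top" for p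
        using emeasure_bounded_finite[OF bounded_window[OF K(3)], of v p] by simp
    qed
    obtain x where x: "0 \<le> x" "x \<le> - (5/2) * ln (r (7/5))" "\<And>p. 0 \<le> p \<Longrightarrow> r p \<le> r 1 * exp (- x * (p - 1))"
      by (rule log_concave_slope[OF lc r01 anti]) (use r75 y in auto)
    \<comment> \<open>Since \<open>r (7/5) \<ge> 1 - y\<close>, the slope is at most
      \<open>5/2\<close> times \<open>- ln (1 - y)\<close>, and the latter is at most
      \<open>2 * y\<close>.\<close>
    have x5: "x \<le> 5 * y"
    proof -
      have "y * y \<le> y * (1/2)" using y by (intro mult_left_mono) auto
      then have "y\<^sup>2 \<le> y * (1/2)" by (simp add: power2_eq_square)
      then have "- 2 * y \<le> - y - 2 * y\<^sup>2" by simp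
      also have "\<dots> \<le> ln (1 - y)" using y by (intro ln_one_minus_pos_lower_bound) auto
      also have "\<dots> \<le> ln (r (7/5))" using r75 y by simp
      finally show ?thesis using x(2) by simp
    qed
    have "exp (- (cost L / 36) / 2 ^ m - \<epsilon> * x) \<le> r 1"
    \<comment> \<open>Slope 0 would put no weight on \<open>v\<close>, and
      \<open>core_inequality\<close> asks for a positive one. In this case the eigenvalue at 1 is at
      least the one at 0, where the window set contains \<open>K\<close>.\<close>
    proof (cases "x = 0")
      case True
      have sub: "K \<subseteq> window K v 0"
      proof
        fix z assume "z \<in> K"
        then have "z + (0::real) *\<^sub>R v \<in> K" by simp
        then show "z \<in> window K v 0" unfolding window_def by (intro CollectI bexI[of _ 0]) auto
      qed
      have "ennreal (exp (- cost Lm / 36)) \<le> prin_eig Lm K"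
        using cls Lm unfolding komlos_class_def by blast
      also have "\<dots> \<le> prin_eig Lm (window K v 0)" by (rule prin_eig_mono[OF sub])
      finally have "exp (- cost Lm / 36) \<le> r 0" using r01(1)[of 0] by (simp add: rr)
      also have "\<dots> \<le> r 1" using x(3)[of 0] True by simp
      finally show ?thesis using True by (simp add: Lm_def cost_halve_pow mult.commute)
    next
      case False
      have "exp (- (cost L / 36 / 2 ^ m) - \<epsilon> * x) \<le> r 1"
      proof (rule core_inequality[where L=Lm and v=v and K=K])
        show "prin_eig Lm (window K v p) \<le> ennreal (r 1 * exp (- x * (p - 1)))" if "0 \<le> p" for p
          unfolding rr by (rule ennreal_leI[OF x(3)[OF that]])
        have "\<forall>p\<in>set ((v, 9 * x / 2) # halve Lm). fst p \<in> insert v V \<and> 0 \<le> snd p"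
          using halve_pow[OF Lm, of 1] x(1) by auto
        then have "ennreal (exp (- cost ((v, 9 * x / 2) # halve Lm) / 36)) \<le> prin_eig ((v, 9 * x / 2) # halve Lm) K"
          using cls unfolding komlos_class_def by blast
        moreover have "- cost ((v, 9 * x / 2) # halve Lm) / 36 = - (cost L / 36 / 2 ^ m) / 2 - x / 8"
          by (simp add: cost_halve Lm_def cost_halve_pow field_simps)
        ultimately show "ennreal (exp (- (cost L / 36 / 2 ^ m) / 2 - x / 8)) \<le> prin_eig ((v, 9 * x / 2) # halve Lm) K"
          by (simp only:)
      qed (use False x x5 y \<epsilon> r01 in auto)
      then show ?thesis by simp
    qed
    moreover have "- (cost L / 36 + \<epsilon>') / 2 ^ m \<le> - (cost L / 36) / 2 ^ m - \<epsilon> * x"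
    proof -
      have "\<epsilon> * x \<le> \<epsilon> * (5 * y)" using x5 \<epsilon> by (intro mult_left_mono) auto
      also have "\<dots> = \<epsilon> * (5 * S) / 2 ^ m" by (simp add: y_def)
      also have "\<dots> \<le> \<epsilon>' / 2 ^ m" using \<epsilon>S by (intro divide_right_mono) auto
      finally show ?thesis by (simp add: add_divide_distrib diff_divide_distrib)
    qed
    ultimately have "exp (- (cost L / 36 + \<epsilon>') / 2 ^ m) \<le> r 1" by (meson exp_le_cancel_iff order_trans)
    then have "ennreal (exp (- (cost L / 36 + \<epsilon>') / 2 ^ m)) \<le> prin_eig Lm (window K v 1)" unfolding rr by (rule ennreal_leI)
    then show "\<exists>m. ennreal (exp (- (cost L / 36 + \<epsilon>') / 2 ^ m)) \<le> prin_eig ((halve ^^ m) L) (window K v 1)"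
      unfolding Lm_def by blast
  qed
  then show "ennreal (exp (- cost L / 36)) \<le> prin_eig L (window K v 1)" by simp
qed

section \<open>Recovering the signs\<close>

lemma komlos_class_nonempty:
  assumes "komlos_class V K"
  shows "K \<noteq> {}"
proof
  assume "K = {}"
  have "ennreal (exp (- cost [] / 36)) \<le> prin_eig [] K"
    using assms[unfolded komlos_class_def, rule_format, of "[]"] by simp
  then have "unit_state K \<noteq> {}" by (auto simp: prin_eig_def bot_ennreal)
  then obtain f where "f \<in> unit_state K" by blast
  then have "ip f f = 1" "\<And>y. f y = 0" using \<open>K = {}\<close> by (auto simp: unit_state_def)
  then show False by simp
qed

text \<open>Vectors are eliminated from the last to the first. The nonempty symmetric convex set
  left at the end contains 0, the empty sum, and on the way back \<open>window_1_sign\<close> picks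
  one sign at a time.\<close>

theorem komlos_class_signs:
  fixes K :: "'a::euclidean_space set" and v :: "nat \<Rightarrow> 'a"
  assumes "open K" "convex K" "bounded K" "\<And>x. x \<in> K \<Longrightarrow> - x \<in> K" "komlos_class (v ` {1..n}) K"
  shows "\<exists>\<epsilon> :: nat \<Rightarrow> real. (\<forall>j\<in>{1..n}. \<epsilon> j \<in> {-1, 1}) \<and> (\<Sum>j=1..n. \<epsilon> j *\<^sub>R v j) \<in> K"
  using assms
proof (induction n arbitrary: K)
  case 0
  then obtain x where x: "x \<in> K" using komlos_class_nonempty by blast
  have "(1/2) *\<^sub>R x + (1/2) *\<^sub>R (- x) \<in> K"
    by (rule convexD[OF 0(2) x 0(4)[OF x]]) auto
  then show ?case by simp
next
  case (Suc n)
  let ?w = "v (Suc n)"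
  have "komlos_class (insert ?w (v ` {1..n})) K"
    using Suc.prems(5) by (simp add: atLeastAtMostSuc_conv)
  then have "komlos_class (v ` {1..n}) (window K ?w 1)"
    by (rule komlos_class_window[OF Suc.prems(1-3)])
  moreover have "- x \<in> window K ?w 1" if "x \<in> window K ?w 1" for x
    by (rule window_symmetric[OF Suc.prems(4) that])
  ultimately obtain \<epsilon> :: "nat \<Rightarrow> real" where \<epsilon>: "\<forall>j\<in>{1..n}. \<epsilon> j \<in> {-1, 1}" "(\<Sum>j=1..n. \<epsilon> j *\<^sub>R v j) \<in> window K ?w 1"
    using Suc.IH[OF open_window[OF Suc.prems(1)] convex_window[OF Suc.prems(2)] bounded_window[OF Suc.prems(3)]] by blast
  obtain s :: real where s: "s \<in> {-1, 1}" "(\<Sum>j=1..n. \<epsilon> j *\<^sub>R v j) + s *\<^sub>R ?w \<in> K"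
    using window_1_sign[OF Suc.prems(2) \<epsilon>(2)] by (metis diff_conv_add_uminus insertI1 insert_subset scaleR_minus1_left scaleR_one subset_insertI)
  have "(\<Sum>j=1..Suc n. (\<epsilon>(Suc n := s)) j *\<^sub>R v j) = (\<Sum>j=1..n. \<epsilon> j *\<^sub>R v j) + s *\<^sub>R ?w"
  proof -
    have "(\<Sum>j=1..n. fun_upd \<epsilon> (Suc n) s j *\<^sub>R v j) = (\<Sum>j=1..n. \<epsilon> j *\<^sub>R v j)"
      by (intro sum.cong) auto
    then show ?thesis by simp
  qed
  then show ?case using \<epsilon>(1) s
    by (intro exI[of _ "fun_upd \<epsilon> (Suc n) s"]) auto
qed

section \<open>The cube\<close>

text \<open>The normalised Dirichlet ground state of the interval; its eigenvalue
  \<open>1/36\<close> is the constant in \<open>komlos_class\<close>.\<close>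

definition bump :: "real \<Rightarrow> real" where
  "bump t = indicator {-(3 * pi)<..<3 * pi} t * (cos (t / 6) / sqrt (3 * pi))"

lemma bump_nonneg: "0 \<le> bump t"
  by (auto simp: bump_def indicator_def intro!: divide_nonneg_nonneg cos_ge_zero)

lemma bump_le: "bump t \<le> 1 / sqrt (3 * pi)"
  by (auto simp: bump_def indicator_def intro!: divide_right_mono)

lemma measurable_bump[measurable]: "bump \<in> borel_measurable borel"
  unfolding bump_def[abs_def] by measurable

text \<open>The product of the unrestricted cosines, integrated over the whole interval, is the
  comparison integral for the correlation of \<open>bump\<close>. The antiderivative comes from the
  addition and double-angle formulas.\<close>

lemma cos_product_integral:
  "integrable lborel (\<lambda>t. cos (t / 6) * cos ((t + s) / 6) / (3 * pi) * indicator {-(3 * pi)..3 * pi} t)"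
  "(\<integral>t. cos (t / 6) * cos ((t + s) / 6) / (3 * pi) * indicator {-(3 * pi)..3 * pi} t \<partial>lborel) = cos (s / 6)"
proof -
  define F where "F t = (cos (s / 6) * (t / 2 + 3 / 2 * sin (t / 3)) + sin (s / 6) * (3 / 2 * cos (t / 3))) / (3 * pi)" for t
  have der: "(F has_real_derivative cos (t / 6) * cos ((t + s) / 6) / (3 * pi)) (at t)" for t
  proof -
    have "cos (t / 6) * cos ((t + s) / 6) = cos (s / 6) * (1 / 2 + 1 / 2 * cos (t / 3)) - sin (s / 6) * (1 / 2 * sin (t / 3))"
    proof -
      have d: "t / 3 = 2 * (t / 6)" by simp
      have c: "cos (t / 3) = 2 * (cos (t / 6))\<^sup>2 - 1" unfolding d by (rule cos_double_cos)
      have sn: "sin (t / 3) = 2 * sin (t / 6) * cos (t / 6)" unfolding d by (rule sin_double)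
      have a: "cos ((t + s) / 6) = cos (t / 6) * cos (s / 6) - sin (t / 6) * sin (s / 6)"
        by (simp add: add_divide_distrib cos_add)
      show ?thesis unfolding a c sn by (simp add: power2_eq_square algebra_simps)
    qed
    moreover have "(F has_real_derivative (cos (s / 6) * (1 / 2 + 1 / 2 * cos (t / 3)) - sin (s / 6) * (1 / 2 * sin (t / 3))) / (3 * pi)) (at t)"
      unfolding F_def by (auto intro!: derivative_eq_intros simp: field_simps)
    ultimately show ?thesis by simp
  qed
  have cont: "isCont (\<lambda>t. cos (t / 6) * cos ((t + s) / 6) / (3 * pi)) t" for t
    by (intro continuous_intros) auto
  show "integrable lborel (\<lambda>t. cos (t / 6) * cos ((t + s) / 6) / (3 * pi) * indicator {-(3 * pi)..3 * pi} t)"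
    using has_bochner_integral_FTC_Icc_real[of "-(3 * pi)" "3 * pi" F, OF _ der cont] by (auto simp: has_bochner_integral_iff)
  have "(\<integral>t. cos (t / 6) * cos ((t + s) / 6) / (3 * pi) * indicator {-(3 * pi)..3 * pi} t \<partial>lborel) = F (3 * pi) - F (- (3 * pi))"
    by (rule integral_FTC_Icc_real[OF _ der cont]) simp
  also have "\<dots> = cos (s / 6)" unfolding F_def by (simp add: field_simps)
  finally show "(\<integral>t. cos (t / 6) * cos ((t + s) / 6) / (3 * pi) * indicator {-(3 * pi)..3 * pi} t \<partial>lborel) = cos (s / 6)" .
qed

lemma cos_ge_parabola: "1 - x\<^sup>2 / 2 \<le> cos (x::real)"
proof -
  have "(sin (x / 2))\<^sup>2 \<le> (x / 2)\<^sup>2"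
    using abs_sin_x_le_abs_x[of "x / 2"] by (simp only: abs_le_square_iff)
  moreover have "cos x = 1 - 2 * (sin (x / 2))\<^sup>2" using cos_double_sin[of "x / 2"] by simp
  ultimately show ?thesis by (simp add: power_divide)
qed

lemma integrable_bump_product: "integrable lborel (\<lambda>t. bump t * bump (t + s))"
proof (rule Bochner_Integration.integrable_bound[where f="\<lambda>t. 1 / (3 * pi) * indicator {-(3 * pi)<..<3 * pi} t"])
  show "AE t in lborel. norm (bump t * bump (t + s)) \<le> norm (1 / (3 * pi) * indicator {-(3 * pi)<..<3 * pi} t :: real)"
  proof (rule AE_I2)
    fix t
    show "norm (bump t * bump (t + s)) \<le> norm (1 / (3 * pi) * indicator {-(3 * pi)<..<3 * pi} t :: real)"
    proof (cases "t \<in> {-(3 * pi)<..<3 * pi}")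
      case True
      have "bump t * bump (t + s) \<le> 1 / sqrt (3 * pi) * (1 / sqrt (3 * pi))"
        by (intro mult_mono bump_le bump_nonneg) auto
      then show ?thesis using True by (simp add: bump_nonneg)
    qed (simp add: bump_def)
  qed
qed auto

lemma bump_square_integral: "(\<integral>\<^sup>+t. ennreal ((bump t)\<^sup>2) \<partial>lborel) = 1"
proof -
  have "(\<integral>\<^sup>+t. ennreal ((bump t)\<^sup>2) \<partial>lborel) = ennreal (\<integral>t. bump t * bump (t + 0) \<partial>lborel)"
    using integrable_bump_product[of 0] by (subst nn_integral_eq_integral[symmetric]) (auto simp: power2_eq_square)
  also have "(\<integral>t. bump t * bump (t + 0) \<partial>lborel)
    = (\<integral>t. cos (t / 6) * cos ((t + 0) / 6) / (3 * pi) * indicator {-(3 * pi)..3 * pi} t \<partial>lborel)"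
  proof (rule Bochner_Integration.integral_cong[OF refl])
    fix t
    consider "t = 3 * pi" | "t = - (3 * pi)" | "t \<in> {-(3 * pi)<..<3 * pi}" | "t \<notin> {-(3 * pi)..3 * pi}" by fastforce
    then show "bump t * bump (t + 0) = cos (t / 6) * cos ((t + 0) / 6) / (3 * pi) * indicator {-(3 * pi)..3 * pi} t"
      by cases (auto simp: bump_def)
  qed
  also have "\<dots> = 1" unfolding cos_product_integral(2) by simp
  finally show ?thesis by simp
qed

text \<open>If \<open>s^2 \<le> 72\<close>, then \<open>|s| \<le> 3 * pi\<close>, and a point that
  leaves the interval under the shift has a nonpositive cosine product. So the integral over the
  whole interval is a lower bound for the correlation, and its value \<open>cos (s / 6)\<close> is
  at least \<open>1 - s^2 / 72\<close>. For larger \<open>s\<close> the left side is 0 in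
  \<open>ennreal\<close>.\<close>

lemma bump_correlation_ge: "ennreal (1 - s\<^sup>2 / 72) \<le> (\<integral>\<^sup>+t. ennreal (bump t) * ennreal (bump (t + s)) \<partial>lborel)"
proof (cases "s\<^sup>2 \<le> 72")
  case True
  have "\<bar>s\<bar>\<^sup>2 \<le> 9\<^sup>2" using True by simp
  then have s9: "\<bar>s\<bar> \<le> 9" by (rule power2_le_imp_le) simp
  have s3: "\<bar>s\<bar> \<le> 3 * pi" using s9 pi_gt3 by linarith
  have "1 - s\<^sup>2 / 72 \<le> cos (s / 6)" using cos_ge_parabola[of "s / 6"] by (simp add: power_divide)
  also have "cos (s / 6) = (\<integral>t. cos (t / 6) * cos ((t + s) / 6) / (3 * pi) * indicator {-(3 * pi)..3 * pi} t \<partial>lborel)"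
    by (rule cos_product_integral(2)[symmetric])
  also have "\<dots> \<le> (\<integral>t. bump t * bump (t + s) \<partial>lborel)"
  proof (rule integral_mono[OF cos_product_integral(1) integrable_bump_product])
    fix t
    show "cos (t / 6) * cos ((t + s) / 6) / (3 * pi) * indicator {-(3 * pi)..3 * pi} t \<le> bump t * bump (t + s)"
    proof (cases "t \<in> {-(3 * pi)<..<3 * pi}")
      case True
      then have c: "0 \<le> cos (t / 6)" by (auto intro!: cos_ge_zero)
      show ?thesis
      proof (cases "t + s \<in> {-(3 * pi)<..<3 * pi}")
        case ts: True
        then show ?thesis using True by (simp add: bump_def)
      next
        case False
        have "cos ((t + s) / 6) \<le> 0"
        proof -
          have "cos \<bar>(t + s) / 6\<bar> \<le> 0"
          proof -
            have e: "\<bar>(t + s) / 6\<bar> = \<bar>t + s\<bar> / 6" by simp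
            have "3 * pi \<le> \<bar>t + s\<bar>" using False unfolding greaterThanLessThan_iff by linarith
            then have "3 * pi / 6 \<le> \<bar>t + s\<bar> / 6" by (rule divide_right_mono) simp
            then have "pi / 2 \<le> \<bar>(t + s) / 6\<bar>" unfolding e by simp
            moreover have "\<bar>t + s\<bar> \<le> 6 * pi" using True s3 unfolding greaterThanLessThan_iff by linarith
            then have "\<bar>(t + s) / 6\<bar> \<le> pi" unfolding e by simp
            ultimately have "cos \<bar>(t + s) / 6\<bar> \<le> cos (pi / 2)" by (intro cos_monotone_0_pi_le) auto
            then show ?thesis by simp
          qed
          then show ?thesis by (simp only: cos_abs_real)
        qed
        then have "cos (t / 6) * cos ((t + s) / 6) / (3 * pi) \<le> 0"
          using c by (intro divide_nonpos_nonneg mult_nonneg_nonpos) auto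
        then have "cos (t / 6) * cos ((t + s) / 6) / (3 * pi) * indicator {-(3 * pi)..3 * pi} t \<le> 0"
          by (rule mult_nonpos_nonneg) simp
        also have "0 \<le> bump t * bump (t + s)" by (intro mult_nonneg_nonneg bump_nonneg)
        finally show ?thesis .
      qed
    next
      case False
      consider "t = 3 * pi" | "t = - (3 * pi)" | "t \<notin> {-(3 * pi)..3 * pi}" using False by fastforce
      then show ?thesis by cases (auto simp: bump_def)
    qed
  qed
  finally have "1 - s\<^sup>2 / 72 \<le> (\<integral>t. bump t * bump (t + s) \<partial>lborel)" .
  then have "ennreal (1 - s\<^sup>2 / 72) \<le> ennreal (\<integral>t. bump t * bump (t + s) \<partial>lborel)" by (rule ennreal_leI)
  also have "\<dots> = (\<integral>\<^sup>+t. ennreal (bump t) * ennreal (bump (t + s)) \<partial>lborel)"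
    using integrable_bump_product[of s] by (subst nn_integral_eq_integral[symmetric]) (auto simp: bump_nonneg ennreal_mult)
  finally show ?thesis .
next
  case False
  then show ?thesis by (simp add: ennreal_neg)
qed

text \<open>The Weierstrass product inequality. It turns coordinatewise bounds into a bound by the
  Euclidean norm whose constant does not depend on the dimension.\<close>

lemma one_minus_sum_le_prod:
  fixes a :: "'b \<Rightarrow> real"
  assumes "finite A" "\<And>x. x \<in> A \<Longrightarrow> 0 \<le> a x" "\<And>x. x \<in> A \<Longrightarrow> a x \<le> 1"
  shows "1 - (\<Sum>x\<in>A. a x) \<le> (\<Prod>x\<in>A. 1 - a x)"
  using assms
proof (induction A)
  case (insert x A)
  have p: "(\<Prod>x\<in>A. 1 - a x) \<le> 1" "0 \<le> (\<Prod>x\<in>A. 1 - a x)"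
    using insert.prems by (auto intro!: prod_le_1 prod_nonneg)
  have "a x * (\<Prod>x\<in>A. 1 - a x) \<le> a x * 1" using insert.prems p by (intro mult_left_mono) auto
  moreover have "1 - (\<Sum>x\<in>A. a x) \<le> (\<Prod>x\<in>A. 1 - a x)" using insert by auto
  ultimately have "1 - (a x + (\<Sum>x\<in>A. a x)) \<le> (1 - a x) * (\<Prod>x\<in>A. 1 - a x)"
    unfolding left_diff_distrib by linarith
  then show ?case using insert.hyps by simp
qed simp

lemma prod_mono_ennreal:
  fixes f g :: "'b \<Rightarrow> ennreal"
  assumes "\<And>x. x \<in> A \<Longrightarrow> f x \<le> g x"
  shows "prod f A \<le> prod g A"
  using assms by (induction A rule: infinite_finite_induct) (auto intro!: mult_mono)

section \<open>The product state on the cube\<close>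

lemma infnorm_less_iff: "infnorm x < r \<longleftrightarrow> (\<forall>b\<in>Basis. \<bar>x \<bullet> b\<bar> < r)" for x :: "'a::euclidean_space"
  by (simp add: infnorm_Max)

lemma cube_eq_box: "{x::'a::euclidean_space. infnorm x < r} = box (- r *\<^sub>R One) (r *\<^sub>R One)"
proof -
  have "\<bar>a\<bar> < r \<longleftrightarrow> - r < a \<and> a < r" for a by linarith
  then show ?thesis by (simp add: set_eq_iff infnorm_less_iff mem_box)
qed

definition cube_state :: "'a::euclidean_space \<Rightarrow> ennreal" where
  "cube_state y = (\<Prod>b\<in>Basis. ennreal (bump (y \<bullet> b)))"

lemma cube_state_unit_state: "cube_state \<in> unit_state {x::'a::euclidean_space. infnorm x < 3 * pi}"
proof -
  have "cube_state \<in> borel_measurable (borel :: 'a measure)" unfolding cube_state_def[abs_def] by measurable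
  moreover have "cube_state y = 0" if y: "\<not> infnorm y < 3 * pi" for y :: 'a
  proof -
    obtain b :: 'a where "b \<in> Basis" "\<not> \<bar>y \<bullet> b\<bar> < 3 * pi" using y unfolding infnorm_less_iff by blast
    then have "bump (y \<bullet> b) = 0" by (auto simp: bump_def indicator_def abs_less_iff)
    then show ?thesis unfolding cube_state_def using \<open>b \<in> Basis\<close> by (intro prod_zero bexI[of _ b]) auto
  qed
  moreover have "cube_state y \<le> ennreal 1" for y :: 'a
  proof -
    have "1 \<le> sqrt (3 * pi)" using pi_gt3 by simp
    then have "bump t \<le> 1" for t using bump_le[of t] by (simp add: order_trans divide_le_eq)
    then have "cube_state y \<le> (\<Prod>b\<in>(Basis :: 'a set). 1)"
      unfolding cube_state_def by (intro prod_mono_ennreal) simp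
    then show ?thesis by simp
  qed
  moreover have "ip cube_state (cube_state :: 'a \<Rightarrow> ennreal) = 1"
  proof -
    have "ip cube_state (cube_state :: 'a \<Rightarrow> ennreal) = (\<integral>\<^sup>+y. (\<Prod>b\<in>Basis. ennreal ((bump (y \<bullet> b))\<^sup>2)) \<partial>(lborel :: 'a measure))"
      by (simp add: cube_state_def prod.distrib[symmetric] ennreal_mult bump_nonneg power2_eq_square)
    also have "\<dots> = (\<Prod>b\<in>(Basis :: 'a set). \<integral>\<^sup>+t. ennreal ((bump t)\<^sup>2) \<partial>lborel)"
      by (rule nn_integral_lborel_prod) auto
    finally show ?thesis by (simp add: bump_square_integral)
  qed
  ultimately show ?thesis unfolding unit_state_def by blast
qed

text \<open>The autocorrelation of a product state factors over the coordinates. If one coordinate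
  is so large that its factor bound is negative, the left side is 0.\<close>

lemma autocorr_cube_state_ge: "ennreal (1 - (norm z)\<^sup>2 / 72) \<le> autocorr cube_state (z :: 'a::euclidean_space)"
proof (cases "\<forall>b\<in>Basis. (z \<bullet> b)\<^sup>2 / 72 \<le> 1")
  case True
  have "(norm z)\<^sup>2 = (\<Sum>b\<in>Basis. (z \<bullet> b)\<^sup>2)"
    unfolding power2_norm_eq_inner by (subst euclidean_inner) (simp add: power2_eq_square)
  then have "1 - (norm z)\<^sup>2 / 72 = 1 - (\<Sum>b\<in>Basis. (z \<bullet> b)\<^sup>2 / 72)" by (simp add: sum_divide_distrib)
  also have "\<dots> \<le> (\<Prod>b\<in>Basis. 1 - (z \<bullet> b)\<^sup>2 / 72)" using True by (intro one_minus_sum_le_prod) auto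
  finally have "ennreal (1 - (norm z)\<^sup>2 / 72) \<le> ennreal (\<Prod>b\<in>Basis. 1 - (z \<bullet> b)\<^sup>2 / 72)" by (rule ennreal_leI)
  also have "\<dots> = (\<Prod>b\<in>Basis. ennreal (1 - (z \<bullet> b)\<^sup>2 / 72))" using True by (subst prod_ennreal) auto
  also have "\<dots> \<le> (\<Prod>b\<in>Basis. \<integral>\<^sup>+t. ennreal (bump t) * ennreal (bump (t + z \<bullet> b)) \<partial>lborel)"
    by (intro prod_mono_ennreal bump_correlation_ge)
  also have "\<dots> = (\<integral>\<^sup>+y. (\<Prod>b\<in>Basis. ennreal (bump (y \<bullet> b)) * ennreal (bump (y \<bullet> b + z \<bullet> b))) \<partial>(lborel :: 'a measure))"
    by (rule nn_integral_lborel_prod[symmetric]) auto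
  also have "\<dots> = autocorr cube_state z"
    by (simp add: autocorr_def cube_state_def prod.distrib inner_add_left)
  finally show ?thesis .
next
  case False
  then obtain b :: 'a where b: "b \<in> Basis" "1 < (z \<bullet> b)\<^sup>2 / 72" by (auto simp: not_le)
  have "\<bar>z \<bullet> b\<bar>\<^sup>2 \<le> (norm z)\<^sup>2" using Basis_le_norm[OF b(1)] by (intro power_mono) auto
  then have "1 - (norm z)\<^sup>2 / 72 \<le> 0" using b(2) by simp
  then show ?thesis by (simp add: ennreal_neg)
qed

text \<open>\<open>prin_eig_ge_of_autocorr\<close> yields \<open>1 - cost L / 36\<close>, which
  agrees with the exponential to first order. Scaling by halves upgrades it to the
  exponential.\<close>

lemma komlos_class_cube:
  assumes V: "\<And>v. v \<in> V \<Longrightarrow> norm v \<le> 1"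
  shows "komlos_class V {x::'a::euclidean_space. infnorm x < 3 * pi}"
  unfolding komlos_class_def
proof (intro allI impI)
  fix L :: "('a \<times> real) list"
  assume L: "\<forall>p\<in>set L. fst p \<in> V \<and> 0 \<le> snd p"
  let ?K = "{x::'a. infnorm x < 3 * pi}"
  have lin: "ennreal (1 - cost L / 36) \<le> prin_eig L ?K" if L: "\<forall>p\<in>set L. fst p \<in> V \<and> 0 \<le> snd p" for L
  proof -
    let ?S = "\<Sum>p\<leftarrow>L. 2 * snd p * (norm (fst p))\<^sup>2"
    have "?S \<le> (\<Sum>p\<leftarrow>L. 2 * snd p)"
    proof (rule sum_list_mono)
      fix p assume "p \<in> set L"
      then have "(norm (fst p))\<^sup>2 \<le> 1" "0 \<le> snd p" using L V by (auto simp: power_le_one)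
      then have "2 * snd p * (norm (fst p))\<^sup>2 \<le> 2 * snd p * 1" by (intro mult_left_mono) auto
      then show "2 * snd p * (norm (fst p))\<^sup>2 \<le> 2 * snd p" by simp
    qed
    then have "ennreal (1 - cost L / 36) \<le> ennreal (1 - 1/72 * ?S)" by (intro ennreal_leI) (simp add: sum_list_const_mult)
    also have "\<dots> \<le> prin_eig L ?K"
      by (rule prin_eig_ge_of_autocorr[OF cube_state_unit_state]) (use autocorr_cube_state_ge L in auto)
    finally show ?thesis .
  qed
  have "ennreal (exp (- (cost L / 36))) \<le> prin_eig L ?K"
  proof (rule prin_eig_ge_of_halve_pow)
    fix \<epsilon> :: real assume \<epsilon>: "0 < \<epsilon>"
    define c where "c = cost L / 36"
    have c: "0 \<le> c" unfolding c_def using L by (intro divide_nonneg_nonneg sum_list_nonneg) auto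
    \<comment> \<open>This \<open>m\<close> makes \<open>y \<le> 1/2\<close>, as the logarithm bound
      requires, and its error \<open>2 * y\<^sup>2\<close> at most
      \<open>\<epsilon> / 2 ^ m\<close>.\<close>
    obtain m where m: "(2 * c + 2 * c\<^sup>2 / \<epsilon>) / 2 ^ m \<le> 1" using exists_large_power_2[of 1 "2 * c + 2 * c\<^sup>2 / \<epsilon>"] by auto
    define y where "y = c / 2 ^ m"
    have m': "2 * c + 2 * c\<^sup>2 / \<epsilon> \<le> 2 ^ m" using m by simp
    have "0 \<le> 2 * c\<^sup>2 / \<epsilon>" using \<epsilon> by simp
    then have y: "0 \<le> y" "y \<le> 1/2" using m' c by (auto simp: y_def divide_le_eq)
    have "2 * c\<^sup>2 \<le> \<epsilon> * 2 ^ m"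
    proof -
      have "2 * c\<^sup>2 / \<epsilon> \<le> 2 ^ m" using m' c by simp
      then show ?thesis using \<epsilon> by (simp add: divide_le_eq mult.commute)
    qed
    then have y2: "2 * y\<^sup>2 \<le> \<epsilon> / 2 ^ m"
      by (simp add: y_def power_divide field_simps power2_eq_square)
    let ?Lm = "(halve ^^ m) L"
    have "cost ?Lm / 36 = y" by (simp add: cost_halve_pow y_def c_def)
    then have le: "ennreal (1 - y) \<le> prin_eig ?Lm ?K" using lin[OF halve_pow[OF L, of m]] by simp
    have "- (c + \<epsilon>) / 2 ^ m \<le> - y - 2 * y\<^sup>2" using y2 by (simp add: y_def add_divide_distrib diff_divide_distrib)
    also have "\<dots> \<le> ln (1 - y)" using y by (intro ln_one_minus_pos_lower_bound) auto
    finally have "exp (- (c + \<epsilon>) / 2 ^ m) \<le> exp (ln (1 - y))" by simp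
    also have "\<dots> = 1 - y" using y by simp
    finally have "ennreal (exp (- (c + \<epsilon>) / 2 ^ m)) \<le> prin_eig ?Lm ?K" by (rule order_trans[OF ennreal_leI le])
    then show "\<exists>m. ennreal (exp (- (cost L / 36 + \<epsilon>) / 2 ^ m)) \<le> prin_eig ((halve ^^ m) L) ?K"
      unfolding c_def by blast
  qed
  then show "ennreal (exp (- cost L / 36)) \<le> prin_eig L ?K" by simp
qed

theorem theorem2p1:
  fixes n :: nat and v :: "nat \<Rightarrow> real ^ 'd"
  assumes "n \<ge> 1"
    and "\<And>j. j \<in> {1..n} \<Longrightarrow> norm (v j) \<le> 1"
  shows "\<exists>\<epsilon> :: nat \<Rightarrow> real.
           (\<forall>j\<in>{1..n}. \<epsilon> j \<in> {-1, 1}) \<and>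
           infnorm (\<Sum>j=1..n. \<epsilon> j *\<^sub>R v j) < 3 * pi"
proof -
  let ?K = "{x :: real ^ 'd. infnorm x < 3 * pi}"
  have "komlos_class (v ` {1..n}) ?K" by (rule komlos_class_cube) (use assms(2) in auto)
  \<comment> \<open>The cube is taken open, so membership in it is the strict inequality of the
    conclusion.\<close>
  moreover have "open ?K" "convex ?K" "bounded ?K" unfolding cube_eq_box by (auto simp: convex_box)
  ultimately have "\<exists>\<epsilon> :: nat \<Rightarrow> real. (\<forall>j\<in>{1..n}. \<epsilon> j \<in> {-1, 1}) \<and> (\<Sum>j=1..n. \<epsilon> j *\<^sub>R v j) \<in> ?K"
    by (intro komlos_class_signs) (auto simp: infnorm_neg)
  then show ?thesis by simp
qed

end
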